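(* Let $f\in L^p(\mathbb{R}^n)$, where $p\in[1,n)$ or $n=p=1$. Let $U\colon[0,\infty)\to[0,\infty)$ be a strictly increasing continuous function such that $U(0)=0$, $\lim_{t\to\infty}U(t)=\infty$, and there are positive constants $a,r$ such that $U(t)\le at^p$ whenever $0<t<r$. Assume that there is a number $N>0$ such that $$ \int_N^{+\infty}t^{-1-p}\,U\bigl(C(n,p)\,t\,\sigma_p(f,t^{-p/n})\bigr)\,dt<\infty, $$ where $C(n,p)=1+\nu_n^{-1/p}(n/p-1)^{1/p-1}$ for $p\in[1,n)$, $\nu_n$ is the surface area of the unit sphere in $\mathbb{R}^n$, and $C(1,1)=1$. Then $$ \int_{\mathbb{R}^n}U(|f(x)|)\,dx<\infty. $$
   Context: Functions are real-valued; $L^p$-norms $\|\cdot\|_p$ are with respect to Lebesgue measure on $\mathbb{R}^n$, $q=p/(p-1)$ ($q=\infty$ if $p=1$), and for a vector field $\Phi$, $\|\Phi\|_q$ is the $L^q$-norm of its Euclidean norm $|\Phi|$. For $f\in L^p(\mathbb{R}^n)$ and $\varepsilon>0$, $$\sigma_p(f,\varepsilon):=\sup\Bigl\{\int_{\mathbb{R}^n}\mathrm{div}\,\Phi(x) f(x)\,dx:\ \Phi\in C_0^\infty(\mathbb{R}^n,\mathbb{R}^n),\ \|\mathrm{div}\,\Phi\|_q\le 1,\ \|\Phi\|_q\le\varepsilon\Bigr\},$$ where $C_0^\infty(\mathbb{R}^n,\mathbb{R}^n)$ is the set of infinitely differentiable compactly supported vector fields. *)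

theory Defs
  imports "HOL-Analysis.Analysis" "HOL-Probability.Essential_Supremum"
begin

text \<open>
  Continuously differentiable \<open>k\<close> times on the whole space: all iterated directional derivatives
  of order less than \<open>k\<close> are (Frechet) differentiable, those of order \<open>k\<close> are continuous.
\<close>

primrec Ck :: "nat \<Rightarrow> ('a::euclidean_space \<Rightarrow> 'b::real_normed_vector) \<Rightarrow> bool" where
  "Ck 0 g \<longleftrightarrow> continuous_on UNIV g"
| "Ck (Suc k) g \<longleftrightarrow> (\<forall>x. g differentiable (at x)) \<and>
     (\<forall>v. Ck k (\<lambda>x. frechet_derivative g (at x) v))"

definition Cinf_compact :: "('a::euclidean_space \<Rightarrow> 'b::real_normed_vector) set" where
  "Cinf_compact = {g. (\<forall>k. Ck k g) \<and> compact (closure {x. g x \<noteq> 0})}"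

definition divergence :: "('a::euclidean_space \<Rightarrow> 'a) \<Rightarrow> 'a \<Rightarrow> real" where
  "divergence \<Phi> x = (\<Sum>b\<in>Basis. frechet_derivative \<Phi> (at x) b \<bullet> b)"

text \<open>
  The value is \<open>\<infinity>\<close> when the integral diverges; the case distinction is needed because \<open>powr\<close> is not
  available on the extended reals. Exponents are meant to lie in \<open>[1, \<infinity>]\<close>.
\<close>

definition Lp_norm :: "ereal \<Rightarrow> ('a::euclidean_space \<Rightarrow> 'b::real_normed_vector) \<Rightarrow> ereal" where
  "Lp_norm q g =
     (if q = \<infinity> then esssup lebesgue (\<lambda>x. ereal (norm (g x)))
      else let I = (\<integral>\<^sup>+ x. ennreal (norm (g x) powr real_of_ereal q) \<partial>lebesgue)
           in if I = \<infinity> then \<infinity> else ereal (enn2real I powr (1 / real_of_ereal q)))"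

definition Lp_space :: "ereal \<Rightarrow> ('a::euclidean_space \<Rightarrow> real) set" where
  "Lp_space q = {g \<in> borel_measurable lebesgue. Lp_norm q g < \<infinity>}"

definition conj_exponent :: "real \<Rightarrow> ereal" where
  "conj_exponent p = (if p = 1 then \<infinity> else ereal (p / (p - 1)))"

text \<open>
  For \<open>f\<close> in \<open>L\<^sup>p\<close> the supremum is over a nonempty set of reals (it contains \<open>0\<close>) that is bounded
  above by the \<open>L\<^sup>p\<close>-norm of \<open>f\<close>, by Hoelder's inequality.
\<close>

definition sigma_mod :: "real \<Rightarrow> ('a::euclidean_space \<Rightarrow> real) \<Rightarrow> real \<Rightarrow> real" where
  "sigma_mod p f \<epsilon> = Sup {(\<integral>x. divergence \<Phi> x * f x \<partial>lebesgue) | \<Phi>.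
     \<Phi> \<in> Cinf_compact \<and>
     Lp_norm (conj_exponent p) (divergence \<Phi>) \<le> 1 \<and>
     Lp_norm (conj_exponent p) \<Phi> \<le> ereal \<epsilon>}"

text \<open>
  Surface measure on the unit sphere, as in the polar coordinate formula: \<open>n\<close> times the volume of
  the cone over \<open>A\<close> with vertex \<open>0\<close>.
\<close>

definition sphere_measure :: "'a::euclidean_space set \<Rightarrow> real" where
  "sphere_measure A =
     real DIM('a) * measure lebesgue {r *\<^sub>R x | r x. 0 < r \<and> r \<le> 1 \<and> x \<in> A}"

definition unit_sphere_area :: "'a::euclidean_space itself \<Rightarrow> real" where
  "unit_sphere_area _ = sphere_measure (sphere (0::'a) 1)"

lemma unit_sphere_area_eq:
  "unit_sphere_area TYPE('a::euclidean_space) =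
     2 * pi powr (real DIM('a) / 2) / Gamma (real DIM('a) / 2)"
proof -
  have eq: "{r *\<^sub>R x | r x. 0 < r \<and> r \<le> 1 \<and> x \<in> sphere (0::'a) 1} = cball 0 1 - {0}"
  proof (intro equalityI subsetI)
    fix y :: 'a assume "y \<in> cball 0 1 - {0}"
    then have "y = norm y *\<^sub>R (y /\<^sub>R norm y)" "0 < norm y" "norm y \<le> 1"
      "y /\<^sub>R norm y \<in> sphere 0 1" by auto
    then show "y \<in> {r *\<^sub>R x | r x. 0 < r \<and> r \<le> 1 \<and> x \<in> sphere (0::'a) 1}" by blast
  qed auto
  have "measure lebesgue (cball (0::'a) 1 - {0}) = measure lebesgue (cball (0::'a) 1)"
    by (intro measure_negligible_symdiff) (auto intro: negligible_subset[of "{0}"])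
  also have "\<dots> = unit_ball_vol (real DIM('a))"
    using content_cball[of 1 "0::'a"] by simp
  finally have "unit_sphere_area TYPE('a) = real DIM('a) * unit_ball_vol (real DIM('a))"
    unfolding unit_sphere_area_def sphere_measure_def eq by simp
  moreover have "Gamma (real DIM('a) / 2 + 1) = real DIM('a) / 2 * Gamma (real DIM('a) / 2)"
    by (rule Gamma_plus1) (use nonpos_Ints_nonpos[of "real DIM('a) / 2"] in auto)
  ultimately show ?thesis
    by (simp add: unit_ball_vol_def)
qed

definition const_C :: "'a::euclidean_space itself \<Rightarrow> real \<Rightarrow> real" where
  "const_C T p = (if DIM('a) = 1 \<and> p = 1 then 1
     else 1 + unit_sphere_area T powr (- 1 / p) * (real DIM('a) / p - 1) powr (1 / p - 1))"

end

theory Submission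
  imports Defs
begin

text \<open>
  If \<open>|f| > h\<close> on a set of measure \<open>m\<close>, test \<open>\<sigma>\<^sub>p\<close> with \<open>\<Phi> = g * K\<close>, where \<open>g\<close> approximates \<open>sgn f\<close> on
  that set and \<open>K\<close> is a smoothly truncated Newton kernel \<open>x / |x|\<^sup>n\<close>. Then \<open>div \<Phi>\<close> is close to a multiple
  of \<open>g\<close>, and splitting \<open>K\<close> at radius \<open>m\<^bsup>1/n\<^esup>\<close> gives \<open>\<parallel>\<Phi>\<parallel>\<^sub>q \<le> L m\<^bsup>1/q + 1/n\<^esup>\<close> by Young's inequality; the
  outer part is in \<open>L\<^sup>q\<close> because \<open>p < n\<close>. This bounds \<open>h\<close> by \<open>t \<sigma>\<^sub>p(f, t\<^bsup>-p/n\<^esup>)\<close> as soon as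
  \<open>m > \<kappa> t\<^bsup>-p\<^esup>\<close>. The factor \<open>\<kappa>\<close> costs nothing in the final change of variables, and as it may be taken large
  when \<open>p < n\<close>, only \<open>C(n,p) \<ge> 1\<close> matters. The theorem follows by writing \<open>\<integral> U(|f|)\<close> through the level
  sets of \<open>U(|f|)\<close> and exchanging integrals; where \<open>|f|\<close> is small, \<open>U(|f|) \<le> a |f|\<^sup>p\<close>.
\<close>

section \<open>Functions of class \<open>C\<^sup>k\<close>\<close>

text \<open>Test fields must be smooth with compact support, while x / |x|^n is singular at 0, never
  vanishes elsewhere, and has a point mass as divergence. Replacing |x|^2 by |x|^2 + \<delta>^2
  keeps the divergence explicit (it becomes \<open>mollifier \<delta>\<close>), and the cutoff at
  radius R costs an error of L^q norm O(R^(-n/p)). For fixed g, R is chosen first and \<delta>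
  afterwards, since the domination used for \<delta> \<rightarrow> 0 depends on R; g tends to a
  difference of indicators only after that, because the resulting bound depends on g only through
  its mass m. Scaling: with c the mass of the mollifier, testing gives c h m \<le> max (c m^(1/q), L
  m^(1/q + 1/n) / \<epsilon>) \<sigma>_p(f, \<epsilon>). For \<epsilon> = t^(-p/n) and m > \<kappa>
  t^(-p) the quotient m^(1/n) / \<epsilon> exceeds \<kappa>^(1/n), so a large \<kappa> makes the
  second entry the maximum. Dividing by m leaves m^(-\<beta>) with \<beta> = 1/p - 1/n, and a large
  \<kappa> absorbs L / c if \<beta> > 0. At n = p = 1 this gain is absent, and the constants
  themselves have to fit.\<close>

lemma Ck_SucI:
  assumes "\<And>x. (g has_derivative g' x) (at x)" and "\<And>v. Ck k (\<lambda>x. g' x v)"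
  shows "Ck (Suc k) g"
proof -
  have "frechet_derivative g (at x) = g' x" for x
    using frechet_derivative_at[OF assms(1)] by simp
  with assms show ?thesis
    by (auto simp: differentiable_def)
qed

lemma Ck_Suc_ex_derivative:
  assumes "Ck (Suc k) g"
  shows "\<exists>g'. (\<forall>x. (g has_derivative g' x) (at x)) \<and> (\<forall>v. Ck k (\<lambda>x. g' x v))"
  using assms by (intro exI[of _ "\<lambda>x. frechet_derivative g (at x)"])
    (auto simp: frechet_derivative_works[symmetric])

lemma Ck_SucD: "Ck (Suc k) g \<Longrightarrow> Ck k g"
proof (induction k arbitrary: g)
  case 0
  then show ?case
    by (auto intro!: differentiable_imp_continuous_on simp: differentiable_on_def)
next
  case (Suc k)
  then show ?case by (metis Ck.simps(2))
qed

lemma Ck_imp_continuous_on: "Ck k g \<Longrightarrow> continuous_on A g"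
proof (induction k)
  case (Suc k)
  then show ?case using Ck_SucD by blast
qed (auto intro: continuous_on_subset)

lemma Ck_const: "Ck k (\<lambda>x. c)"
proof (induction k arbitrary: c)
  case (Suc k)
  show ?case by (rule Ck_SucI[OF has_derivative_const Suc])
qed auto

lemma Ck_bounded_linear:
  assumes "bounded_linear h" shows "Ck k h"
proof (cases k)
  case 0
  with assms show ?thesis by (simp add: linear_continuous_on)
next
  case (Suc j)
  show ?thesis
    unfolding Suc using bounded_linear_imp_has_derivative[OF assms] Ck_const by (rule Ck_SucI)
qed

lemma Ck_add: "Ck k f \<Longrightarrow> Ck k g \<Longrightarrow> Ck k (\<lambda>x. f x + g x)"
proof (induction k arbitrary: f g)
  case 0
  then show ?case by (auto intro: continuous_intros)
next
  case (Suc k)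
  obtain f' where f': "\<And>x. (f has_derivative f' x) (at x)" "\<And>v. Ck k (\<lambda>x. f' x v)"
    using Ck_Suc_ex_derivative[OF Suc.prems(1)] by blast
  obtain g' where g': "\<And>x. (g has_derivative g' x) (at x)" "\<And>v. Ck k (\<lambda>x. g' x v)"
    using Ck_Suc_ex_derivative[OF Suc.prems(2)] by blast
  show ?case
    by (rule Ck_SucI[OF has_derivative_add[OF f'(1) g'(1)]]) (intro Suc.IH f' g')
qed

lemma (in bounded_bilinear) Ck_prod: "Ck k f \<Longrightarrow> Ck k g \<Longrightarrow> Ck k (\<lambda>x. prod (f x) (g x))"
proof (induction k arbitrary: f g)
  case 0
  then show ?case by (auto intro: continuous_on)
next
  case (Suc k)
  obtain f' where f': "\<And>x. (f has_derivative f' x) (at x)" "\<And>v. Ck k (\<lambda>x. f' x v)"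
    using Ck_Suc_ex_derivative[OF Suc.prems(1)] by blast
  obtain g' where g': "\<And>x. (g has_derivative g' x) (at x)" "\<And>v. Ck k (\<lambda>x. g' x v)"
    using Ck_Suc_ex_derivative[OF Suc.prems(2)] by blast
  show ?case
    by (rule Ck_SucI[OF FDERIV[OF f'(1) g'(1)]])
       (intro Ck_add Suc.IH f' g' Suc.prems[THEN Ck_SucD])
qed

lemmas Ck_mult = bounded_bilinear.Ck_prod[OF bounded_bilinear_mult]
lemmas Ck_scaleR = bounded_bilinear.Ck_prod[OF bounded_bilinear_scaleR]
lemmas Ck_inner = bounded_bilinear.Ck_prod[OF bounded_bilinear_inner]

text \<open>The outer function comes with its whole sequence \<open>\<psi>\<close> of successive
  derivatives. Generalising the induction over \<open>j\<close> replaces a higher-order chain rule: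
  one differentiation raises \<open>j\<close> by one and leaves a product of two functions of the
  next lower class.\<close>

lemma Ck_compose_real:
  fixes \<psi> :: "nat \<Rightarrow> real \<Rightarrow> real"
  assumes "\<And>j y. y \<in> S \<Longrightarrow> (\<psi> j has_real_derivative \<psi> (Suc j) y) (at y)"
    and "Ck k u" and "\<And>x. u x \<in> S"
  shows "Ck k (\<lambda>x. \<psi> j (u x))"
  using assms(2)
proof (induction k arbitrary: j)
  case 0
  have "continuous_on S (\<psi> j)"
    by (meson assms(1) DERIV_isCont continuous_at_imp_continuous_on)
  with 0 assms(3) show ?case
    by (auto intro: continuous_on_compose2)
next
  case (Suc k)
  obtain u' where u': "\<And>x. (u has_derivative u' x) (at x)" "\<And>v. Ck k (\<lambda>x. u' x v)"
    using Ck_Suc_ex_derivative[OF Suc.prems] by blast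
  have "((\<lambda>x. \<psi> j (u x)) has_derivative (\<lambda>v. u' x v * \<psi> (Suc j) (u x))) (at x)" for x
    using DERIV_compose_FDERIV[OF assms(1)[OF assms(3)] u'(1)] by simp
  then show ?case
    by (rule Ck_SucI) (intro Ck_mult u' Suc.IH Ck_SucD[OF Suc.prems])
qed

text \<open>The derivative falls on \<open>K\<close>, so continuity of \<open>g\<close> is enough.
  Integrating over a box puts the differentiation under the integral sign on a compact
  domain.\<close>

lemma convolution_has_derivative:
  fixes K :: "'a::euclidean_space \<Rightarrow> 'b::banach" and g :: "'a \<Rightarrow> real"
  assumes g: "continuous_on UNIV g"
    and K': "\<And>x. (K has_derivative K' x) (at x)" and cK': "\<And>v. continuous_on UNIV (\<lambda>x. K' x v)"
  shows "((\<lambda>x. integral (cbox a b) (\<lambda>y. g y *\<^sub>R K (x - y))) has_derivative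
    (\<lambda>v. integral (cbox a b) (\<lambda>y. g y *\<^sub>R K' (x - y) v))) (at x)"
proof -
  define D where "D x y = g y *\<^sub>R Blinfun (K' (x - y))" for x y
  have bl: "bounded_linear (K' x)" for x
    using K' has_derivative_bounded_linear by blast
  have cK: "continuous_on A K" for A
    by (rule has_derivative_continuous_on) (rule has_derivative_at_withinI[OF K'])
  \<comment> \<open>The derivative is wanted as a continuous map into the bounded linear operators;
    in finite dimension this can be checked one direction at a time.\<close>
  have cB: "continuous_on UNIV (\<lambda>x. Blinfun (K' x))"
    by (rule continuous_on_blinfun_componentwise)
       (use cK' bl in \<open>simp add: bounded_linear_Blinfun_apply\<close>)
  have cD: "continuous_on A (\<lambda>z. D (fst z) (snd z))" for A
    unfolding D_def
    by (intro continuous_intros continuous_on_compose2[OF g] continuous_on_compose2[OF cB]) auto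
  have intf: "(\<lambda>y. g y *\<^sub>R K (x - y)) integrable_on cbox a b" for x
    by (intro integrable_continuous continuous_intros continuous_on_subset[OF g]
        continuous_on_compose2[OF cK[of UNIV]]) auto
  have intD: "D x integrable_on cbox a b"
  proof (rule integrable_continuous)
    have "continuous_on (cbox a b) (\<lambda>y. (x, y))"
      by (intro continuous_intros)
    from continuous_on_compose2[OF cD[of UNIV] this]
    show "continuous_on (cbox a b) (D x)" by simp
  qed
  have "((\<lambda>x. integral (cbox a b) (\<lambda>y. g y *\<^sub>R K (x - y))) has_derivative
      integral (cbox a b) (D x)) (at x)"
  proof (rule leibniz_rule[where U=UNIV, OF _ intf])
    fix x y
    have "((\<lambda>x. g y *\<^sub>R K (x - y)) has_derivative (\<lambda>v. g y *\<^sub>R K' (x - y) v)) (at x)"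
    proof (rule has_derivative_scaleR_right)
      have "((\<lambda>x. x - y) has_derivative (\<lambda>v. v)) (at x)"
        by (auto intro!: derivative_eq_intros)
      from has_derivative_compose[OF this K']
      show "((\<lambda>x. K (x - y)) has_derivative K' (x - y)) (at x)" .
    qed
    moreover have "blinfun_apply (D x y) = (\<lambda>v. g y *\<^sub>R K' (x - y) v)"
      unfolding D_def by (auto simp: blinfun.scaleR_left bounded_linear_Blinfun_apply bl)
    ultimately show "((\<lambda>x. g y *\<^sub>R K (x - y)) has_derivative blinfun_apply (D x y)) (at x within UNIV)"
      by simp
  qed (use cD in \<open>auto simp: case_prod_unfold\<close>)
  moreover have "blinfun_apply (integral (cbox a b) (D x)) =
      (\<lambda>v. integral (cbox a b) (\<lambda>y. g y *\<^sub>R K' (x - y) v))"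
  proof
    fix v
    have "blinfun_apply (integral (cbox a b) (D x)) v = integral (cbox a b) (\<lambda>y. blinfun_apply (D x y) v)"
      by (rule blinfun_apply_integral[OF intD])
    also have "\<dots> = integral (cbox a b) (\<lambda>y. g y *\<^sub>R K' (x - y) v)"
      unfolding D_def by (simp add: blinfun.scaleR_left bounded_linear_Blinfun_apply bl)
    finally show "blinfun_apply (integral (cbox a b) (D x)) v =
        integral (cbox a b) (\<lambda>y. g y *\<^sub>R K' (x - y) v)" .
  qed
  ultimately show ?thesis by simp
qed

lemma Ck_convolution:
  fixes K :: "'a::euclidean_space \<Rightarrow> 'b::banach" and g :: "'a \<Rightarrow> real"
  assumes g: "continuous_on UNIV g" and "Ck k K"
  shows "Ck k (\<lambda>x. integral (cbox a b) (\<lambda>y. g y *\<^sub>R K (x - y)))"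
  using assms(2)
proof (induction k arbitrary: K)
  case 0
  then have "continuous_on UNIV K" by simp
  then show ?case
    unfolding Ck.simps
    by (intro integral_continuous_on_param)
       (simp_all add: case_prod_unfold, intro continuous_intros continuous_on_compose2[OF g]
         continuous_on_compose2[OF \<open>continuous_on UNIV K\<close>] subset_UNIV)
next
  case (Suc k)
  obtain K' where K': "\<And>x. (K has_derivative K' x) (at x)" "\<And>v. Ck k (\<lambda>x. K' x v)"
    using Ck_Suc_ex_derivative[OF Suc.prems] by blast
  show ?case
    by (rule Ck_SucI[OF convolution_has_derivative[OF g K'(1)]])
       (use K' in \<open>auto intro: Suc.IH Ck_imp_continuous_on\<close>)
qed

text \<open>With w = 1/v one has d/dv = - w^2 d/dw. Hence the j-th derivative of exp (-1/v) for v >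
  0 is P_j(w) exp (-w) with P_(j+1) = w^2 (P_j - P_j'); these are the P_j.\<close>

fun exp_inv_poly :: "nat \<Rightarrow> real poly" where
  "exp_inv_poly 0 = 1"
| "exp_inv_poly (Suc j) = [:0, 0, 1:] * (exp_inv_poly j - pderiv (exp_inv_poly j))"

definition exp_inv :: "nat \<Rightarrow> real \<Rightarrow> real" where
  "exp_inv j v = (if v > 0 then poly (exp_inv_poly j) (1 / v) * exp (- (1 / v)) else 0)"

lemma poly_exp_neg_tendsto_0: "((\<lambda>x. poly P x * exp (- x)) \<longlongrightarrow> 0) (at_top :: real filter)"
proof -
  have "((\<lambda>x. \<Sum>i\<le>degree P. coeff P i * (x ^ i / exp x)) \<longlongrightarrow> (\<Sum>i\<le>degree P. coeff P i * 0)) at_top"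
    by (intro tendsto_intros tendsto_power_div_exp_0)
  then show ?thesis
    by (simp add: poly_altdef exp_minus sum_distrib_right divide_inverse mult.assoc)
qed

lemma exp_inv_has_derivative: "(exp_inv j has_real_derivative exp_inv (Suc j) v) (at v)"
proof -
  consider "v > 0" | "v < 0" | "v = 0" by linarith
  then show ?thesis
  proof cases
    case 1
    have "((\<lambda>v. poly (exp_inv_poly j) (1 / v) * exp (- (1 / v))) has_real_derivative
       exp_inv (Suc j) v) (at v)"
    proof -
      have "((\<lambda>v. 1 / v) has_real_derivative (- 1 / v\<^sup>2)) (at v)"
        using 1 by (auto intro!: derivative_eq_intros simp: power2_eq_square)
      note inv = this
      have "((\<lambda>v. poly (exp_inv_poly j) (1 / v)) has_real_derivative
          poly (pderiv (exp_inv_poly j)) (1 / v) * (- 1 / v\<^sup>2)) (at v)"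
        by (rule DERIV_chain2[OF poly_DERIV inv])
      moreover have "((\<lambda>v. exp (- (1 / v))) has_real_derivative exp (- (1 / v)) * (- (- 1 / v\<^sup>2))) (at v)"
        by (rule DERIV_chain2[OF DERIV_exp DERIV_minus[OF inv]])
      ultimately have "((\<lambda>v. poly (exp_inv_poly j) (1 / v) * exp (- (1 / v))) has_real_derivative
          poly (pderiv (exp_inv_poly j)) (1 / v) * (- 1 / v\<^sup>2) * exp (- (1 / v)) +
          exp (- (1 / v)) * (- (- 1 / v\<^sup>2)) * poly (exp_inv_poly j) (1 / v)) (at v)"
        by (rule DERIV_mult)
      moreover have "poly (pderiv (exp_inv_poly j)) (1 / v) * (- 1 / v\<^sup>2) * exp (- (1 / v)) +
          exp (- (1 / v)) * (- (- 1 / v\<^sup>2)) * poly (exp_inv_poly j) (1 / v) = exp_inv (Suc j) v"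
        using 1 by (simp add: exp_inv_def algebra_simps power2_eq_square)
      ultimately show ?thesis by simp
    qed
    moreover have "\<forall>\<^sub>F w in nhds v. w > 0"
      using 1 by (metis eventually_nhds open_greaterThan greaterThan_iff)
    then have "\<forall>\<^sub>F w in nhds v. exp_inv j w = poly (exp_inv_poly j) (1 / w) * exp (- (1 / w))"
      by eventually_elim (simp add: exp_inv_def)
    ultimately show ?thesis
      by (subst DERIV_cong_ev[OF refl _ refl]) auto
  next
    case 2
    then have "\<forall>\<^sub>F w in nhds v. w < 0"
      by (metis eventually_nhds open_lessThan lessThan_iff)
    then have "\<forall>\<^sub>F w in nhds v. exp_inv j w = 0"
      by eventually_elim (simp add: exp_inv_def)
    moreover have "((\<lambda>v. 0) has_real_derivative exp_inv (Suc j) v) (at v)"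
      using 2 by (simp add: exp_inv_def)
    ultimately show ?thesis
      by (subst DERIV_cong_ev[OF refl _ refl]) auto
  next
    case 3
    have "((\<lambda>h. exp_inv j h / h) \<longlongrightarrow> 0) (at_right 0)"
    proof -
      \<comment> \<open>At the gluing point the difference quotient from the right is w P_j(w) exp
        (-w) with w = 1/h, and the exponential beats the extra factor w, which is
        \<open>[:0,1:]\<close>.\<close>
      have "((\<lambda>h. poly ([:0,1:] * exp_inv_poly j) (inverse h) * exp (- inverse h)) \<longlongrightarrow> 0) (at_right 0)"
        by (rule filterlim_compose[OF poly_exp_neg_tendsto_0 filterlim_inverse_at_top_right])
      moreover have "\<forall>\<^sub>F h in at_right 0. poly ([:0,1:] * exp_inv_poly j) (inverse h) * exp (- inverse h)
          = exp_inv j h / h"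
        using eventually_at_right_less by eventually_elim (simp add: exp_inv_def field_simps)
      ultimately show ?thesis
        by (rule Lim_transform_eventually)
    qed
    moreover have "((\<lambda>h. exp_inv j h / h) \<longlongrightarrow> 0) (at_left 0)"
    proof (rule Lim_transform_eventually[OF tendsto_const])
      show "\<forall>\<^sub>F h in at_left 0. 0 = exp_inv j h / h"
        by (simp add: eventually_at_left_real exp_inv_def eventually_at_filter)
    qed
    ultimately have "((\<lambda>h. exp_inv j h / h) \<longlongrightarrow> 0) (at 0)"
      by (simp add: filterlim_split_at)
    then show ?thesis
      using 3 by (simp add: DERIV_def exp_inv_def)
  qed
qed

section \<open>The truncated Newton kernel\<close>

lemma Ck_power:
  fixes u :: "'a::euclidean_space \<Rightarrow> real"
  shows "Ck k u \<Longrightarrow> Ck k (\<lambda>x. u x ^ m)"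
  by (induction m) (auto intro: Ck_const Ck_mult)

lemma exp_inv_bounds: "0 \<le> exp_inv 0 v" "v \<le> 1 \<Longrightarrow> exp_inv 0 v \<le> exp (- 1)"
  by (auto simp: exp_inv_def divide_simps)

text \<open>The function exp (1 - 1/(1 - u)) for u < 1, extended by 0. The factor
  \<open>exp 1\<close> normalises the value at 0; for u < 0 the values exceed 1, so the upper bound
  1 is claimed for \<open>0 \<le> u\<close>.\<close>

definition cutoff :: "real \<Rightarrow> real" where
  "cutoff u = exp 1 * exp_inv 0 (1 - u)"

definition cutoff_deriv :: "real \<Rightarrow> real" where
  "cutoff_deriv u = - exp 1 * exp_inv 1 (1 - u)"

lemma cutoff_0 [simp]: "cutoff 0 = 1"
  by (simp add: cutoff_def exp_inv_def flip: exp_add)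

lemma cutoff_nonneg: "0 \<le> cutoff u"
  by (simp add: cutoff_def exp_inv_bounds)

lemma cutoff_le_1: "0 \<le> u \<Longrightarrow> cutoff u \<le> 1"
  using mult_left_mono[OF exp_inv_bounds(2)[of "1 - u"], of "exp 1"]
  by (simp add: cutoff_def flip: exp_add)

lemma cutoff_eq_0: "1 \<le> u \<Longrightarrow> cutoff u = 0" "1 \<le> u \<Longrightarrow> cutoff_deriv u = 0"
  by (simp_all add: cutoff_def cutoff_deriv_def exp_inv_def)

lemma cutoff_has_derivative: "(cutoff has_real_derivative cutoff_deriv u) (at u)"
proof -
  have "((\<lambda>u. 1 - u) has_real_derivative -1) (at u)"
    by (auto intro!: derivative_eq_intros)
  from DERIV_cmult[OF DERIV_chain2[OF exp_inv_has_derivative this], of "exp 1" 0]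
  show ?thesis
    by (simp add: cutoff_def[abs_def] cutoff_deriv_def)
qed

lemma isCont_cutoff: "isCont cutoff u"
  using cutoff_has_derivative DERIV_isCont by blast

lemma cutoff_deriv_bounded: "\<exists>M\<ge>0. \<forall>u\<ge>0. \<bar>cutoff_deriv u\<bar> \<le> M"
proof -
  have "continuous_on {0..1} cutoff_deriv"
  proof -
    have "continuous_on UNIV (exp_inv 1)"
      by (intro continuous_at_imp_continuous_on ballI DERIV_isCont[OF exp_inv_has_derivative])
    moreover have "continuous_on {0..1} (\<lambda>u::real. 1 - u)"
      by (intro continuous_intros)
    ultimately have "continuous_on {0..1} (\<lambda>u. exp_inv 1 (1 - u))"
      by (rule continuous_on_compose2) auto
    then show ?thesis
      unfolding cutoff_deriv_def[abs_def] by (rule continuous_on_mult_left)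
  qed
  from compact_imp_bounded[OF compact_continuous_image[OF this]]
  obtain M where M: "\<forall>u\<in>{0..1}. \<bar>cutoff_deriv u\<bar> \<le> M"
    by (auto simp: bounded_iff)
  have "\<bar>cutoff_deriv u\<bar> \<le> max M 0" if "u \<ge> 0" for u
    using M[rule_format, of u] that cutoff_eq_0(2)[of u] by (cases "u \<le> 1") auto
  then show ?thesis by (intro exI[of _ "max M 0"]) auto
qed

text \<open>Writing the profile as a function of \<open>x \<bullet> x\<close> instead of the norm
  makes the chain rule valid at the origin too.\<close>

lemma divergence_radial:
  fixes x :: "'a::euclidean_space"
  assumes "(k has_real_derivative k') (at (x \<bullet> x))"
  shows "divergence (\<lambda>x. k (x \<bullet> x) *\<^sub>R x) x = 2 * (x \<bullet> x) * k' + real DIM('a) * k (x \<bullet> x)"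
proof -
  have "((\<lambda>x. x \<bullet> x) has_derivative (\<lambda>v. 2 * (x \<bullet> v))) (at x)"
    by (auto intro!: derivative_eq_intros simp: inner_commute)
  from DERIV_compose_FDERIV[OF assms this]
  have "((\<lambda>x. k (x \<bullet> x)) has_derivative (\<lambda>v. 2 * (x \<bullet> v) * k')) (at x)" .
  from has_derivative_scaleR[OF this has_derivative_ident]
  have "((\<lambda>x. k (x \<bullet> x) *\<^sub>R x) has_derivative
      (\<lambda>v. k (x \<bullet> x) *\<^sub>R v + (2 * (x \<bullet> v) * k') *\<^sub>R x)) (at x)" .
  from frechet_derivative_at[OF this, symmetric]
  have "divergence (\<lambda>x. k (x \<bullet> x) *\<^sub>R x) x =
      (\<Sum>b\<in>Basis. k (x \<bullet> x) * (b \<bullet> b) + 2 * k' * ((x \<bullet> b) * (x \<bullet> b)))"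
    unfolding divergence_def by (intro sum.cong) (auto simp: inner_simps algebra_simps)
  also have "\<dots> = (\<Sum>b\<in>(Basis::'a set). k (x \<bullet> x)) + 2 * k' * (\<Sum>b\<in>Basis. (x \<bullet> b) * (x \<bullet> b))"
    unfolding sum.distrib sum_distrib_left by (simp add: inner_same_Basis)
  also have "(\<Sum>b\<in>Basis. (x \<bullet> b) * (x \<bullet> b)) = x \<bullet> x"
    by (simp add: euclidean_inner[of x x])
  finally show ?thesis by (simp add: algebra_simps)
qed

text \<open>
  The \<open>n\<close>-th power inside the cutoff makes its derivative vanish to high order at \<open>0\<close>, so that the error
  term in the divergence is of size \<open>R\<^bsup>-n\<^esup>\<close> uniformly, also near the singularity.
\<close>

definition kernel :: "real \<Rightarrow> real \<Rightarrow> 'a::euclidean_space \<Rightarrow> 'a" where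
  "kernel \<delta> R x = ((x \<bullet> x + \<delta>\<^sup>2) powr (- real DIM('a) / 2) * cutoff ((x \<bullet> x / R\<^sup>2) ^ DIM('a))) *\<^sub>R x"

text \<open>The exact divergence of (|x|^2 + \<delta>^2)^(-n/2) x: the contributions - n |x|^2 and n
  (|x|^2 + \<delta>^2) leave n \<delta>^2. It is the rescaling \<delta>^(-n)
  \<open>mollifier 1\<close> (x / \<delta>), an approximate identity up to normalisation.\<close>

definition mollifier :: "real \<Rightarrow> 'a::euclidean_space \<Rightarrow> real" where
  "mollifier \<delta> x = real DIM('a) * \<delta>\<^sup>2 * (x \<bullet> x + \<delta>\<^sup>2) powr (- real DIM('a) / 2 - 1)"

lemma Ck_powr:
  fixes u :: "'a::euclidean_space \<Rightarrow> real"
  assumes "Ck k u" "\<And>x. u x > 0"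
  shows "Ck k (\<lambda>x. u x powr s)"
proof -
  define \<psi> where "\<psi> j y = (\<Prod>i<j. s - real i) * y powr (s - real j)" for j y
  have "(\<psi> j has_real_derivative \<psi> (Suc j) y) (at y)" if "y \<in> {0<..}" for j y
  proof -
    have "((\<lambda>y. y powr (s - real j)) has_real_derivative (s - real j) * y powr (s - real j - 1)) (at y)"
      using that by (intro has_real_derivative_powr) auto
    from DERIV_cmult[OF this, of "\<Prod>i<j. s - real i"] show ?thesis
      by (simp add: \<psi>_def[abs_def] algebra_simps)
  qed
  then have "Ck k (\<lambda>x. \<psi> 0 (u x))"
    using assms by (intro Ck_compose_real[where S="{0<..}" and \<psi>=\<psi>]) auto
  then show ?thesis
    by (simp add: \<psi>_def)
qed

lemma Ck_kernel:
  assumes "\<delta> > 0"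
  shows "Ck k (kernel \<delta> R :: 'a::euclidean_space \<Rightarrow> 'a)"
proof -
  have id: "Ck k (\<lambda>x::'a. x)"
    by (rule Ck_bounded_linear) (rule bounded_linear_ident)
  have sq: "Ck k (\<lambda>x::'a. x \<bullet> x)"
    by (rule Ck_inner[OF id id])
  have "Ck k (\<lambda>x::'a. (x \<bullet> x + \<delta>\<^sup>2) powr (- real DIM('a) / 2))"
    using assms by (intro Ck_powr Ck_add sq Ck_const) (simp add: add_nonneg_pos)
  moreover have "Ck k (\<lambda>x::'a. cutoff ((x \<bullet> x / R\<^sup>2) ^ DIM('a)))"
  proof -
    have "Ck k (\<lambda>x::'a. 1 + (- 1) * ((1 / R\<^sup>2) * (x \<bullet> x)) ^ DIM('a))"
      by (intro Ck_add Ck_const Ck_mult Ck_power sq)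
    from Ck_mult[OF Ck_const[of k "exp 1"] Ck_compose_real[of UNIV exp_inv, OF exp_inv_has_derivative this, where j=0]]
    show ?thesis
      by (simp add: cutoff_def)
  qed
  ultimately show ?thesis
    unfolding kernel_def[abs_def] by (intro Ck_scaleR Ck_mult id)
qed

lemma kernel_eq_0: "R > 0 \<Longrightarrow> norm x \<ge> R \<Longrightarrow> kernel \<delta> R x = 0"
  by (simp add: kernel_def cutoff_eq_0 dot_square_norm power_mono)

text \<open>Uniformity in \<open>\<delta>\<close> and \<open>R\<close> keeps the constants for the
  potential independent of the regularisation. At \<open>x = 0\<close> both sides vanish, as
  \<open>powr\<close> with base 0 is 0.\<close>

lemma norm_kernel_le: "norm (kernel \<delta> R (x::'a::euclidean_space)) \<le> norm x powr (1 - real DIM('a))"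
proof (cases "x = 0")
  case False
  have "(x \<bullet> x + \<delta>\<^sup>2) powr (- real DIM('a) / 2) \<le> (x \<bullet> x) powr (- real DIM('a) / 2)"
    using False by (intro powr_mono2') auto
  also have "\<dots> = norm x powr (- real DIM('a))"
    using False by (simp add: dot_square_norm powr_powr flip: powr_numeral)
  finally have "(x \<bullet> x + \<delta>\<^sup>2) powr (- real DIM('a) / 2) * cutoff ((x \<bullet> x / R\<^sup>2) ^ DIM('a))
      \<le> norm x powr (- real DIM('a)) * 1"
    by (intro mult_mono cutoff_le_1 cutoff_nonneg) auto
  then have "norm (kernel \<delta> R x) \<le> norm x powr (- real DIM('a)) * norm x"
    unfolding kernel_def norm_scaleR by (intro mult_right_mono) (auto simp: abs_mult cutoff_nonneg)
  also have "\<dots> = norm x powr (1 - real DIM('a))"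
    using False powr_add[of "norm x" "- real DIM('a)" 1] by simp
  finally show ?thesis .
qed (simp add: kernel_def)

text \<open>The derivative of the \<open>powr\<close> factor combines with n times the profile to
  mollifier times cutoff. What remains carries the derivative of the cutoff, which lives on the ball
  of radius \<open>R\<close>.\<close>

lemma divergence_kernel:
  "\<exists>C\<ge>0. \<forall>\<delta> R (x::'a::euclidean_space). \<delta> > 0 \<longrightarrow> R > 0 \<longrightarrow>
     \<bar>divergence (kernel \<delta> R) x - mollifier \<delta> x * cutoff ((x \<bullet> x / R\<^sup>2) ^ DIM('a))\<bar>
       \<le> C * R powr (- real DIM('a)) * indicator (cball 0 R) x"
proof -
  obtain M where M: "M \<ge> 0" "\<And>u. u \<ge> 0 \<Longrightarrow> \<bar>cutoff_deriv u\<bar> \<le> M"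
    using cutoff_deriv_bounded by blast
  let ?n = "real DIM('a)"
  have "\<bar>divergence (kernel \<delta> R) x - mollifier \<delta> x * cutoff ((x \<bullet> x / R\<^sup>2) ^ DIM('a))\<bar>
       \<le> 2 * ?n * M * R powr (- ?n) * indicator (cball 0 R) x"
    if \<delta>: "\<delta> > 0" and R: "R > 0" for \<delta> R :: real and x :: 'a
  proof -
    define s where "s = x \<bullet> x"
    define k where "k = (\<lambda>s. (s + \<delta>\<^sup>2) powr (- ?n / 2) * cutoff ((s / R\<^sup>2) ^ DIM('a)))"
    define e where "e = (s + \<delta>\<^sup>2) powr (- ?n / 2) *
      (cutoff_deriv ((s / R\<^sup>2) ^ DIM('a)) * (?n * (s / R\<^sup>2) ^ (DIM('a) - 1) / R\<^sup>2))"
    have s: "s \<ge> 0" "s + \<delta>\<^sup>2 > 0"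
      using \<delta> by (auto simp: s_def add_nonneg_pos)
    have 1: "((\<lambda>s. (s + \<delta>\<^sup>2) powr (- ?n / 2)) has_real_derivative
        (- ?n / 2) * (s + \<delta>\<^sup>2) powr (- ?n / 2 - 1)) (at s)"
    proof -
      have "((\<lambda>s. s + \<delta>\<^sup>2) has_real_derivative 1) (at s)"
        by (auto intro!: derivative_eq_intros)
      from DERIV_chain2[where f="\<lambda>z. z powr (- ?n / 2)", OF has_real_derivative_powr[OF s(2)] this]
      show ?thesis by simp
    qed
    have "((\<lambda>s. (s / R\<^sup>2) ^ DIM('a)) has_real_derivative ?n * (s / R\<^sup>2) ^ (DIM('a) - 1) / R\<^sup>2) (at s)"
      using DERIV_power[OF DERIV_cdivide[OF DERIV_ident, of "R\<^sup>2"], where x=s and s=UNIV and n="DIM('a)"] by simp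
    from DERIV_chain2[OF cutoff_has_derivative this]
    have 2: "((\<lambda>s. cutoff ((s / R\<^sup>2) ^ DIM('a))) has_real_derivative
        cutoff_deriv ((s / R\<^sup>2) ^ DIM('a)) * (?n * (s / R\<^sup>2) ^ (DIM('a) - 1) / R\<^sup>2)) (at s)" .
    have "(k has_real_derivative (- ?n / 2) * (s + \<delta>\<^sup>2) powr (- ?n / 2 - 1) * cutoff ((s / R\<^sup>2) ^ DIM('a)) + e) (at s)"
      using DERIV_mult[OF 1 2] by (simp add: k_def e_def mult_ac add_ac)
    from divergence_radial[OF this[unfolded s_def]]
    have "divergence (kernel \<delta> R) x = 2 * s * ((- ?n / 2) * (s + \<delta>\<^sup>2) powr (- ?n / 2 - 1) *
        cutoff ((s / R\<^sup>2) ^ DIM('a)) + e) + ?n * k s"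
      by (simp add: kernel_def[abs_def] k_def s_def)
    also have "(s + \<delta>\<^sup>2) powr (- ?n / 2) = (s + \<delta>\<^sup>2) powr (- ?n / 2 - 1) * (s + \<delta>\<^sup>2)"
      using s(2) powr_add[of "s + \<delta>\<^sup>2" "- ?n / 2 - 1" 1] by simp
    then have "2 * s * ((- ?n / 2) * (s + \<delta>\<^sup>2) powr (- ?n / 2 - 1) *
        cutoff ((s / R\<^sup>2) ^ DIM('a)) + e) + ?n * k s =
        mollifier \<delta> x * cutoff ((x \<bullet> x / R\<^sup>2) ^ DIM('a)) + 2 * s * e"
      unfolding k_def mollifier_def by (simp add: s_def algebra_simps)
    finally have eq: "\<bar>divergence (kernel \<delta> R) x - mollifier \<delta> x * cutoff ((x \<bullet> x / R\<^sup>2) ^ DIM('a))\<bar>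
        = 2 * s * \<bar>e\<bar>"
      using s by (simp add: abs_mult)
    show ?thesis
    proof (cases "s = 0 \<or> norm x > R")
      case True
      then have "2 * s * \<bar>e\<bar> = 0"
      proof
        assume "norm x > R"
        then have "R\<^sup>2 \<le> s"
          using R by (simp add: s_def dot_square_norm power_mono)
        then have "1 \<le> (s / R\<^sup>2) ^ DIM('a)"
          using R by (intro one_le_power) simp
        then show ?thesis by (simp add: e_def cutoff_eq_0)
      qed simp
      moreover have "0 \<le> 2 * ?n * M * R powr (- ?n) * indicator (cball 0 R) x"
        using M by (intro mult_nonneg_nonneg) auto
      ultimately show ?thesis unfolding eq by linarith
    next
      case False
      then have s0: "s > 0" and x: "norm x \<le> R" using s by auto
      then have sR: "s / R\<^sup>2 \<le> 1" "s / R\<^sup>2 > 0"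
        using R by (auto simp: s_def dot_square_norm power_mono)
      define c where "c = \<bar>cutoff_deriv ((s / R\<^sup>2) ^ DIM('a))\<bar>"
      have c: "0 \<le> c" "c \<le> M" unfolding c_def using M(2) sR by auto
      have "s * ((s + \<delta>\<^sup>2) powr (- ?n / 2) *
          (c * (?n * (s / R\<^sup>2) ^ (DIM('a) - 1) / R\<^sup>2)))
        \<le> s * (s powr (- ?n / 2) * (M * (?n * (s / R\<^sup>2) ^ (DIM('a) - 1) / R\<^sup>2)))"
        using s0 M c by (intro mult_mono powr_mono2') auto
      also have "\<dots> = ?n * M * (s powr (- ?n / 2) * ((s / R\<^sup>2) * (s / R\<^sup>2) ^ (DIM('a) - 1)))"
        by (simp add: field_simps)
      also have "(s / R\<^sup>2) * (s / R\<^sup>2) ^ (DIM('a) - 1) = (s / R\<^sup>2) ^ DIM('a)"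
        by (metis DIM_positive power_eq_if not_gr_zero)
      \<comment> \<open>Half of the n powers of s / R^2 cancel s^(-n/2) and turn it into R^(-n); the
        other half is at most 1, because s \<le> R^2.\<close>
      also have "\<dots> = (s / R\<^sup>2) powr (?n / 2) * (s / R\<^sup>2) powr (?n / 2)"
        using sR by (simp add: powr_realpow flip: powr_add)
      also have "s powr (- ?n / 2) * ((s / R\<^sup>2) powr (?n / 2) * (s / R\<^sup>2) powr (?n / 2)) =
          (s powr (- ?n / 2) * s powr (?n / 2)) * ((s / R\<^sup>2) powr (?n / 2) / (R\<^sup>2) powr (?n / 2))"
        using s0 by (simp add: powr_divide)
      also have "s powr (- ?n / 2) * s powr (?n / 2) = 1"
        using s0 by (simp flip: powr_add)
      also have "(R\<^sup>2) powr (?n / 2) = R powr ?n"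
        using R by (simp add: powr_powr flip: powr_numeral)
      also have "?n * M * (1 * ((s / R\<^sup>2) powr (?n / 2) / R powr ?n)) \<le> ?n * M * (1 * (1 / R powr ?n))"
        using M sR by (intro mult_left_mono divide_right_mono powr_le1) auto
      finally have "s * ((s + \<delta>\<^sup>2) powr (- ?n / 2) *
          (c * (?n * (s / R\<^sup>2) ^ (DIM('a) - 1) / R\<^sup>2)))
        \<le> ?n * M * (1 / R powr ?n)" by simp
      moreover have "\<bar>e\<bar> = (s + \<delta>\<^sup>2) powr (- ?n / 2) *
          (c * (?n * (s / R\<^sup>2) ^ (DIM('a) - 1) / R\<^sup>2))"
        unfolding e_def abs_mult abs_divide power_abs c_def using s0 by simp
      ultimately have "s * \<bar>e\<bar> \<le> ?n * M * R powr (- ?n)"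
        by (simp only: powr_minus_divide)
      then show ?thesis unfolding eq using x by simp
    qed
  qed
  then show ?thesis
    using M by (intro exI[of _ "2 * ?n * M"]) auto
qed

section \<open>Convolution inequalities\<close>

text \<open>Convexity of the power function on the open half-line; at the endpoint
  \<open>v = 0\<close> the claim reduces to 1 - q \<le> 0.\<close>

lemma powr_tangent:
  fixes v M q :: real
  assumes "q \<ge> 1" "M > 0" "v \<ge> 0"
  shows "v powr q \<ge> M powr q + q * M powr (q - 1) * (v - M)"
proof (cases "v = 0")
  case True
  have "M powr (q - 1) * M = M powr q"
    using assms powr_add[of M "q - 1" 1] by simp
  then have "M powr q + q * M powr (q - 1) * (v - M) = (1 - q) * M powr q"
    using True by (simp add: algebra_simps)
  also have "\<dots> \<le> 0" using assms by (intro mult_nonpos_nonneg) auto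
  finally show ?thesis using True by simp
next
  case False
  have "convex_on {0<..} (\<lambda>x. x powr q)"
    using assms(1) by (rule powr_convex)
  moreover have "((\<lambda>x. x powr q) has_real_derivative q * M powr (q - 1)) (at M)"
    using assms by (intro has_real_derivative_powr)
  ultimately have "v powr q - M powr q \<ge> q * M powr (q - 1) * (v - M)"
    using False assms
    by (intro convex_on_imp_above_tangent[where A="{0<..}"])
       (auto simp: connected_iff_interval interior_open has_field_derivative_at_within)
  then show ?thesis by simp
qed

text \<open>Jensen's inequality for an unnormalised weight \<open>u\<close>: the tangent inequality
  at the weighted mean \<open>I / U\<close> is integrated against \<open>u\<close>. The integral on
  the right may be infinite.\<close>

lemma jensen_powr:
  fixes u v :: "'a \<Rightarrow> real"
  assumes q: "q > 1" and u: "integrable M u" and uv: "integrable M (\<lambda>y. u y * v y)"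
    and [measurable]: "v \<in> borel_measurable M"
    and nonneg: "\<And>y. u y \<ge> 0" "\<And>y. v y \<ge> 0"
  shows "ennreal ((\<integral>y. u y * v y \<partial>M) powr q) \<le>
    ennreal ((\<integral>y. u y \<partial>M) powr (q - 1)) * (\<integral>\<^sup>+y. ennreal (u y * v y powr q) \<partial>M)"
proof -
  define U where "U = (\<integral>y. u y \<partial>M)"
  define I where "I = (\<integral>y. u y * v y \<partial>M)"
  have [measurable]: "u \<in> borel_measurable M"
    using u by auto
  have I0: "I \<ge> 0" and U0: "U \<ge> 0"
    unfolding I_def U_def using nonneg by auto
  show ?thesis
  proof (cases "I = 0")
    case True
    then show ?thesis unfolding I_def by simp
  next
    case False
    then have I: "I > 0" using I0 by simp
    have U: "U > 0"
    proof (rule ccontr)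
      assume "\<not> U > 0"
      then have "AE y in M. u y = 0"
        using integral_nonneg_eq_0_iff_AE[OF u] U0 nonneg unfolding U_def by auto
      then have "AE y in M. u y * v y = 0" by eventually_elim simp
      then have "I = 0" unfolding I_def by (rule integral_eq_zero_AE)
      with I show False by simp
    qed
    define m where "m = I / U"
    have m: "m > 0" using I U by (simp add: m_def)
    show ?thesis
    proof (cases "(\<integral>\<^sup>+y. ennreal (u y * v y powr q) \<partial>M) < \<infinity>")
      case True
      then have int: "integrable M (\<lambda>y. u y * v y powr q)"
        using nonneg by (intro integrableI_nonneg) auto
      \<comment> \<open>Since \<open>m * U = I\<close>, the linear part of the tangent at
        \<open>m\<close> integrates to 0.\<close>
      have "m powr q * U = (\<integral>y. u y * (m powr q - q * m powr (q - 1) * m) + q * m powr (q - 1) * (u y * v y) \<partial>M)"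
        using u uv I U by (simp add: m_def flip: U_def I_def) (simp add: field_simps)
      also have "\<dots> \<le> (\<integral>y. u y * v y powr q \<partial>M)"
      proof (rule integral_mono)
        fix y
        have "u y * (m powr q + q * m powr (q - 1) * (v y - m)) \<le> u y * v y powr q"
          using powr_tangent[of q m "v y"] q m nonneg by (intro mult_left_mono) auto
        then show "u y * (m powr q - q * m powr (q - 1) * m) + q * m powr (q - 1) * (u y * v y) \<le> u y * v y powr q"
          by (simp add: algebra_simps)
      qed (use u uv int in auto)
      finally have "U powr (q - 1) * (m powr q * U) \<le> U powr (q - 1) * (\<integral>y. u y * v y powr q \<partial>M)"
        by (intro mult_left_mono) auto
      also have "U powr (q - 1) * (m powr q * U) = I powr q"
      proof -
        have "U powr (q - 1) * U = U powr q"
          using U powr_add[of U "q - 1" 1] by simp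
        then have "U powr (q - 1) * (m powr q * U) = m powr q * U powr q"
          by (simp add: algebra_simps)
        also have "\<dots> = I powr q"
          using I U by (simp add: m_def powr_divide)
        finally show ?thesis .
      qed
      finally have "I powr q \<le> U powr (q - 1) * (\<integral>y. u y * v y powr q \<partial>M)" .
      moreover have "ennreal (\<integral>y. u y * v y powr q \<partial>M) = (\<integral>\<^sup>+y. ennreal (u y * v y powr q) \<partial>M)"
        using nn_integral_eq_integral[OF int] nonneg by simp
      ultimately show ?thesis
        unfolding I_def[symmetric] U_def[symmetric]
        by (metis ennreal_leI ennreal_mult' powr_ge_zero)
    next
      case False
      then have "(\<integral>\<^sup>+y. ennreal (u y * v y powr q) \<partial>M) = \<infinity>"
        by (simp add: less_top[symmetric])
      then show ?thesis
        using U unfolding U_def[symmetric] by (simp add: ennreal_mult_top)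
    qed
  qed
qed

text \<open>For \<open>p = 1\<close> the conjugate exponent is \<open>\<infinity>\<close>, and a pointwise bound replaces the essential supremum.\<close>

definition conj_norm_le :: "real \<Rightarrow> ('a::euclidean_space \<Rightarrow> real) \<Rightarrow> real \<Rightarrow> bool" where
  "conj_norm_le p u B \<longleftrightarrow> u \<in> borel_measurable borel \<and> 0 < B \<and>
     (if p = 1 then \<forall>x. \<bar>u x\<bar> \<le> B
      else (\<integral>\<^sup>+x. ennreal (\<bar>u x\<bar> powr (p / (p - 1))) \<partial>lborel) \<le> ennreal (B powr (p / (p - 1))))"

lemma conj_norm_leD: "conj_norm_le p u B \<Longrightarrow> u \<in> borel_measurable borel" "conj_norm_le p u B \<Longrightarrow> 0 < B"
  by (auto simp: conj_norm_le_def)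

lemma conj_norm_le_mono:
  assumes "conj_norm_le p v A" "A \<le> B" "\<And>x. \<bar>u x\<bar> \<le> \<bar>v x\<bar>" "u \<in> borel_measurable borel" "p \<ge> 1"
  shows "conj_norm_le p u B"
proof (cases "p = 1")
  case True
  then show ?thesis
    using assms by (auto simp: conj_norm_le_def intro: order_trans[OF assms(3)] order_trans[of _ A B])
next
  case False
  have "(\<integral>\<^sup>+x. ennreal (\<bar>u x\<bar> powr (p / (p - 1))) \<partial>lborel) \<le> (\<integral>\<^sup>+x. ennreal (\<bar>v x\<bar> powr (p / (p - 1))) \<partial>lborel)"
    using assms False by (intro nn_integral_mono ennreal_leI powr_mono2) auto
  also have "\<dots> \<le> ennreal (A powr (p / (p - 1)))"
    using assms False by (simp add: conj_norm_le_def)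
  also have "\<dots> \<le> ennreal (B powr (p / (p - 1)))"
    using assms False by (intro ennreal_leI powr_mono2) (auto simp: conj_norm_le_def)
  finally show ?thesis
    using assms False by (auto simp: conj_norm_le_def)
qed

text \<open>Convexity at the points a / A and b / B with weights proportional to A and B. If a^q and
  b^q are replaced by A^q and B^q, the right side becomes exactly (A + B)^q.\<close>

lemma powr_add_le_weighted:
  fixes a b A B q :: real
  assumes q: "q > 1" and "A > 0" "B > 0" "a \<ge> 0" "b \<ge> 0"
  shows "(a + b) powr q \<le> (A + B) powr (q - 1) * (A powr (1 - q) * a powr q + B powr (1 - q) * b powr q)"
proof (cases "a + b = 0")
  case True
  then show ?thesis by simp
next
  case False
  define m where "m = (a + b) / (A + B)"
  have m: "m > 0" using False assms by (simp add: m_def add_nonneg_eq_0_iff less_le)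
  have "A * (m powr q + q * m powr (q - 1) * (a / A - m)) + B * (m powr q + q * m powr (q - 1) * (b / B - m))
      \<le> A * (a / A) powr q + B * (b / B) powr q"
    using assms m by (intro add_mono mult_left_mono powr_tangent) auto
  moreover have "A * (m powr q + q * m powr (q - 1) * (a / A - m)) + B * (m powr q + q * m powr (q - 1) * (b / B - m))
     = (A + B) * m powr q + q * m powr (q - 1) * (a + b - (A + B) * m)"
    using assms by (simp add: field_simps)
  moreover have "(A + B) * m = a + b" using assms by (simp add: m_def)
  moreover have "A * (a / A) powr q = A powr (1 - q) * a powr q" "B * (b / B) powr q = B powr (1 - q) * b powr q"
    using assms by (simp_all add: powr_divide powr_diff)
  ultimately have "(A + B) * m powr q \<le> A powr (1 - q) * a powr q + B powr (1 - q) * b powr q"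
    by simp
  then have "(A + B) powr (q - 1) * ((A + B) * m powr q) \<le>
      (A + B) powr (q - 1) * (A powr (1 - q) * a powr q + B powr (1 - q) * b powr q)"
    by (intro mult_left_mono) auto
  moreover have "(A + B) powr (q - 1) * ((A + B) * m powr q) = (a + b) powr q"
  proof -
    have "(A + B) powr (q - 1) * (A + B) = (A + B) powr q"
      using assms powr_add[of "A + B" "q - 1" 1] by simp
    then have "(A + B) powr (q - 1) * ((A + B) * m powr q) = (A + B) powr q * m powr q"
      by (simp add: mult.assoc[symmetric])
    also have "\<dots> = (a + b) powr q"
      using assms by (simp add: m_def powr_divide)
    finally show ?thesis .
  qed
  ultimately show ?thesis by simp
qed

text \<open>Minkowski's inequality, obtained by integrating a pointwise convexity bound whose
  weights are the two norm bounds.\<close>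

lemma conj_norm_le_add:
  assumes u: "conj_norm_le p u A" and v: "conj_norm_le p v B" and p: "p \<ge> 1"
  shows "conj_norm_le p (\<lambda>x. u x + v x) (A + B)"
proof -
  note [measurable] = conj_norm_leD(1)[OF u] conj_norm_leD(1)[OF v]
  have AB: "A > 0" "B > 0" using conj_norm_leD(2)[OF u] conj_norm_leD(2)[OF v] by auto
  show ?thesis
  proof (cases "p = 1")
    case True
    then show ?thesis
      using u v unfolding conj_norm_le_def by (auto intro: order_trans[OF abs_triangle_ineq add_mono])
  next
    case False
    define q where "q = p / (p - 1)"
    have q: "q > 1" using p False by (simp add: q_def field_simps)
    have "(\<integral>\<^sup>+x. ennreal (\<bar>u x + v x\<bar> powr q) \<partial>lborel) \<le>
       (\<integral>\<^sup>+x. ennreal ((A + B) powr (q - 1)) * (ennreal (A powr (1 - q)) * ennreal (\<bar>u x\<bar> powr q) +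
           ennreal (B powr (1 - q)) * ennreal (\<bar>v x\<bar> powr q)) \<partial>lborel)"
    proof (rule nn_integral_mono)
      fix x
      have "\<bar>u x + v x\<bar> powr q \<le> (\<bar>u x\<bar> + \<bar>v x\<bar>) powr q"
        using q by (intro powr_mono2) auto
      also have "\<dots> \<le> (A + B) powr (q - 1) * (A powr (1 - q) * \<bar>u x\<bar> powr q + B powr (1 - q) * \<bar>v x\<bar> powr q)"
        by (rule powr_add_le_weighted) (use q AB in auto)
      finally show "ennreal (\<bar>u x + v x\<bar> powr q) \<le> ennreal ((A + B) powr (q - 1)) *
          (ennreal (A powr (1 - q)) * ennreal (\<bar>u x\<bar> powr q) + ennreal (B powr (1 - q)) * ennreal (\<bar>v x\<bar> powr q))"
        by (simp add: ennreal_mult'[symmetric] ennreal_plus[symmetric] ennreal_leI del: ennreal_plus)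
    qed
    also have "\<dots> = ennreal ((A + B) powr (q - 1)) * (ennreal (A powr (1 - q)) * (\<integral>\<^sup>+x. ennreal (\<bar>u x\<bar> powr q) \<partial>lborel) +
           ennreal (B powr (1 - q)) * (\<integral>\<^sup>+x. ennreal (\<bar>v x\<bar> powr q) \<partial>lborel))"
      by (simp add: nn_integral_cmult nn_integral_add)
    also have "\<dots> \<le> ennreal ((A + B) powr (q - 1)) * (ennreal (A powr (1 - q)) * ennreal (A powr q) +
           ennreal (B powr (1 - q)) * ennreal (B powr q))"
      using u v False unfolding conj_norm_le_def q_def by (intro mult_left_mono add_mono) auto
    also have "\<dots> = ennreal ((A + B) powr (q - 1) * (A powr (1 - q) * A powr q + B powr (1 - q) * B powr q))"
      by (simp add: ennreal_mult'[symmetric] ennreal_plus[symmetric] del: ennreal_plus)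
    also have "(A + B) powr (q - 1) * (A powr (1 - q) * A powr q + B powr (1 - q) * B powr q) = (A + B) powr q"
      using AB powr_add[of "A + B" "q - 1" 1] by (simp flip: powr_add)
    finally show ?thesis
      using False AB unfolding conj_norm_le_def q_def[symmetric] by simp
  qed
qed

text \<open>Young's convolution inequality for \<open>L\<^sup>1 * L\<^sup>q\<close>, in either order, is an instance.\<close>

lemma conj_norm_le_integral:
  fixes u v :: "'a::euclidean_space \<Rightarrow> 'a \<Rightarrow> real"
  assumes p: "p \<ge> 1" and AB: "A > 0" "B > 0"
    and nonneg: "\<And>x y. u x y \<ge> 0" "\<And>x y. v x y \<ge> 0"
    and [measurable]: "case_prod u \<in> borel_measurable (borel \<Otimes>\<^sub>M borel)"
      "case_prod v \<in> borel_measurable (borel \<Otimes>\<^sub>M borel)"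
    and int: "\<And>x. integrable lborel (u x)" "\<And>x. integrable lborel (\<lambda>y. u x y * v x y)"
    and uA: "\<And>x. (\<integral>y. u x y \<partial>lborel) \<le> A"
    and v1: "p = 1 \<Longrightarrow> (\<And>x y. v x y \<le> B)"
    and vq: "p \<noteq> 1 \<Longrightarrow> (\<integral>\<^sup>+x. \<integral>\<^sup>+y. ennreal (u x y * v x y powr (p / (p - 1))) \<partial>lborel \<partial>lborel)
       \<le> ennreal (A * B powr (p / (p - 1)))"
  shows "conj_norm_le p (\<lambda>x. \<integral>y. u x y * v x y \<partial>lborel) (A * B)"
proof (cases "p = 1")
  case True
  have "\<bar>\<integral>y. u x y * v x y \<partial>lborel\<bar> \<le> A * B" for x
  proof -
    have "(\<integral>y. u x y * v x y \<partial>lborel) \<le> (\<integral>y. u x y * B \<partial>lborel)"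
      using int nonneg v1[OF True] by (intro integral_mono mult_left_mono) auto
    also have "\<dots> \<le> A * B" using uA[of x] AB int by (simp add: mult_right_mono)
    finally show ?thesis using nonneg by (simp add: abs_of_nonneg integral_nonneg_AE)
  qed
  then show ?thesis
    using True AB by (simp add: conj_norm_le_def)
next
  case False
  define q where "q = p / (p - 1)"
  have q: "q > 1" using p False by (simp add: q_def field_simps)
  have "(\<integral>\<^sup>+x. ennreal (\<bar>\<integral>y. u x y * v x y \<partial>lborel\<bar> powr q) \<partial>lborel)
    \<le> (\<integral>\<^sup>+x. ennreal (A powr (q - 1)) * (\<integral>\<^sup>+y. ennreal (u x y * v x y powr q) \<partial>lborel) \<partial>lborel)"
  proof (rule nn_integral_mono)
    fix x
    have "\<bar>\<integral>y. u x y * v x y \<partial>lborel\<bar> = (\<integral>y. u x y * v x y \<partial>lborel)"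
      using nonneg by (simp add: integral_nonneg_AE)
    then have "ennreal (\<bar>\<integral>y. u x y * v x y \<partial>lborel\<bar> powr q) \<le>
      ennreal ((\<integral>y. u x y \<partial>lborel) powr (q - 1)) * (\<integral>\<^sup>+y. ennreal (u x y * v x y powr q) \<partial>lborel)"
      using jensen_powr[OF q int(1)[of x] int(2)[of x]] nonneg by simp
    also have "\<dots> \<le> ennreal (A powr (q - 1)) * (\<integral>\<^sup>+y. ennreal (u x y * v x y powr q) \<partial>lborel)"
      using uA q nonneg by (intro mult_right_mono ennreal_leI powr_mono2) (auto simp: integral_nonneg_AE)
    finally show "ennreal (\<bar>\<integral>y. u x y * v x y \<partial>lborel\<bar> powr q) \<le>
       ennreal (A powr (q - 1)) * (\<integral>\<^sup>+y. ennreal (u x y * v x y powr q) \<partial>lborel)" .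
  qed
  also have "\<dots> = ennreal (A powr (q - 1)) * (\<integral>\<^sup>+x. (\<integral>\<^sup>+y. ennreal (u x y * v x y powr q) \<partial>lborel) \<partial>lborel)"
    by (rule nn_integral_cmult) measurable
  also have "\<dots> \<le> ennreal (A powr (q - 1)) * ennreal (A * B powr q)"
    using vq[OF False] by (intro mult_left_mono) (auto simp: q_def)
  also have "\<dots> = ennreal ((A powr (q - 1) * A) * B powr q)"
    using AB by (simp add: ennreal_mult'[symmetric] mult.assoc)
  also have "A powr (q - 1) * A = A powr q"
    using AB powr_add[of A "q - 1" 1] by simp
  also have "A powr q * B powr q = (A * B) powr q"
    using AB by (simp add: powr_mult)
  finally show ?thesis
    using False AB by (simp add: conj_norm_le_def q_def)
qed

lemma nn_integral_lborel_translate: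
  fixes F :: "'a::euclidean_space \<Rightarrow> ennreal"
  assumes [measurable]: "F \<in> borel_measurable borel"
  shows "(\<integral>\<^sup>+x. F (x - y) \<partial>lborel) = (\<integral>\<^sup>+x. F x \<partial>lborel)"
    and "(\<integral>\<^sup>+x. F (y - x) \<partial>lborel) = (\<integral>\<^sup>+x. F x \<partial>lborel)"
proof -
  have "(\<integral>\<^sup>+x. F x \<partial>lborel) = (\<integral>\<^sup>+x. F x \<partial>(density (distr lborel borel (\<lambda>x. - y + 1 *\<^sub>R x)) (\<lambda>_. ennreal (\<bar>1\<bar>^DIM('a)))))"
    by (subst lborel_affine[of 1 "- y"]) auto
  also have "\<dots> = (\<integral>\<^sup>+x. F (x - y) \<partial>lborel)"
    by (simp add: nn_integral_density nn_integral_distr)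
  finally show "(\<integral>\<^sup>+x. F (x - y) \<partial>lborel) = (\<integral>\<^sup>+x. F x \<partial>lborel)" by simp
  have "(\<integral>\<^sup>+x. F x \<partial>lborel) = (\<integral>\<^sup>+x. F x \<partial>(density (distr lborel borel (\<lambda>x. y + (- 1) *\<^sub>R x)) (\<lambda>_. ennreal (\<bar>- 1\<bar>^DIM('a)))))"
    by (subst lborel_affine[of "- 1" y]) auto
  also have "\<dots> = (\<integral>\<^sup>+x. F (y - x) \<partial>lborel)"
    by (simp add: nn_integral_density nn_integral_distr)
  finally show "(\<integral>\<^sup>+x. F (y - x) \<partial>lborel) = (\<integral>\<^sup>+x. F x \<partial>lborel)" by simp
qed

lemma integrable_mult_bounded:
  fixes g k :: "'a \<Rightarrow> real"
  assumes "integrable M g" "k \<in> borel_measurable M" "\<And>y. \<bar>k y\<bar> \<le> C"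
  shows "integrable M (\<lambda>y. g y * k y)"
proof (rule Bochner_Integration.integrable_bound)
  show "integrable M (\<lambda>y. C * g y)" using assms by simp
  show "AE y in M. norm (g y * k y) \<le> norm (C * g y)"
  proof (intro AE_I2)
    fix y
    have "\<bar>g y\<bar> * \<bar>k y\<bar> \<le> \<bar>g y\<bar> * \<bar>C\<bar>"
      by (intro mult_left_mono order_trans[OF assms(3) abs_ge_self]) auto
    then show "norm (g y * k y) \<le> norm (C * g y)"
      by (simp add: abs_mult mult.commute)
  qed
qed (use assms in measurable)

text \<open>Here \<open>g\<close> is the weight in Jensen's inequality and \<open>k\<close> carries
  the L^q norm; this treats the kernel away from 0. The bound \<open>C\<close> makes the products
  integrable and does not enter the resulting constant.\<close>

lemma conj_norm_le_young_right:
  fixes g k :: "'a::euclidean_space \<Rightarrow> real"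
  assumes p: "p \<ge> 1" and A: "A > 0"
    and g: "integrable lborel g" "\<And>y. 0 \<le> g y" "(\<integral>y. g y \<partial>lborel) \<le> A"
    and k: "conj_norm_le p k B" "\<And>y. 0 \<le> k y" "\<And>y. k y \<le> C"
  shows "conj_norm_le p (\<lambda>x. \<integral>y. g y * k (x - y) \<partial>lborel) (A * B)"
proof -
  note [measurable] = conj_norm_leD(1)[OF k(1)]
  have [measurable]: "g \<in> borel_measurable borel" using g(1) by auto
  have B: "B > 0" using k conj_norm_leD by blast
  show ?thesis
  proof (rule conj_norm_le_integral[where u="\<lambda>x y. g y" and v="\<lambda>x y. k (x - y)"])
    show "integrable lborel (\<lambda>y. g y * k (x - y))" for x
      by (rule integrable_mult_bounded[where C=C]) (use g k in auto)
    show "k (x - y) \<le> B" if "p = 1" for x y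
      using k(1,2) that by (auto simp: conj_norm_le_def)
    assume p1: "p \<noteq> 1"
    define q where "q = p / (p - 1)"
    have "(\<integral>\<^sup>+x. \<integral>\<^sup>+y. ennreal (g y * k (x - y) powr q) \<partial>lborel \<partial>lborel)
       = (\<integral>\<^sup>+y. \<integral>\<^sup>+x. ennreal (g y * k (x - y) powr q) \<partial>lborel \<partial>lborel)"
      by (rule lborel_pair.Fubini') measurable
    also have "\<dots> = (\<integral>\<^sup>+y. ennreal (g y) * (\<integral>\<^sup>+x. ennreal (k (x - y) powr q) \<partial>lborel) \<partial>lborel)"
      using g by (simp add: ennreal_mult nn_integral_cmult)
    also have "\<dots> = (\<integral>\<^sup>+y. ennreal (g y) * (\<integral>\<^sup>+x. ennreal (k x powr q) \<partial>lborel) \<partial>lborel)"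
      by (subst nn_integral_lborel_translate(1)[where F="\<lambda>x. ennreal (k x powr q)"]) auto
    also have "\<dots> = (\<integral>\<^sup>+y. ennreal (g y) \<partial>lborel) * (\<integral>\<^sup>+x. ennreal (k x powr q) \<partial>lborel)"
      by (simp add: nn_integral_multc)
    also have "\<dots> \<le> ennreal A * ennreal (B powr q)"
      using k p1 g unfolding conj_norm_le_def q_def
      by (intro mult_mono) (auto simp: nn_integral_eq_integral ennreal_leI)
    finally show "(\<integral>\<^sup>+x. \<integral>\<^sup>+y. ennreal (g y * k (x - y) powr (p / (p - 1))) \<partial>lborel \<partial>lborel)
       \<le> ennreal (A * B powr (p / (p - 1)))"
      using A by (simp add: q_def ennreal_mult')
  qed (use p A B g k in auto)
qed

text \<open>The roles are exchanged: \<open>k\<close> is the integrable weight and \<open>g\<close>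
  carries the L^q norm. This serves the kernel near 0 and the mollifier.\<close>

lemma conj_norm_le_young_left:
  fixes g k :: "'a::euclidean_space \<Rightarrow> real"
  assumes p: "p \<ge> 1" and A: "A > 0"
    and k: "k \<in> borel_measurable borel" "\<And>y. 0 \<le> k y" "(\<integral>\<^sup>+y. ennreal (k y) \<partial>lborel) \<le> ennreal A"
    and g: "conj_norm_le p g B" "\<And>y. 0 \<le> g y" "\<And>y. g y \<le> C"
  shows "conj_norm_le p (\<lambda>x. \<integral>y. g y * k (x - y) \<partial>lborel) (A * B)"
proof -
  note [measurable] = conj_norm_leD(1)[OF g(1)] k(1)
  have B: "B > 0" using g conj_norm_leD by blast
  have nn: "(\<integral>\<^sup>+y. ennreal (k (x - y)) \<partial>lborel) \<le> ennreal A" for x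
    using nn_integral_lborel_translate(2)[of "\<lambda>y. ennreal (k y)" x] k(3) by simp
  have int: "integrable lborel (\<lambda>y. k (x - y))" for x
    using nn[of x] k(2) by (intro integrableI_nonneg) (auto simp: le_less_trans)
  have "conj_norm_le p (\<lambda>x. \<integral>y. k (x - y) * g y \<partial>lborel) (A * B)"
  proof (rule conj_norm_le_integral[where u="\<lambda>x y. k (x - y)" and v="\<lambda>x y. g y"])
    show "integrable lborel (\<lambda>y. k (x - y) * g y)" for x
      by (rule integrable_mult_bounded[where C=C]) (use int g in auto)
    show "(\<integral>y. k (x - y) \<partial>lborel) \<le> A" for x
      using nn[of x] nn_integral_eq_integral[OF int, of x] k(2) A by simp
    show "g y \<le> B" if "p = 1" for x y
      using g(1,2) that by (auto simp: conj_norm_le_def)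
    assume p1: "p \<noteq> 1"
    define q where "q = p / (p - 1)"
    have "(\<integral>\<^sup>+x. \<integral>\<^sup>+y. ennreal (k (x - y) * g y powr q) \<partial>lborel \<partial>lborel)
       = (\<integral>\<^sup>+y. \<integral>\<^sup>+x. ennreal (k (x - y) * g y powr q) \<partial>lborel \<partial>lborel)"
      by (rule lborel_pair.Fubini') measurable
    also have "\<dots> = (\<integral>\<^sup>+y. (\<integral>\<^sup>+x. ennreal (k (x - y)) \<partial>lborel) * ennreal (g y powr q) \<partial>lborel)"
      using k by (simp add: ennreal_mult nn_integral_multc)
    also have "\<dots> = (\<integral>\<^sup>+y. (\<integral>\<^sup>+x. ennreal (k x) \<partial>lborel) * ennreal (g y powr q) \<partial>lborel)"
      by (subst nn_integral_lborel_translate(1)[where F="\<lambda>x. ennreal (k x)"]) auto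
    also have "\<dots> = (\<integral>\<^sup>+x. ennreal (k x) \<partial>lborel) * (\<integral>\<^sup>+y. ennreal (g y powr q) \<partial>lborel)"
      by (simp add: nn_integral_cmult)
    also have "\<dots> \<le> ennreal A * ennreal (B powr q)"
      using k p1 g unfolding conj_norm_le_def q_def by (intro mult_mono) auto
    finally show "(\<integral>\<^sup>+x. \<integral>\<^sup>+y. ennreal (k (x - y) * g y powr (p / (p - 1))) \<partial>lborel \<partial>lborel)
       \<le> ennreal (A * B powr (p / (p - 1)))"
      using A by (simp add: q_def ennreal_mult')
  qed (use p A B g k int in auto)
  then show ?thesis by (simp add: mult.commute)
qed

text \<open>Bridge from estimates over \<open>lborel\<close> to the norms over
  \<open>lebesgue\<close> that define admissibility in \<open>sigma_mod\<close>.\<close>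

lemma Lp_norm_conj_exponent_le:
  fixes \<Phi> :: "'a::euclidean_space \<Rightarrow> 'b::real_normed_vector"
  assumes "conj_norm_le p (\<lambda>x. norm (\<Phi> x)) B" "p \<ge> 1"
  shows "Lp_norm (conj_exponent p) \<Phi> \<le> ereal B"
proof (cases "p = 1")
  case True
  note [measurable] = conj_norm_leD(1)[OF assms(1)]
  have "(\<lambda>x. ereal (norm (\<Phi> x))) \<in> borel_measurable lebesgue"
    by (intro measurable_completion) simp
  with True assms show ?thesis
    unfolding Lp_norm_def conj_exponent_def conj_norm_le_def by (auto intro!: esssup_I)
next
  case False
  define q where "q = p / (p - 1)"
  have q: "q > 1" using assms False by (simp add: q_def field_simps)
  define I where "I = (\<integral>\<^sup>+ x. ennreal (norm (\<Phi> x) powr q) \<partial>lebesgue)"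
  have B: "B > 0" and I: "I \<le> ennreal (B powr q)"
    using assms False by (auto simp: conj_norm_le_def I_def q_def nn_integral_completion)
  then have fin: "I \<noteq> \<infinity>" by (auto simp: top_unique)
  have "enn2real I powr (1 / q) \<le> (B powr q) powr (1 / q)"
    using I q by (intro powr_mono2) (auto intro: enn2real_leI)
  also have "\<dots> = B" using B q by (simp add: powr_powr)
  finally show ?thesis
    using False fin by (simp add: Lp_norm_def conj_exponent_def Let_def flip: q_def I_def)
qed

section \<open>Integrals of the kernel and of the mollifier\<close>

text \<open>Takes the place of polar coordinates: a radial profile is dominated by a sum of step
  functions on balls, whose volumes are known.\<close>

lemma nn_integral_le_suminf:
  fixes F :: "'a::euclidean_space \<Rightarrow> real" and r w :: "nat \<Rightarrow> real"
  assumes cover: "\<And>x. F x > 0 \<Longrightarrow> \<exists>k. norm x \<le> r k \<and> F x \<le> w k"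
    and r: "\<And>k. r k \<ge> 0" and w: "\<And>k. w k \<ge> 0"
    and sums: "(\<lambda>k. w k * (unit_ball_vol (real DIM('a)) * r k ^ DIM('a))) sums s"
  shows "(\<integral>\<^sup>+x. ennreal (F x) \<partial>lborel) \<le> ennreal s"
proof -
  have "(\<integral>\<^sup>+x. ennreal (F x) \<partial>lborel) \<le> (\<integral>\<^sup>+x. (\<Sum>k. ennreal (w k) * indicator (cball (0::'a) (r k)) x) \<partial>lborel)"
  proof (rule nn_integral_mono)
    fix x
    show "ennreal (F x) \<le> (\<Sum>k. ennreal (w k) * indicator (cball 0 (r k)) x)"
    proof (cases "F x > 0")
      case True
      then obtain k where k: "norm x \<le> r k" "F x \<le> w k" using cover by blast
      have "ennreal (F x) \<le> ennreal (w k) * indicator (cball 0 (r k)) x"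
        using k by (simp add: ennreal_leI)
      also have "\<dots> \<le> (\<Sum>k. ennreal (w k) * indicator (cball 0 (r k)) x)"
      proof -
        define f where "f = (\<lambda>k. ennreal (w k) * indicator (cball 0 (r k)) x)"
        have "f k \<le> suminf f"
          using sum_le_suminf[of f "{k}"] by simp
        then show ?thesis by (simp only: f_def)
      qed
      finally show ?thesis .
    qed (simp add: ennreal_neg)
  qed
  also have "\<dots> = (\<Sum>k. \<integral>\<^sup>+x. ennreal (w k) * indicator (cball (0::'a) (r k)) x \<partial>lborel)"
    by (intro nn_integral_suminf borel_measurable_times_ennreal borel_measurable_const
        borel_measurable_indicator) simp
  also have "\<dots> = (\<Sum>k. ennreal (w k * (unit_ball_vol (real DIM('a)) * r k ^ DIM('a))))"
    using r w by (simp add: nn_integral_cmult_indicator emeasure_cball ennreal_mult)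
  also have "\<dots> = ennreal s"
    using sums r w by (intro suminf_ennreal_eq) (auto intro!: mult_nonneg_nonneg)
  finally show ?thesis .
qed

lemma ex_dyadic_shell:
  fixes t :: real
  assumes "t \<ge> 1"
  shows "\<exists>k. 2 ^ k \<le> t \<and> t < 2 ^ (k + 1)"
proof -
  obtain m where "t < 2 ^ m" using real_arch_pow[of 2 t] by auto
  define k where "k = (LEAST m. t < 2 ^ m)"
  have k: "t < 2 ^ k" unfolding k_def by (rule LeastI) fact
  then have "k \<noteq> 0" using assms by (cases k) auto
  then have "\<not> t < 2 ^ (k - 1)"
    unfolding k_def[symmetric] using not_less_Least[of "k - 1" "\<lambda>m. t < 2 ^ m"] by (simp add: k_def)
  then show ?thesis
    using k \<open>k \<noteq> 0\<close> by (intro exI[of _ "k - 1"]) auto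
qed

lemma nn_integral_norm_powr_outside_ball:
  assumes "\<alpha> > real DIM('a::euclidean_space)"
  shows "\<exists>L>0. \<forall>\<rho>>0. (\<integral>\<^sup>+x. ennreal (norm (x::'a) powr (- \<alpha>) * indicator {x. norm x \<ge> \<rho>} x) \<partial>lborel)
    \<le> ennreal (L * \<rho> powr (real DIM('a) - \<alpha>))"
proof -
  let ?n = "real DIM('a)" and ?v = "unit_ball_vol (real DIM('a))"
  define z where "z = 2 powr (?n - \<alpha>)"
  have z: "0 < z" "z < 1" using assms by (auto simp: z_def powr_less_one)
  \<comment> \<open>Each shell is enclosed in a ball of twice its inner radius, whence
    \<open>2 ^ DIM('a)\<close>; the rest is the geometric series with ratio
    \<open>z\<close>.\<close>
  define L where "L = ?v * 2 ^ DIM('a) / (1 - z)"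
  have L: "L > 0" using z by (simp add: L_def)
  have "(\<integral>\<^sup>+x. ennreal (norm (x::'a) powr (- \<alpha>) * indicator {x. norm x \<ge> \<rho>} x) \<partial>lborel)
    \<le> ennreal (L * \<rho> powr (?n - \<alpha>))" if \<rho>: "\<rho> > 0" for \<rho>
  proof (rule nn_integral_le_suminf[where r="\<lambda>k. 2 ^ (k + 1) * \<rho>" and w="\<lambda>k. (2 ^ k * \<rho>) powr (- \<alpha>)"])
    fix x :: 'a assume "norm x powr (- \<alpha>) * indicator {x. norm x \<ge> \<rho>} x > 0"
    then have x: "norm x \<ge> \<rho>" by (auto simp: indicator_def of_bool_def split: if_splits)
    then have "norm x / \<rho> \<ge> 1" using \<rho> by simp
    then obtain k where k: "2 ^ k \<le> norm x / \<rho>" "norm x / \<rho> < 2 ^ (k + 1)"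
      using ex_dyadic_shell by blast
    then have "2 ^ k * \<rho> \<le> norm x" "norm x \<le> 2 ^ (k + 1) * \<rho>"
      using \<rho> by (simp_all add: field_simps)
    then show "\<exists>k. norm x \<le> 2 ^ (k + 1) * \<rho> \<and>
        norm x powr (- \<alpha>) * indicator {x. norm x \<ge> \<rho>} x \<le> (2 ^ k * \<rho>) powr (- \<alpha>)"
      using \<rho> assms x by (intro exI[of _ k]) (auto intro!: powr_mono2')
  next
    have "(2 ^ k * \<rho>) powr (- \<alpha>) * (?v * (2 ^ (k + 1) * \<rho>) ^ DIM('a)) =
        \<rho> powr (?n - \<alpha>) * ?v * 2 ^ DIM('a) * z ^ k" for k
    proof -
      have "(2 ^ k * \<rho>) powr (- \<alpha>) * (2 ^ k * \<rho>) ^ DIM('a) = (2 ^ k * \<rho>) powr (?n - \<alpha>)"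
        using \<rho> by (simp add: powr_realpow[symmetric] powr_add[symmetric])
      also have "\<dots> = z ^ k * \<rho> powr (?n - \<alpha>)"
        using \<rho> z by (simp add: powr_mult z_def powr_realpow[symmetric] powr_powr mult.commute)
      finally have "(2 ^ k * \<rho>) powr (- \<alpha>) * (2 ^ k * \<rho>) ^ DIM('a) = z ^ k * \<rho> powr (?n - \<alpha>)" .
      then show ?thesis
        by (simp add: power_mult_distrib algebra_simps)
    qed
    moreover have "(\<lambda>k. \<rho> powr (?n - \<alpha>) * ?v * 2 ^ DIM('a) * z ^ k) sums
       (\<rho> powr (?n - \<alpha>) * ?v * 2 ^ DIM('a) * (1 / (1 - z)))"
      using z by (intro sums_mult geometric_sums) auto
    ultimately have "(\<lambda>k. (2 ^ k * \<rho>) powr (- \<alpha>) * (?v * (2 ^ (k + 1) * \<rho>) ^ DIM('a))) sums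
        (\<rho> powr (?n - \<alpha>) * ?v * 2 ^ DIM('a) * (1 / (1 - z)))"
      by (simp only:)
    then show "(\<lambda>k. (2 ^ k * \<rho>) powr (- \<alpha>) * (?v * (2 ^ (k + 1) * \<rho>) ^ DIM('a))) sums
        (L * \<rho> powr (?n - \<alpha>))"
      by (simp only: L_def mult_ac divide_inverse mult_1_left)
  qed (use \<rho> in auto)
  with L show ?thesis by blast
qed

lemma nn_integral_norm_powr_inside_ball:
  assumes "0 \<le> \<alpha>" "\<alpha> < real DIM('a::euclidean_space)"
  shows "\<exists>L>0. \<forall>\<rho>>0. (\<integral>\<^sup>+x. ennreal (norm (x::'a) powr (- \<alpha>) * indicator {x. norm x < \<rho>} x) \<partial>lborel)
    \<le> ennreal (L * \<rho> powr (real DIM('a) - \<alpha>))"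
proof -
  let ?n = "real DIM('a)" and ?v = "unit_ball_vol (real DIM('a))"
  define z where "z = 2 powr (\<alpha> - ?n)"
  have z: "0 < z" "z < 1" using assms by (auto simp: z_def powr_less_one)
  \<comment> \<open>The weight is evaluated at the inner radius of a shell, half of the outer one,
    whence the factor 2^\<alpha>.\<close>
  define L where "L = ?v * 2 powr \<alpha> / (1 - z)"
  have L: "L > 0" using z by (simp add: L_def)
  have "(\<integral>\<^sup>+x. ennreal (norm (x::'a) powr (- \<alpha>) * indicator {x. norm x < \<rho>} x) \<partial>lborel)
    \<le> ennreal (L * \<rho> powr (?n - \<alpha>))" if \<rho>: "\<rho> > 0" for \<rho>
  proof (rule nn_integral_le_suminf[where r="\<lambda>k. \<rho> / 2 ^ k" and w="\<lambda>k. (\<rho> / 2 ^ (k + 1)) powr (- \<alpha>)"])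
    fix x :: 'a assume "norm x powr (- \<alpha>) * indicator {x. norm x < \<rho>} x > 0"
    \<comment> \<open>The origin drops out because \<open>0 powr (- \<alpha>)\<close> is 0; the
      shells do not cover it.\<close>
    then have x: "norm x < \<rho>" "x \<noteq> 0" by (auto simp: indicator_def of_bool_def split: if_splits)
    then have "\<rho> / norm x \<ge> 1" using \<rho> by simp
    then obtain k where k: "2 ^ k \<le> \<rho> / norm x" "\<rho> / norm x < 2 ^ (k + 1)"
      using ex_dyadic_shell by blast
    then have "norm x \<le> \<rho> / 2 ^ k" "\<rho> / 2 ^ (k + 1) \<le> norm x"
      using x by (simp_all add: field_simps)
    then show "\<exists>k. norm x \<le> \<rho> / 2 ^ k \<and>
        norm x powr (- \<alpha>) * indicator {x. norm x < \<rho>} x \<le> (\<rho> / 2 ^ (k + 1)) powr (- \<alpha>)"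
      using \<rho> assms x by (intro exI[of _ k]) (auto intro!: powr_mono2')
  next
    have "(\<rho> / 2 ^ (k + 1)) powr (- \<alpha>) * (?v * (\<rho> / 2 ^ k) ^ DIM('a)) =
        \<rho> powr (?n - \<alpha>) * ?v * 2 powr \<alpha> * z ^ k" for k
    proof -
      have "(\<rho> / 2 ^ (k + 1)) powr (- \<alpha>) = 2 powr \<alpha> * (\<rho> / 2 ^ k) powr (- \<alpha>)"
      proof -
        have "\<rho> / 2 ^ (k + 1) = (1 / 2) * (\<rho> / 2 ^ k)" by simp
        then have "(\<rho> / 2 ^ (k + 1)) powr (- \<alpha>) = (1 / 2) powr (- \<alpha>) * (\<rho> / 2 ^ k) powr (- \<alpha>)"
          using \<rho> by (simp only: powr_mult)
        then show ?thesis by (simp add: powr_divide powr_minus)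
      qed
      moreover have "(\<rho> / 2 ^ k) powr (- \<alpha>) * (\<rho> / 2 ^ k) ^ DIM('a) = (\<rho> / 2 ^ k) powr (?n - \<alpha>)"
        using \<rho> by (simp add: powr_realpow[symmetric] powr_add[symmetric])
      moreover have "(\<rho> / 2 ^ k) powr (?n - \<alpha>) = z ^ k * \<rho> powr (?n - \<alpha>)"
      proof -
        have "\<rho> / 2 ^ k = 2 powr (- real k) * \<rho>"
          by (simp add: powr_minus powr_realpow divide_inverse)
        then have "(\<rho> / 2 ^ k) powr (?n - \<alpha>) = (2 powr (- real k)) powr (?n - \<alpha>) * \<rho> powr (?n - \<alpha>)"
          using \<rho> by (simp only: powr_mult)
        also have "(2 powr (- real k)) powr (?n - \<alpha>) = z powr (real k)"
          unfolding z_def powr_powr by (simp add: algebra_simps)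
        finally show ?thesis using z by (simp add: powr_realpow)
      qed
      ultimately show ?thesis
        by (simp add: mult_ac)
    qed
    moreover have "(\<lambda>k. \<rho> powr (?n - \<alpha>) * ?v * 2 powr \<alpha> * z ^ k) sums
       (\<rho> powr (?n - \<alpha>) * ?v * 2 powr \<alpha> * (1 / (1 - z)))"
      using z by (intro sums_mult geometric_sums) auto
    ultimately have "(\<lambda>k. (\<rho> / 2 ^ (k + 1)) powr (- \<alpha>) * (?v * (\<rho> / 2 ^ k) ^ DIM('a))) sums
        (\<rho> powr (?n - \<alpha>) * ?v * 2 powr \<alpha> * (1 / (1 - z)))"
      by (simp only:)
    then show "(\<lambda>k. (\<rho> / 2 ^ (k + 1)) powr (- \<alpha>) * (?v * (\<rho> / 2 ^ k) ^ DIM('a))) sums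
        (L * \<rho> powr (?n - \<alpha>))"
      by (simp only: L_def mult_ac divide_inverse mult_1_left)
  qed (use \<rho> in auto)
  with L show ?thesis by blast
qed

lemma kernel_borel_measurable: "\<delta> > 0 \<Longrightarrow> kernel \<delta> R \<in> borel_measurable borel"
  by (intro borel_measurable_continuous_onI Ck_imp_continuous_on[of 0] Ck_kernel)

text \<open>The bound obtained degenerates as \<open>\<delta>\<close> tends to 0; it is meant for
  integrability of products with a density, not for estimates.\<close>

lemma kernel_bounded:
  assumes "\<delta> > 0" "R > 0"
  shows "\<exists>C. \<forall>x::'a::euclidean_space. norm (kernel \<delta> R x) \<le> C"
proof -
  have "norm (kernel \<delta> R x) \<le> (\<delta>\<^sup>2) powr (- real DIM('a) / 2) * 1 * R" for x :: 'a
  proof (cases "norm x \<ge> R")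
    case False
    have "norm (kernel \<delta> R x) =
        (x \<bullet> x + \<delta>\<^sup>2) powr (- real DIM('a) / 2) * cutoff ((x \<bullet> x / R\<^sup>2) ^ DIM('a)) * norm x"
      unfolding kernel_def by (simp add: abs_mult cutoff_nonneg)
    also have "\<dots> \<le> (\<delta>\<^sup>2) powr (- real DIM('a) / 2) * 1 * R"
      using False assms by (intro mult_mono powr_mono2' cutoff_le_1) (auto intro: cutoff_nonneg)
    finally show ?thesis .
  qed (use assms in \<open>simp add: kernel_eq_0\<close>)
  then show ?thesis by blast
qed

text \<open>The singularity has order n - 1 < n, so it is integrable, and scaling gives the first
  power of the radius.\<close>

lemma kernel_inside_L1:
  "\<exists>L>0. \<forall>\<rho>>0. \<forall>\<delta> R. (\<integral>\<^sup>+x. ennreal (norm (kernel \<delta> R (x::'a::euclidean_space)) * indicator {x. norm x < \<rho>} x) \<partial>lborel)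
     \<le> ennreal (L * \<rho>)"
proof -
  obtain L where L: "L > 0" "\<And>\<rho>. \<rho> > 0 \<Longrightarrow>
      (\<integral>\<^sup>+x. ennreal (norm (x::'a) powr (- (real DIM('a) - 1)) * indicator {x. norm x < \<rho>} x) \<partial>lborel)
      \<le> ennreal (L * \<rho> powr (real DIM('a) - (real DIM('a) - 1)))"
    using nn_integral_norm_powr_inside_ball[where 'a='a and \<alpha>="real DIM('a) - 1"] by auto
  have "(\<integral>\<^sup>+x. ennreal (norm (kernel \<delta> R (x::'a)) * indicator {x. norm x < \<rho>} x) \<partial>lborel) \<le> ennreal (L * \<rho>)"
    if "\<rho> > 0" for \<rho> \<delta> R
  proof -
    have "(\<integral>\<^sup>+x. ennreal (norm (kernel \<delta> R (x::'a)) * indicator {x. norm x < \<rho>} x) \<partial>lborel) \<le>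
      (\<integral>\<^sup>+x. ennreal (norm (x::'a) powr (- (real DIM('a) - 1)) * indicator {x. norm x < \<rho>} x) \<partial>lborel)"
      using norm_kernel_le[of \<delta> R] by (intro nn_integral_mono ennreal_leI mult_right_mono) auto
    also have "\<dots> \<le> ennreal (L * \<rho>)"
      using L(2)[OF that] that by simp
    finally show ?thesis .
  qed
  with L(1) show ?thesis by blast
qed

lemma kernel_outside_conj_norm:
  assumes p: "1 \<le> p" "p < real DIM('a::euclidean_space)"
  shows "\<exists>L>0. \<forall>\<rho>>0. \<forall>\<delta>>0. \<forall>R. conj_norm_le p
    (\<lambda>x::'a. norm (kernel \<delta> R x) * indicator {x. norm x \<ge> \<rho>} x) (L * \<rho> powr (1 - real DIM('a) / p))"
proof (cases "p = 1")
  case True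
  have "conj_norm_le p (\<lambda>x::'a. norm (kernel \<delta> R x) * indicator {x. norm x \<ge> \<rho>} x)
      (1 * \<rho> powr (1 - real DIM('a) / p))" if "\<rho> > 0" "\<delta> > 0" for \<rho> \<delta> R
  proof -
    have [measurable]: "kernel \<delta> R \<in> borel_measurable (borel :: 'a measure)"
      using kernel_borel_measurable that by blast
    have "norm (kernel \<delta> R x) \<le> \<rho> powr (1 - real DIM('a))" if "norm x \<ge> \<rho>" for x :: 'a
    proof -
      have "norm x powr (1 - real DIM('a)) \<le> \<rho> powr (1 - real DIM('a))"
        using that \<open>\<rho> > 0\<close> p by (intro powr_mono2') auto
      with norm_kernel_le[of \<delta> R x] show ?thesis by simp
    qed
    then show ?thesis
      using that True unfolding conj_norm_le_def by (auto simp: indicator_def)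
  qed
  then show ?thesis by (intro exI[of _ 1]) auto
next
  case False
  let ?n = "real DIM('a)"
  define q where "q = p / (p - 1)"
  have q: "q > 1" using p False by (simp add: q_def field_simps)
  have qp: "1 / q = 1 - 1 / p" using p False by (simp add: q_def field_simps)
  define \<alpha> where "\<alpha> = (?n - 1) * q"
  \<comment> \<open>For p > 1, (n - 1) q > n is equivalent to p < n: exactly then the tail of
    |x|^(1-n) lies in L^q.\<close>
  have "\<alpha> > ?n" using p False by (simp add: \<alpha>_def q_def field_simps)
  from nn_integral_norm_powr_outside_ball[OF this]
  obtain L where L: "L > 0" "\<And>\<rho>. \<rho> > 0 \<Longrightarrow>
      (\<integral>\<^sup>+x. ennreal (norm (x::'a) powr (- \<alpha>) * indicator {x. norm x \<ge> \<rho>} x) \<partial>lborel)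
      \<le> ennreal (L * \<rho> powr (?n - \<alpha>))"
    by blast
  have "conj_norm_le p (\<lambda>x::'a. norm (kernel \<delta> R x) * indicator {x. norm x \<ge> \<rho>} x)
      (L powr (1 / q) * \<rho> powr (1 - ?n / p))" if "\<rho> > 0" "\<delta> > 0" for \<rho> \<delta> R
  proof -
    have [measurable]: "kernel \<delta> R \<in> borel_measurable (borel :: 'a measure)"
      using kernel_borel_measurable that by blast
    have "(\<integral>\<^sup>+x. ennreal (\<bar>norm (kernel \<delta> R (x::'a)) * indicator {x. norm x \<ge> \<rho>} x\<bar> powr q) \<partial>lborel)
      \<le> (\<integral>\<^sup>+x. ennreal (norm (x::'a) powr (- \<alpha>) * indicator {x. norm x \<ge> \<rho>} x) \<partial>lborel)"
    proof (intro nn_integral_mono ennreal_leI)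
      fix x :: 'a
      show "\<bar>norm (kernel \<delta> R (x::'a)) * indicator {x. norm x \<ge> \<rho>} x\<bar> powr q
          \<le> norm (x::'a) powr (- \<alpha>) * indicator {x. norm x \<ge> \<rho>} x"
      proof (cases "norm x \<ge> \<rho>")
        case True
        have "norm (kernel \<delta> R x) powr q \<le> (norm x powr (1 - ?n)) powr q"
          using q by (intro powr_mono2 norm_kernel_le) auto
        also have "\<dots> = norm x powr (- \<alpha>)"
          by (simp add: powr_powr \<alpha>_def algebra_simps)
        finally show ?thesis using True by simp
      qed simp
    qed
    also have "\<dots> \<le> ennreal (L * \<rho> powr (?n - \<alpha>))"
      using L that by blast
    also have "L * \<rho> powr (?n - \<alpha>) = (L powr (1 / q) * \<rho> powr (1 - ?n / p)) powr q"
    proof -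
      have "(1 - ?n / p) * q = ?n - \<alpha>"
        using p False by (simp add: q_def \<alpha>_def field_simps)
      then show ?thesis
        using L q that by (simp add: powr_mult powr_powr)
    qed
    finally show ?thesis
      using that L False unfolding conj_norm_le_def q_def[symmetric] by simp
  qed
  then show ?thesis using L by (intro exI[of _ "L powr (1 / q)"]) auto
qed

text \<open>The total flux of x / |x|^n through spheres about 0, that is, the surface area of the
  unit sphere.\<close>

definition mollifier_mass :: "'a::euclidean_space itself \<Rightarrow> real" where
  "mollifier_mass _ = (\<integral>x. mollifier 1 (x::'a) \<partial>lborel)"

lemma mollifier_measurable [measurable]: "mollifier \<delta> \<in> borel_measurable borel"
  unfolding mollifier_def[abs_def] by measurable

lemma mollifier_nonneg: "0 \<le> mollifier \<delta> x"
  by (simp add: mollifier_def)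

lemma mollifier_scaleR:
  assumes "\<delta> > 0"
  shows "\<delta> ^ DIM('a) * mollifier \<delta> (\<delta> *\<^sub>R z) = mollifier 1 (z::'a::euclidean_space)"
proof -
  let ?n = "real DIM('a)"
  have "(\<delta> *\<^sub>R z) \<bullet> (\<delta> *\<^sub>R z) + \<delta>\<^sup>2 = \<delta>\<^sup>2 * (z \<bullet> z + 1)"
    by (simp add: power2_eq_square algebra_simps)
  then have "\<delta> ^ DIM('a) * mollifier \<delta> (\<delta> *\<^sub>R z) =
     (\<delta> ^ DIM('a) * \<delta>\<^sup>2 * (\<delta>\<^sup>2) powr (- ?n / 2 - 1)) * mollifier 1 z"
    using assms by (simp add: mollifier_def powr_mult add_nonneg_pos)
  also have "(\<delta>\<^sup>2) powr (- ?n / 2 - 1) = \<delta> powr (- ?n - 2)"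
    using assms by (simp add: powr_powr algebra_simps flip: powr_numeral)
  also have "\<delta> ^ DIM('a) * \<delta>\<^sup>2 * \<delta> powr (- ?n - 2) = 1"
    using assms by (simp add: powr_diff powr_minus powr_realpow field_simps)
  finally show ?thesis by simp
qed

text \<open>Near 0 the function is at most n, and at infinity it decays like n |x|^(-n-2).\<close>

lemma mollifier_1_integrable: "integrable lborel (mollifier 1 :: 'a::euclidean_space \<Rightarrow> real)"
proof -
  let ?n = "real DIM('a)"
  obtain L where L: "(\<integral>\<^sup>+x. ennreal (norm (x::'a) powr (- (?n + 2)) * indicator {x. norm x \<ge> 1} x) \<partial>lborel)
      \<le> ennreal (L * 1 powr (?n - (?n + 2)))"
    using nn_integral_norm_powr_outside_ball[where 'a='a and \<alpha>="?n + 2"] by (auto dest!: spec[of _ "1::real"])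
  have [measurable]: "cball (0::'a) r \<in> sets borel" for r by simp
  have "(\<integral>\<^sup>+x. ennreal (mollifier 1 (x::'a)) \<partial>lborel) \<le>
      (\<integral>\<^sup>+x. ennreal ?n * indicator (cball 0 1) x + ennreal ?n * ennreal (norm (x::'a) powr (- (?n + 2)) * indicator {x. norm x \<ge> 1} x) \<partial>lborel)"
  proof (intro nn_integral_mono)
    fix x :: 'a
    show "ennreal (mollifier 1 x) \<le> ennreal ?n * indicator (cball 0 1) x +
        ennreal ?n * ennreal (norm x powr (- (?n + 2)) * indicator {x. norm x \<ge> 1} x)"
    proof (cases "norm x \<ge> 1")
      case True
      have "(x \<bullet> x + 1) powr (- ?n / 2 - 1) \<le> (x \<bullet> x) powr (- ?n / 2 - 1)"
        using True by (intro powr_mono2') auto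
      also have "\<dots> = norm x powr (- (?n + 2))"
        using True by (simp add: dot_square_norm powr_powr algebra_simps flip: powr_numeral)
      finally have "ennreal (mollifier 1 x) \<le> ennreal (?n * norm x powr (- (?n + 2)))"
        by (intro ennreal_leI) (simp add: mollifier_def)
      also have "\<dots> \<le> ennreal ?n * indicator (cball 0 1) x +
        ennreal ?n * ennreal (norm x powr (- (?n + 2)) * indicator {x. norm x \<ge> 1} x)"
        using True by (simp add: ennreal_mult' add_increasing)
      finally show ?thesis .
    next
      case False
      have "(x \<bullet> x + 1) powr (- ?n / 2 - 1) \<le> 1 powr (- ?n / 2 - 1)"
        by (intro powr_mono2') auto
      then have "ennreal (mollifier 1 x) \<le> ennreal ?n"
        by (intro ennreal_leI) (simp add: mollifier_def)
      then show ?thesis using False by simp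
    qed
  qed
  also have "\<dots> = ennreal ?n * emeasure lborel (cball (0::'a) 1) + ennreal ?n * (\<integral>\<^sup>+x. ennreal (norm (x::'a) powr (- (?n + 2)) * indicator {x. norm x \<ge> 1} x) \<partial>lborel)"
    by (subst nn_integral_add, measurable, measurable) (simp add: nn_integral_cmult nn_integral_cmult_indicator)
  also have "\<dots> < \<infinity>"
  proof -
    have "emeasure lborel (cball (0::'a) 1) < top"
      using emeasure_lborel_cball_finite[of "0::'a" 1] by simp
    with le_less_trans[OF L ennreal_less_top] show ?thesis
      by (simp add: ennreal_mult_less_top)
  qed
  finally show ?thesis
    by (intro integrableI_nonneg) (auto simp: mollifier_nonneg)
qed

lemma nn_integral_mollifier_1:
  "(\<integral>\<^sup>+x. ennreal (mollifier 1 (x::'a::euclidean_space)) \<partial>lborel) = ennreal (mollifier_mass TYPE('a))"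
  unfolding mollifier_mass_def
  by (rule nn_integral_eq_integral[OF mollifier_1_integrable]) (simp add: mollifier_nonneg)

lemma nn_integral_mollifier:
  assumes "\<delta> > 0"
  shows "(\<integral>\<^sup>+x. ennreal (mollifier \<delta> (x::'a::euclidean_space)) \<partial>lborel) = ennreal (mollifier_mass TYPE('a))"
proof -
  have "(\<integral>\<^sup>+x. ennreal (mollifier \<delta> (x::'a)) \<partial>lborel) =
      (\<integral>\<^sup>+x. ennreal (mollifier \<delta> x) \<partial>(density (distr lborel borel (\<lambda>x::'a. 0 + \<delta> *\<^sub>R x)) (\<lambda>_. ennreal (\<bar>\<delta>\<bar> ^ DIM('a)))))"
    using assms by (subst lborel_affine[of \<delta> 0]) auto
  also have "\<dots> = (\<integral>\<^sup>+x. ennreal (\<delta> ^ DIM('a)) * ennreal (mollifier \<delta> (\<delta> *\<^sub>R (x::'a))) \<partial>lborel)"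
    using assms by (simp add: nn_integral_density nn_integral_distr)
  also have "\<dots> = (\<integral>\<^sup>+x. ennreal (mollifier 1 (x::'a)) \<partial>lborel)"
    using assms by (simp add: mollifier_scaleR mollifier_nonneg flip: ennreal_mult)
  finally show ?thesis by (simp add: nn_integral_mollifier_1)
qed

lemma mollifier_mass_pos: "mollifier_mass TYPE('a::euclidean_space) > 0"
proof -
  have "mollifier_mass TYPE('a) \<ge> 0"
    unfolding mollifier_mass_def by (simp add: mollifier_nonneg)
  moreover have "mollifier_mass TYPE('a) \<noteq> 0"
  proof
    assume "mollifier_mass TYPE('a) = 0"
    then have "AE x in lborel. mollifier 1 (x::'a) = 0"
      unfolding mollifier_mass_def
      by (subst (asm) integral_nonneg_eq_0_iff_AE) (auto simp: mollifier_1_integrable mollifier_nonneg)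
    moreover have "mollifier 1 (x::'a) \<noteq> 0" for x
    proof -
      have "x \<bullet> x + 1 > 0" using inner_ge_zero[of x] by linarith
      then show ?thesis by (simp add: mollifier_def)
    qed
    ultimately have "AE x in (lborel :: 'a measure). False" by simp
    then show False
      by (simp add: AE_iff_null trivial_limit_def null_sets_def ae_filter_eq_bot_iff flip: trivial_limit_def)
  qed
  ultimately show ?thesis by simp
qed

text \<open>The mass is in fact \<open>2\<close>; a step function with two steps already gives the bound.\<close>

lemma mollifier_mass_ge_1:
  assumes "DIM('a::euclidean_space) = 1"
  shows "mollifier_mass TYPE('a) \<ge> 1"
proof -
  have v: "unit_ball_vol 1 = 2" by (simp add: unit_ball_vol_1)
  \<comment> \<open>Comparing squares avoids fractional powers. The heights used below satisfy
    0.71^2 (5/4)^3 < 1 and 0.35^2 2^3 < 1.\<close>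
  have low: "(x \<bullet> x + 1) powr (- 3 / 2) \<ge> y" if "y > 0" "x \<bullet> x \<le> z" "y\<^sup>2 * (z + 1) ^ 3 \<le> 1" for x :: 'a and y z :: real
  proof -
    have pos: "x \<bullet> x + 1 > 0" "z + 1 > 0" using inner_ge_zero[of x] that by linarith+
    have "y\<^sup>2 \<le> (z + 1) powr (- 3)"
      using that pos by (simp add: powr_minus powr_numeral divide_simps)
    also have "\<dots> \<le> (x \<bullet> x + 1) powr (- 3)"
      using that pos by (intro powr_mono2') auto
    also have "\<dots> = ((x \<bullet> x + 1) powr (- 3 / 2))\<^sup>2"
      using pos by (simp add: power2_eq_square flip: powr_add)
    finally show ?thesis by (rule power2_le_imp_le) simp
  qed
  have [measurable]: "cball (0::'a) r \<in> sets borel" for r by simp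
  have "emeasure lborel (cball (0::'a) (1/2)) = ennreal 1" "emeasure lborel (cball (0::'a) 1) = ennreal 2"
    using assms v by (simp_all add: emeasure_cball)
  \<comment> \<open>The step function has height 0.36 + 0.35 = 0.71 on the inner ball and 0.35
    around it; its integral is 0.36 + 0.70 = 1.06.\<close>
  then have "ennreal 1 \<le> ennreal (36/100) * emeasure lborel (cball (0::'a) (1/2)) + ennreal (35/100) * emeasure lborel (cball (0::'a) 1)"
    by (simp only: ennreal_mult[symmetric] ennreal_plus[symmetric]) simp
  also have "\<dots> = (\<integral>\<^sup>+x. ennreal (36/100) * indicator (cball (0::'a) (1/2)) x + ennreal (35/100) * indicator (cball 0 1) x \<partial>lborel)"
    by (subst nn_integral_add, measurable, measurable) (simp add: nn_integral_cmult_indicator)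
  also have "\<dots> \<le> (\<integral>\<^sup>+x. ennreal (mollifier 1 (x::'a)) \<partial>lborel)"
  proof (intro nn_integral_mono)
    fix x :: 'a
    have m: "mollifier 1 x = (x \<bullet> x + 1) powr (- 3 / 2)"
      using assms by (simp add: mollifier_def)
    consider "norm x \<le> 1/2" | "norm x > 1/2" "norm x \<le> 1" | "norm x > 1" by linarith
    then show "ennreal (36/100) * indicator (cball (0::'a) (1/2)) x + ennreal (35/100) * indicator (cball 0 1) x
       \<le> ennreal (mollifier 1 x)"
    proof cases
      case 1
      then have "x \<bullet> x \<le> (1/2)\<^sup>2" by (simp add: dot_square_norm power_mono)
      then have "(x \<bullet> x + 1) powr (- 3 / 2) \<ge> 71/100"
        by (intro low[where z="1/4"]) (auto simp: power2_eq_square power3_eq_cube)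
      with 1 show ?thesis unfolding m
        by (simp add: ennreal_plus[symmetric] del: ennreal_plus)
    next
      case 2
      then have "x \<bullet> x \<le> 1\<^sup>2"
        unfolding dot_square_norm by (intro power_mono) auto
      then have "(x \<bullet> x + 1) powr (- 3 / 2) \<ge> 35/100"
        by (intro low[where z="1"]) (auto simp: power2_eq_square power3_eq_cube)
      with 2 show ?thesis unfolding m
        by (simp add: ennreal_leI)
    qed simp
  qed
  also have "\<dots> = ennreal (mollifier_mass TYPE('a))" by (rule nn_integral_mollifier_1)
  finally show ?thesis
    using mollifier_mass_pos[where 'a='a] by simp
qed

section \<open>Potentials of compactly supported densities\<close>

text \<open>A continuous stand-in for the sign of \<open>f\<close> on a level set. Continuity is
  enough, as the smoothness of the test field comes from the kernel; the mass bound \<open>m\<close>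
  together with \<open>\<bar>g y\<bar> \<le> 1\<close> controls every L^q norm.\<close>

locale charge =
  fixes g :: "'a::euclidean_space \<Rightarrow> real" and a b :: 'a and m p :: real
  assumes cont: "continuous_on UNIV g" and supp: "\<And>y. y \<notin> cbox a b \<Longrightarrow> g y = 0"
    and abs_le_1: "\<And>y. \<bar>g y\<bar> \<le> 1" and m_pos: "0 < m" and mass_le: "(\<integral>y. \<bar>g y\<bar> \<partial>lborel) \<le> m"
    and p_ge_1: "1 \<le> p"
begin

definition potential :: "real \<Rightarrow> real \<Rightarrow> 'a \<Rightarrow> 'a" where
  "potential \<delta> R x = integral (cbox a b) (\<lambda>y. g y *\<^sub>R kernel \<delta> R (x - y))"

lemma g_measurable [measurable]: "g \<in> borel_measurable borel"
  by (rule borel_measurable_continuous_onI[OF cont])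

text \<open>Differentiation under the integral sign works with the integral over the box, the norm
  estimates with the Lebesgue integral over the whole space; \<open>supp\<close> makes the two
  agree.\<close>

lemma
  fixes h :: "'a \<Rightarrow> 'b::euclidean_space"
  assumes "continuous_on UNIV h"
  shows integrable_density: "integrable lborel (\<lambda>y. g y *\<^sub>R h y)"
    and integral_density: "integral (cbox a b) (\<lambda>y. g y *\<^sub>R h y) = (\<integral>y. g y *\<^sub>R h y \<partial>lborel)"
proof -
  have "integrable lborel (\<lambda>y. indicator (cbox a b) y *\<^sub>R (g y *\<^sub>R h y))"
    by (intro borel_integrable_compact compact_cbox continuous_on_subset[OF continuous_on_scaleR[OF cont assms]]) auto
  moreover have "(\<lambda>y. indicator (cbox a b) y *\<^sub>R (g y *\<^sub>R h y)) = (\<lambda>y. g y *\<^sub>R h y)"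
    using supp by (auto simp: indicator_def fun_eq_iff)
  ultimately show int: "integrable lborel (\<lambda>y. g y *\<^sub>R h y)" by simp
  have "integral (cbox a b) (\<lambda>y. g y *\<^sub>R h y) = integral UNIV (\<lambda>y. if y \<in> cbox a b then g y *\<^sub>R h y else 0)"
    by (simp only: integral_restrict_UNIV)
  also have "(\<lambda>y. if y \<in> cbox a b then g y *\<^sub>R h y else 0) = (\<lambda>y. g y *\<^sub>R h y)"
    using supp by auto
  also have "integral UNIV (\<lambda>y. g y *\<^sub>R h y) = (\<integral>y. g y *\<^sub>R h y \<partial>lborel)"
    by (rule integral_lborel[OF int])
  finally show "integral (cbox a b) (\<lambda>y. g y *\<^sub>R h y) = (\<integral>y. g y *\<^sub>R h y \<partial>lborel)" .
qed

lemma integrable_g: "integrable lborel g"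
  using integrable_density[of "\<lambda>_. 1::real"] by simp

text \<open>As |g| \<le> 1, its q-th power is at most |g|, so the mass bound carries over;
  \<open>1 - 1 / p\<close> is 1/q, which is 0 for p = 1.\<close>

lemma conj_norm_g: "conj_norm_le p (\<lambda>y. \<bar>g y\<bar>) (m powr (1 - 1 / p))"
proof (cases "p = 1")
  case True
  then show ?thesis using abs_le_1 m_pos by (simp add: conj_norm_le_def)
next
  case False
  define q where "q = p / (p - 1)"
  have q: "q > 1" "(1 - 1 / p) * q = 1"
    using p_ge_1 False by (simp_all add: q_def field_simps)
  have "(\<integral>\<^sup>+y. ennreal (\<bar>\<bar>g y\<bar>\<bar> powr q) \<partial>lborel) \<le> (\<integral>\<^sup>+y. ennreal \<bar>g y\<bar> \<partial>lborel)"
  proof (intro nn_integral_mono ennreal_leI)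
    fix y
    show "\<bar>\<bar>g y\<bar>\<bar> powr q \<le> \<bar>g y\<bar>"
    proof (cases "g y = 0")
      case False
      then have "\<bar>g y\<bar> powr q \<le> \<bar>g y\<bar> powr 1"
        using q abs_le_1[of y] by (intro powr_mono') auto
      then show ?thesis by simp
    qed simp
  qed
  also have "\<dots> = ennreal (\<integral>y. \<bar>g y\<bar> \<partial>lborel)"
    using integrable_g by (intro nn_integral_eq_integral) auto
  also have "\<dots> \<le> ennreal m" using mass_le by (rule ennreal_leI)
  also have "m = (m powr (1 - 1 / p)) powr q"
    using m_pos q by (simp add: powr_powr)
  finally show ?thesis
    using False m_pos by (simp add: conj_norm_le_def q_def)
qed

lemma continuous_kernel_shift: "\<delta> > 0 \<Longrightarrow> continuous_on UNIV (\<lambda>y. kernel \<delta> R (x - y :: 'a))"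
  by (intro continuous_on_compose2[OF Ck_imp_continuous_on[OF Ck_kernel[of \<delta> 0]]] continuous_intros) auto

lemma potential_Cinf:
  assumes "\<delta> > 0" "R > 0"
  shows "potential \<delta> R \<in> Cinf_compact"
proof -
  have "Ck k (potential \<delta> R)" for k
    unfolding potential_def[abs_def] by (intro Ck_convolution cont Ck_kernel assms)
  moreover have "bounded {x. potential \<delta> R x \<noteq> 0}"
  proof -
    obtain r where r: "\<And>y. y \<in> cbox a b \<Longrightarrow> norm y \<le> r"
      using bounded_cbox[of a b] unfolding bounded_iff by blast
    have "potential \<delta> R x = 0" if "norm x > r + R" for x
    proof -
      have "kernel \<delta> R (x - y) = 0" if "y \<in> cbox a b" for y
      proof (rule kernel_eq_0)
        have "norm y \<le> r" using that by (rule r)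
        then show "norm (x - y) \<ge> R"
          using norm_triangle_ineq2[of x y] \<open>norm x > r + R\<close> by linarith
      qed fact
      then show ?thesis
        unfolding potential_def by (subst integral_cong[where g="\<lambda>_. 0"]) auto
    qed
    then show ?thesis
      unfolding bounded_iff by (intro exI[of _ "r + R"]) (auto simp: not_less[symmetric])
  qed
  ultimately show ?thesis
    by (simp add: Cinf_compact_def)
qed

lemma continuous_divergence_kernel:
  assumes "\<delta> > 0"
  shows "continuous_on UNIV (\<lambda>y. divergence (kernel \<delta> R) (x - y :: 'a))"
proof -
  have "continuous_on UNIV (\<lambda>x::'a. frechet_derivative (kernel \<delta> R) (at x) v)" for v
    using Ck_kernel[OF assms, of "Suc 0" R, where 'a='a] by simp
  then have "continuous_on UNIV (divergence (kernel \<delta> R :: 'a \<Rightarrow> 'a))"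
    unfolding divergence_def[abs_def] by (intro continuous_intros)
  then show ?thesis
    by (rule continuous_on_compose2) (auto intro: continuous_intros)
qed

lemma divergence_potential:
  assumes \<delta>: "\<delta> > 0"
  shows "divergence (potential \<delta> R) x = (\<integral>y. g y * divergence (kernel \<delta> R) (x - y) \<partial>lborel)"
proof -
  let ?K' = "\<lambda>x::'a. frechet_derivative (kernel \<delta> R) (at x)"
  have K': "(kernel \<delta> R has_derivative ?K' x) (at x)" for x :: 'a
    using Ck_kernel[OF \<delta>, of "Suc 0" R, where 'a='a] by (simp flip: frechet_derivative_works)
  have cK': "continuous_on UNIV (\<lambda>x. ?K' x v)" for v
    using Ck_kernel[OF \<delta>, of "Suc 0" R, where 'a='a] by simp
  have "(potential \<delta> R has_derivative (\<lambda>v. integral (cbox a b) (\<lambda>y. g y *\<^sub>R ?K' (x - y) v))) (at x)"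
    unfolding potential_def[abs_def] by (rule convolution_has_derivative[OF cont K' cK'])
  from frechet_derivative_at[OF this, symmetric]
  have "divergence (potential \<delta> R) x = (\<Sum>i\<in>Basis. integral (cbox a b) (\<lambda>y. g y *\<^sub>R ?K' (x - y) i) \<bullet> i)"
    by (simp add: divergence_def)
  also have "\<dots> = (\<Sum>i\<in>Basis. \<integral>y. (g y *\<^sub>R ?K' (x - y) i) \<bullet> i \<partial>lborel)"
  proof (intro sum.cong refl)
    fix i
    have c: "continuous_on UNIV (\<lambda>y. ?K' (x - y) i)"
      by (rule continuous_on_compose2[OF cK']) (auto intro: continuous_intros)
    show "integral (cbox a b) (\<lambda>y. g y *\<^sub>R ?K' (x - y) i) \<bullet> i = (\<integral>y. (g y *\<^sub>R ?K' (x - y) i) \<bullet> i \<partial>lborel)"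
      unfolding integral_density[OF c] by (rule integral_inner_left[symmetric]) (rule integrable_density[OF c])
  qed
  also have "\<dots> = (\<integral>y. (\<Sum>i\<in>Basis. (g y *\<^sub>R ?K' (x - y) i) \<bullet> i) \<partial>lborel)"
  proof (rule Bochner_Integration.integral_sum[symmetric])
    fix i
    have c: "continuous_on UNIV (\<lambda>y. ?K' (x - y) i)"
      by (rule continuous_on_compose2[OF cK']) (auto intro: continuous_intros)
    show "integrable lborel (\<lambda>y. (g y *\<^sub>R ?K' (x - y) i) \<bullet> i)"
      by (rule integrable_inner_left) (rule integrable_density[OF c])
  qed
  finally show ?thesis
    by (simp add: divergence_def sum_distrib_left)
qed

lemma norm_potential_le:
  assumes \<delta>: "\<delta> > 0"
  shows "norm (potential \<delta> R x) \<le> (\<integral>y. \<bar>g y\<bar> * norm (kernel \<delta> R (x - y)) \<partial>lborel)"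
proof -
  have "norm (potential \<delta> R x) = norm (\<integral>y. g y *\<^sub>R kernel \<delta> R (x - y) \<partial>lborel)"
    unfolding potential_def by (subst integral_density[OF continuous_kernel_shift[OF \<delta>]]) simp
  also have "\<dots> \<le> (\<integral>y. norm (g y *\<^sub>R kernel \<delta> R (x - y)) \<partial>lborel)"
    by (rule integral_norm_bound)
  finally show ?thesis by simp
qed

lemma potential_measurable: "\<delta> > 0 \<Longrightarrow> potential \<delta> R \<in> borel_measurable borel"
  using Ck_convolution[OF cont Ck_kernel, of \<delta> 0 a b R]
  unfolding potential_def[abs_def] by (intro borel_measurable_continuous_onI) simp

lemma divergence_potential_measurable: "\<delta> > 0 \<Longrightarrow> divergence (potential \<delta> R) \<in> borel_measurable borel"
proof -
  assume \<delta>: "\<delta> > 0"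
  have "Ck (Suc 0) (potential \<delta> R)"
    unfolding potential_def[abs_def] by (intro Ck_convolution cont Ck_kernel \<delta>)
  then have "continuous_on UNIV (divergence (potential \<delta> R))"
    unfolding divergence_def[abs_def] by (intro continuous_intros) simp
  then show ?thesis by (rule borel_measurable_continuous_onI)
qed

end

text \<open>In dimension one the kernel is bounded by 1, so the mass itself bounds the potential and
  \<open>L = 1\<close>. This explicit constant is kept for the endpoint n = p = 1.\<close>

lemma conj_norm_potential_le:
  assumes "(1 \<le> p \<and> p < real DIM('a::euclidean_space)) \<or> (DIM('a) = 1 \<and> p = 1)"
  shows "\<exists>L>0. (DIM('a) = 1 \<longrightarrow> L = 1) \<and> (\<forall>(g::'a \<Rightarrow> real) a b m \<delta> R. charge g a b m p \<longrightarrow> \<delta> > 0 \<longrightarrow> R > 0 \<longrightarrow>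
    conj_norm_le p (\<lambda>x. norm (charge.potential g a b \<delta> R x)) (L * m powr (1 - 1 / p + 1 / real DIM('a))))"
proof (cases "DIM('a) = 1")
  case True
  then have p: "p = 1" using assms by auto
  have "conj_norm_le p (\<lambda>x. norm (charge.potential g a b \<delta> R x)) (1 * m powr (1 - 1 / p + 1 / real DIM('a)))"
    if d: "charge g a b m p" and \<delta>: "\<delta> > 0" and R: "R > 0" for g :: "'a \<Rightarrow> real" and a b m \<delta> R
  proof -
    interpret charge g a b m p by fact
    note [measurable] = kernel_borel_measurable[OF \<delta>, of R, where 'a='a] potential_measurable[OF \<delta>, of R]
    have k: "norm (kernel \<delta> R x) \<le> 1" for x :: 'a
      using norm_kernel_le[of \<delta> R x] True by (cases "x = 0") auto
    have "norm (potential \<delta> R x) \<le> m" for x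
    proof -
      have "norm (potential \<delta> R x) \<le> (\<integral>y. \<bar>g y\<bar> * norm (kernel \<delta> R (x - y)) \<partial>lborel)"
        by (rule norm_potential_le) fact
      also have "\<dots> \<le> (\<integral>y. \<bar>g y\<bar> \<partial>lborel)"
        using integrable_g k
        by (intro integral_mono integrable_mult_bounded[where C=1]) (auto intro: mult_left_le)
      also note mass_le
      finally show ?thesis .
    qed
    then show ?thesis
      using m_pos True p by (simp add: conj_norm_le_def)
  qed
  then show ?thesis by (intro exI[of _ 1]) auto
next
  case False
  let ?n = "real DIM('a)"
  have p: "1 \<le> p" "p < ?n" using assms False by auto
  obtain L1 where L1: "L1 > 0" "\<And>\<rho> \<delta> R. \<rho> > 0 \<Longrightarrow>
    (\<integral>\<^sup>+x. ennreal (norm (kernel \<delta> R (x::'a)) * indicator {x. norm x < \<rho>} x) \<partial>lborel) \<le> ennreal (L1 * \<rho>)"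
    using kernel_inside_L1[where 'a='a] by blast
  obtain L2 where L2: "L2 > 0" "\<And>\<rho> \<delta> R. \<rho> > 0 \<Longrightarrow> \<delta> > 0 \<Longrightarrow> conj_norm_le p
    (\<lambda>x::'a. norm (kernel \<delta> R x) * indicator {x. norm x \<ge> \<rho>} x) (L2 * \<rho> powr (1 - ?n / p))"
    using kernel_outside_conj_norm[OF p] by blast
  have "conj_norm_le p (\<lambda>x. norm (charge.potential g a b \<delta> R x)) ((L1 + L2) * m powr (1 - 1 / p + 1 / ?n))"
    if d: "charge g a b m p" and \<delta>: "\<delta> > 0" and R: "R > 0" for g :: "'a \<Rightarrow> real" and a b m \<delta> R
  proof -
    interpret charge g a b m p by fact
    note [measurable] = kernel_borel_measurable[OF \<delta>, of R, where 'a='a] potential_measurable[OF \<delta>, of R]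
    \<comment> \<open>This radius balances the two parts: the inner one contributes \<rho> m^(1/q),
      the outer one m \<rho>^(1 - n/p), and both equal m^(1/q + 1/n).\<close>
    define \<rho> where "\<rho> = m powr (1 / ?n)"
    have \<rho>: "\<rho> > 0" using m_pos by (simp add: \<rho>_def)
    define k1 where "k1 x = norm (kernel \<delta> R (x::'a)) * indicator {x. norm x < \<rho>} x" for x
    define k2 where "k2 x = norm (kernel \<delta> R (x::'a)) * indicator {x. norm x \<ge> \<rho>} x" for x
    have [measurable]: "k1 \<in> borel_measurable borel" "k2 \<in> borel_measurable borel"
      unfolding k1_def k2_def by measurable
    obtain C where C: "\<And>x::'a. norm (kernel \<delta> R x) \<le> C"
      using kernel_bounded[OF \<delta> R, where 'a='a] by blast
    have C0: "C \<ge> 0" using order_trans[OF norm_ge_zero C] .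
    have kC: "0 \<le> k1 x" "k1 x \<le> C" "0 \<le> k2 x" "k2 x \<le> C" "\<bar>k1 x\<bar> \<le> C" "\<bar>k2 x\<bar> \<le> C" for x
      using C[of x] C0 by (auto simp: k1_def k2_def indicator_def)
    have g: "integrable lborel (\<lambda>y. \<bar>g y\<bar>)" using integrable_g by simp
    have 1: "conj_norm_le p (\<lambda>x. \<integral>y. \<bar>g y\<bar> * k1 (x - y) \<partial>lborel) ((L1 * \<rho>) * m powr (1 - 1 / p))"
      using L1 \<rho> kC abs_le_1
      by (intro conj_norm_le_young_left[OF p(1) _ _ _ _ conj_norm_g, where C=1]) (auto simp: k1_def[abs_def])
    have 2: "conj_norm_le p (\<lambda>x. \<integral>y. \<bar>g y\<bar> * k2 (x - y) \<partial>lborel) (m * (L2 * \<rho> powr (1 - ?n / p)))"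
      using L2(2)[OF \<rho> \<delta>, of R] kC mass_le
      by (intro conj_norm_le_young_right[OF p(1) m_pos g, where C=C]) (auto simp: k2_def[abs_def])
    have e1: "(L1 * \<rho>) * m powr (1 - 1 / p) = L1 * m powr (1 - 1 / p + 1 / ?n)"
      by (simp add: \<rho>_def powr_add)
    have e2: "m * (L2 * \<rho> powr (1 - ?n / p)) = L2 * m powr (1 - 1 / p + 1 / ?n)"
    proof -
      have "m * \<rho> powr (1 - ?n / p) = m powr 1 * m powr (1 / ?n * (1 - ?n / p))"
        using m_pos by (simp add: \<rho>_def powr_powr)
      also have "\<dots> = m powr (1 + 1 / ?n * (1 - ?n / p))"
        by (simp only: powr_add)
      also have "1 + 1 / ?n * (1 - ?n / p) = 1 - 1 / p + 1 / ?n"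
        using p by (simp add: field_simps)
      finally show ?thesis by (simp add: algebra_simps)
    qed
    have le: "norm (potential \<delta> R x) \<le> (\<integral>y. \<bar>g y\<bar> * k1 (x - y) \<partial>lborel) + (\<integral>y. \<bar>g y\<bar> * k2 (x - y) \<partial>lborel)" for x
    proof -
      have "norm (potential \<delta> R x) \<le> (\<integral>y. \<bar>g y\<bar> * norm (kernel \<delta> R (x - y)) \<partial>lborel)"
        by (rule norm_potential_le) fact
      also have "\<dots> = (\<integral>y. \<bar>g y\<bar> * k1 (x - y) + \<bar>g y\<bar> * k2 (x - y) \<partial>lborel)"
        by (intro Bochner_Integration.integral_cong) (auto simp: k1_def k2_def indicator_def)
      also have "\<dots> = (\<integral>y. \<bar>g y\<bar> * k1 (x - y) \<partial>lborel) + (\<integral>y. \<bar>g y\<bar> * k2 (x - y) \<partial>lborel)"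
        using kC by (intro Bochner_Integration.integral_add integrable_mult_bounded[OF g, where C=C]) auto
      finally show ?thesis .
    qed
    have "(L1 * \<rho>) * m powr (1 - 1 / p) + m * (L2 * \<rho> powr (1 - ?n / p)) = (L1 + L2) * m powr (1 - 1 / p + 1 / ?n)"
      unfolding e1 e2 by (simp add: algebra_simps)
    moreover have "conj_norm_le p (\<lambda>x. norm (potential \<delta> R x)) ((L1 * \<rho>) * m powr (1 - 1 / p) + m * (L2 * \<rho> powr (1 - ?n / p)))"
      by (rule conj_norm_le_mono[OF conj_norm_le_add[OF 1 2 p(1)]])
         (use le p in \<open>auto intro: order_trans[OF le abs_ge_self]\<close>)
    ultimately show ?thesis by simp
  qed
  then show ?thesis
    using L1 L2 False by (intro exI[of _ "L1 + L2"]) auto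
qed

text \<open>The kernel error has size R^(-n) on a ball of radius \<open>R\<close>, so its L^q norm
  is R^(-n + n/q) = R^(-n/p) up to a constant. This is uniform in \<open>\<delta>\<close> and tends
  to 0 as \<open>R\<close> grows.\<close>

lemma divergence_kernel_error:
  assumes "p \<ge> 1"
  shows "\<exists>C. \<forall>\<delta> R (g::'a::euclidean_space \<Rightarrow> real) a b m. \<delta> > 0 \<longrightarrow> R > 0 \<longrightarrow> charge g a b m p \<longrightarrow>
    conj_norm_le p (\<lambda>x. divergence (charge.potential g a b \<delta> R) x -
        (\<integral>y. g y * (mollifier \<delta> (x - y) * cutoff (((x - y) \<bullet> (x - y) / R\<^sup>2) ^ DIM('a))) \<partial>lborel))
      (m * (C * R powr (- real DIM('a) / p)))"
proof -
  let ?n = "real DIM('a)"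
  define v where "v = unit_ball_vol ?n"
  have v: "v > 0" by (simp add: v_def)
  obtain C0 where C0: "C0 \<ge> 0" "\<And>\<delta> R (x::'a). \<delta> > 0 \<Longrightarrow> R > 0 \<Longrightarrow>
     \<bar>divergence (kernel \<delta> R) x - mollifier \<delta> x * cutoff ((x \<bullet> x / R\<^sup>2) ^ DIM('a))\<bar>
       \<le> C0 * R powr (- ?n) * indicator (cball 0 R) x"
    using divergence_kernel[where 'a='a] by blast
  define C where "C = (C0 + 1) * v powr (1 - 1 / p)"
  have "conj_norm_le p (\<lambda>x. divergence (charge.potential g a b \<delta> R) x -
        (\<integral>y. g y * (mollifier \<delta> (x - y) * cutoff (((x - y) \<bullet> (x - y) / R\<^sup>2) ^ DIM('a))) \<partial>lborel))
      (m * (C * R powr (- ?n / p)))"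
    if \<delta>: "\<delta> > 0" and R: "R > 0" and d: "charge g a b m p" for \<delta> R :: real and g :: "'a \<Rightarrow> real" and a b m
  proof -
    interpret charge g a b m p by fact
    \<comment> \<open>\<open>C0 + 1\<close> instead of \<open>C0\<close> keeps the bound strictly
      positive, as \<open>conj_norm_le\<close> demands.\<close>
    define e where "e x = (C0 + 1) * R powr (- ?n) * indicator (cball (0::'a) R) x" for x
    have [measurable]: "cball (0::'a) R \<in> sets borel" by simp
    have [measurable]: "e \<in> borel_measurable borel" unfolding e_def by measurable
    have e: "0 \<le> e x" "e x \<le> (C0 + 1) * R powr (- ?n)" for x
      using C0 by (auto simp: e_def indicator_def)
    have ke: "conj_norm_le p e (C * R powr (- ?n / p))"
    proof (cases "p = 1")
      case True
      then show ?thesis using e v C0 R by (simp add: conj_norm_le_def C_def)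
    next
      case False
      define q where "q = p / (p - 1)"
      have q: "q > 1" "(1 - 1 / p) * q = 1" "?n - ?n * q = (- ?n / p) * q"
        using assms False by (simp_all add: q_def field_simps)
      have "(\<integral>\<^sup>+x. ennreal (\<bar>e x\<bar> powr q) \<partial>lborel) =
        (\<integral>\<^sup>+x. ennreal (((C0 + 1) * R powr (- ?n)) powr q) * indicator (cball (0::'a) R) x \<partial>lborel)"
        using C0 by (intro nn_integral_cong) (auto simp: e_def indicator_def)
      also have "\<dots> = ennreal (((C0 + 1) * R powr (- ?n)) powr q * (v * R ^ DIM('a)))"
        using R v by (simp add: nn_integral_cmult_indicator emeasure_cball v_def ennreal_mult)
      also have "((C0 + 1) * R powr (- ?n)) powr q * (v * R ^ DIM('a)) =
          (C0 + 1) powr q * v * R powr (?n - ?n * q)"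
      proof -
        have "((C0 + 1) * R powr (- ?n)) powr q = (C0 + 1) powr q * R powr (- ?n * q)"
          using C0 by (simp add: powr_mult powr_powr)
        moreover have "R ^ DIM('a) = R powr ?n" using R by (simp add: powr_realpow)
        moreover have "R powr (- ?n * q) * R powr ?n = R powr (?n - ?n * q)"
          unfolding powr_add[symmetric] by simp
        ultimately show ?thesis by (simp only: mult_ac)
      qed
      also have "\<dots> = (C * R powr (- ?n / p)) powr q"
        using R C0 v q by (simp add: C_def powr_mult powr_powr)
      finally show ?thesis
        using False R C0 v by (simp add: conj_norm_le_def C_def q_def)
    qed
    have g: "integrable lborel (\<lambda>y. \<bar>g y\<bar>)" using integrable_g by simp
    have Y: "conj_norm_le p (\<lambda>x. \<integral>y. \<bar>g y\<bar> * e (x - y) \<partial>lborel) (m * (C * R powr (- ?n / p)))"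
      by (intro conj_norm_le_young_right[OF assms m_pos g _ mass_le ke, where C="(C0 + 1) * R powr (- ?n)"] e) auto
    define M where "M z = mollifier \<delta> z * cutoff ((z \<bullet> z / R\<^sup>2) ^ DIM('a))" for z :: 'a
    have cM: "continuous_on UNIV (\<lambda>y. M (x - y))" for x
    proof -
      have "continuous_on UNIV cutoff"
        by (intro continuous_at_imp_continuous_on ballI isCont_cutoff)
      moreover have "continuous_on UNIV (\<lambda>z::'a. (z \<bullet> z / R\<^sup>2) ^ DIM('a))"
        using R by (intro continuous_intros) auto
      ultimately have "continuous_on UNIV (\<lambda>z::'a. cutoff ((z \<bullet> z / R\<^sup>2) ^ DIM('a)))"
        by (rule continuous_on_compose2) simp
      moreover have "z \<bullet> z + \<delta>\<^sup>2 \<noteq> 0" for z :: 'a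
        using inner_ge_zero[of z] zero_less_power[OF \<delta>, of 2] by linarith
      then have "continuous_on UNIV (mollifier \<delta> :: 'a \<Rightarrow> real)"
        unfolding mollifier_def[abs_def] by (intro continuous_intros) auto
      ultimately have "continuous_on UNIV M"
        unfolding M_def[abs_def] by (intro continuous_on_mult)
      then show ?thesis
        by (rule continuous_on_compose2) (auto intro: continuous_intros)
    qed
    have bound: "\<bar>divergence (potential \<delta> R) x - (\<integral>y. g y * M (x - y) \<partial>lborel)\<bar>
        \<le> \<bar>\<integral>y. \<bar>g y\<bar> * e (x - y) \<partial>lborel\<bar>" for x
    proof -
      have "divergence (potential \<delta> R) x - (\<integral>y. g y * M (x - y) \<partial>lborel) =
          (\<integral>y. g y * divergence (kernel \<delta> R) (x - y) - g y * M (x - y) \<partial>lborel)"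
        unfolding divergence_potential[OF \<delta>]
        using integrable_density[OF continuous_divergence_kernel[OF \<delta>]] integrable_density[OF cM]
        by (intro Bochner_Integration.integral_diff[symmetric]) auto
      also have "\<bar>\<dots>\<bar> \<le> (\<integral>y. \<bar>g y * divergence (kernel \<delta> R) (x - y) - g y * M (x - y)\<bar> \<partial>lborel)"
        by (rule integral_abs_bound)
      also have "\<dots> \<le> (\<integral>y. \<bar>g y\<bar> * e (x - y) \<partial>lborel)"
      proof (rule integral_mono)
        show "integrable lborel (\<lambda>y. \<bar>g y * divergence (kernel \<delta> R) (x - y) - g y * M (x - y)\<bar>)"
          using integrable_density[OF continuous_divergence_kernel[OF \<delta>]] integrable_density[OF cM]
          by (intro integrable_abs Bochner_Integration.integrable_diff) auto
        show "integrable lborel (\<lambda>y. \<bar>g y\<bar> * e (x - y))"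
          using e by (intro integrable_mult_bounded[OF g, where C="(C0 + 1) * R powr (- ?n)"]) auto
        fix y
        have "\<bar>divergence (kernel \<delta> R) (x - y) - M (x - y)\<bar> \<le> e (x - y)"
        proof -
          have "\<bar>divergence (kernel \<delta> R) (x - y) - M (x - y)\<bar>
              \<le> C0 * R powr (- ?n) * indicator (cball 0 R) (x - y)"
            unfolding M_def by (rule C0(2)[OF \<delta> R])
          also have "\<dots> \<le> e (x - y)"
            unfolding e_def by (intro mult_right_mono) auto
          finally show ?thesis .
        qed
        then show "\<bar>g y * divergence (kernel \<delta> R) (x - y) - g y * M (x - y)\<bar> \<le> \<bar>g y\<bar> * e (x - y)"
          by (simp add: abs_mult mult_left_mono flip: right_diff_distrib)
      qed
      finally show ?thesis by simp
    qed
    have [measurable]: "M \<in> borel_measurable borel"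
      using continuous_on_compose2[OF cM[of 0], of UNIV uminus]
      by (intro borel_measurable_continuous_onI) (simp add: continuous_on_minus)
    note [measurable] = divergence_potential_measurable[OF \<delta>, of R]
    have "conj_norm_le p (\<lambda>x. divergence (potential \<delta> R) x - (\<integral>y. g y * M (x - y) \<partial>lborel)) (m * (C * R powr (- ?n / p)))"
      by (rule conj_norm_le_mono[OF Y order_refl bound _ assms]) measurable
    then show ?thesis by (simp only: M_def)
  qed
  then show ?thesis by blast
qed

section \<open>Pairing with \<open>L\<^sup>p\<close> functions\<close>

lemma Lp_space_powr_finite:
  assumes "f \<in> Lp_space (ereal p)"
  shows "(\<integral>\<^sup>+x. ennreal (\<bar>f x\<bar> powr p) \<partial>lebesgue) < \<infinity>"
  using assms by (auto simp: Lp_space_def Lp_norm_def Let_def less_top split: if_splits)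

text \<open>For p > 1 the pointwise inequality |h f| \<le> |f|^p + |h|^q gives the bound
  \<open>I + 1\<close>. It is cruder than Hoelder's inequality but uniform over the unit ball, which
  is the point here.\<close>

lemma Lp_pairing_bounded:
  fixes f :: "'a::euclidean_space \<Rightarrow> real"
  assumes f: "f \<in> Lp_space (ereal p)" and p: "p \<ge> 1"
  shows "\<exists>M\<ge>0. \<forall>h\<in>borel_measurable lebesgue. Lp_norm (conj_exponent p) h \<le> 1 \<longrightarrow>
    integrable lebesgue (\<lambda>x. h x * f x) \<and> \<bar>\<integral>x. h x * f x \<partial>lebesgue\<bar> \<le> M"
proof -
  have [measurable]: "f \<in> borel_measurable lebesgue"
    using f by (simp add: Lp_space_def)
  define I where "I = (\<integral>\<^sup>+x. ennreal (\<bar>f x\<bar> powr p) \<partial>lebesgue)"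
  have I: "I < \<infinity>" unfolding I_def by (rule Lp_space_powr_finite[OF f])
  have "integrable lebesgue (\<lambda>x. h x * f x) \<and> \<bar>\<integral>x. h x * f x \<partial>lebesgue\<bar> \<le> enn2real (I + 1)"
    if [measurable]: "h \<in> borel_measurable lebesgue" and h: "Lp_norm (conj_exponent p) h \<le> 1" for h :: "'a \<Rightarrow> real"
  proof -
    have bound: "(\<integral>\<^sup>+x. ennreal \<bar>h x * f x\<bar> \<partial>lebesgue) \<le> I + 1"
    proof (cases "p = 1")
      case True
      have e1: "esssup lebesgue (\<lambda>x. ereal (norm (h x))) \<le> 1"
        using h True by (simp add: Lp_norm_def conj_exponent_def)
      have "AE x in lebesgue. ereal (norm (h x)) \<le> 1"
        by (rule eventually_mono[OF esssup_AE[of "\<lambda>x. ereal (norm (h x))"]]) (rule order_trans[OF _ e1])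
      then have "(\<integral>\<^sup>+x. ennreal \<bar>h x * f x\<bar> \<partial>lebesgue) \<le> (\<integral>\<^sup>+x. ennreal (\<bar>f x\<bar> powr p) \<partial>lebesgue)"
        using True by (intro nn_integral_mono_AE)
          (auto elim!: eventually_mono intro!: ennreal_leI mult_left_le_one_le simp: abs_mult)
      then show ?thesis by (simp add: I_def add_increasing2)
    next
      case False
      define q where "q = p / (p - 1)"
      have q: "q > 1" "1 / p + 1 / q = 1" using p False by (simp_all add: q_def field_simps)
      define J where "J = (\<integral>\<^sup>+x. ennreal (\<bar>h x\<bar> powr q) \<partial>lebesgue)"
      have J: "J \<noteq> \<infinity>" "enn2real J powr (1 / q) \<le> 1"
        using h False by (auto simp: Lp_norm_def conj_exponent_def Let_def J_def q_def split: if_splits)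
      have "enn2real J \<le> 1"
      proof (rule ccontr)
        assume "\<not> enn2real J \<le> 1"
        then have "1 < enn2real J powr (1 / q)" using q by (intro gr_one_powr) auto
        with J show False by simp
      qed
      \<comment> \<open>Finiteness of \<open>J\<close> enters because \<open>enn2real\<close> sends
        infinity to 0.\<close>
      then have J1: "J \<le> 1"
        using J(1) by (cases J) auto
      have "(\<integral>\<^sup>+x. ennreal \<bar>h x * f x\<bar> \<partial>lebesgue) \<le>
          (\<integral>\<^sup>+x. ennreal (\<bar>f x\<bar> powr p) + ennreal (\<bar>h x\<bar> powr q) \<partial>lebesgue)"
      proof (intro nn_integral_mono)
        fix x
        have "\<bar>f x\<bar> * \<bar>h x\<bar> \<le> \<bar>f x\<bar> powr p / p + \<bar>h x\<bar> powr q / q"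
          using p False q by (intro Youngs_inequality) auto
        also have "\<dots> \<le> \<bar>f x\<bar> powr p / 1 + \<bar>h x\<bar> powr q / 1"
          using p q by (intro add_mono divide_left_mono) auto
        finally show "ennreal \<bar>h x * f x\<bar> \<le> ennreal (\<bar>f x\<bar> powr p) + ennreal (\<bar>h x\<bar> powr q)"
          by (simp add: abs_mult mult.commute ennreal_leI flip: ennreal_plus)
      qed
      also have "\<dots> = I + J"
        unfolding I_def J_def by (rule nn_integral_add) measurable
      also have "\<dots> \<le> I + 1" using J1 by (rule add_left_mono)
      finally show ?thesis .
    qed
    have fin: "I + 1 < \<infinity>" using I by simp
    have int: "integrable lebesgue (\<lambda>x. h x * f x)"
      using le_less_trans[OF bound fin] by (intro integrableI_bounded) auto
    have "ennreal \<bar>\<integral>x. h x * f x \<partial>lebesgue\<bar> \<le> I + 1"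
      using integral_norm_bound_ennreal[OF int] bound by simp
    also have "\<dots> = ennreal (enn2real (I + 1))"
      using fin by simp
    finally have "\<bar>\<integral>x. h x * f x \<partial>lebesgue\<bar> \<le> enn2real (I + 1)"
      by (simp only: ennreal_le_iff enn2real_nonneg)
    with int show ?thesis by blast
  qed
  then show ?thesis by (intro exI[of _ "enn2real (I + 1)"]) auto
qed

lemma conj_norm_le_scale:
  assumes "conj_norm_le p u B" "c > 0" "p \<ge> 1"
  shows "conj_norm_le p (\<lambda>x. c * u x) (c * B)"
proof -
  note [measurable] = conj_norm_leD(1)[OF assms(1)]
  have B: "B > 0" using assms conj_norm_leD by blast
  show ?thesis
  proof (cases "p = 1")
    case True
    then show ?thesis using assms by (auto simp: conj_norm_le_def abs_mult)
  next
    case False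
    have "(\<integral>\<^sup>+x. ennreal (\<bar>c * u x\<bar> powr (p / (p - 1))) \<partial>lborel) =
        (\<integral>\<^sup>+x. ennreal (c powr (p / (p - 1))) * ennreal (\<bar>u x\<bar> powr (p / (p - 1))) \<partial>lborel)"
      using assms by (simp add: abs_mult powr_mult ennreal_mult')
    also have "\<dots> = ennreal (c powr (p / (p - 1))) * (\<integral>\<^sup>+x. ennreal (\<bar>u x\<bar> powr (p / (p - 1))) \<partial>lborel)"
      by (rule nn_integral_cmult) measurable
    also have "\<dots> \<le> ennreal (c powr (p / (p - 1))) * ennreal (B powr (p / (p - 1)))"
      using assms False by (intro mult_left_mono) (auto simp: conj_norm_le_def)
    also have "\<dots> = ennreal ((c * B) powr (p / (p - 1)))"
      using assms B by (simp add: powr_mult ennreal_mult')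
    finally show ?thesis
      using assms B False by (simp add: conj_norm_le_def)
  qed
qed

lemma conj_norm_le_lebesgue_measurable: "conj_norm_le p h B \<Longrightarrow> h \<in> borel_measurable lebesgue"
  by (intro measurable_completion) (simp add: conj_norm_leD)

text \<open>By scaling \<open>h\<close> to norm bound 1. The constant \<open>M\<close> does not
  depend on \<open>h\<close>, so errors that are small in L^q stay small after pairing with
  \<open>f\<close>.\<close>

lemma Lp_pairing_conj_norm:
  fixes f :: "'a::euclidean_space \<Rightarrow> real"
  assumes f: "f \<in> Lp_space (ereal p)" and p: "p \<ge> 1"
  shows "\<exists>M\<ge>0. \<forall>h B. conj_norm_le p h B \<longrightarrow>
    integrable lebesgue (\<lambda>x. h x * f x) \<and> \<bar>\<integral>x. h x * f x \<partial>lebesgue\<bar> \<le> M * B"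
proof -
  obtain M where M: "M \<ge> 0" "\<And>h. h \<in> borel_measurable lebesgue \<Longrightarrow> Lp_norm (conj_exponent p) h \<le> 1 \<Longrightarrow>
    integrable lebesgue (\<lambda>x. h x * f x) \<and> \<bar>\<integral>x. h x * f x \<partial>lebesgue\<bar> \<le> M"
    using Lp_pairing_bounded[OF f p] by blast
  have "integrable lebesgue (\<lambda>x. h x * f x) \<and> \<bar>\<integral>x. h x * f x \<partial>lebesgue\<bar> \<le> M * B"
    if h: "conj_norm_le p h B" for h B
  proof -
    have B: "B > 0" using h conj_norm_leD by blast
    have s: "conj_norm_le p (\<lambda>x. inverse B * h x) 1"
      using conj_norm_le_scale[OF h _ p, of "inverse B"] B by simp
    have "conj_norm_le p (\<lambda>x. norm (inverse B * h x)) 1"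
      by (rule conj_norm_le_mono[OF s order_refl _ _ p]) (use conj_norm_leD(1)[OF s] in auto)
    from Lp_norm_conj_exponent_le[OF this p]
    have "Lp_norm (conj_exponent p) (\<lambda>x. inverse B * h x) \<le> 1" by (simp add: one_ereal_def)
    from M(2)[OF conj_norm_le_lebesgue_measurable[OF s] this]
    have *: "integrable lebesgue (\<lambda>x. inverse B * (h x * f x))"
      "\<bar>\<integral>x. inverse B * (h x * f x) \<partial>lebesgue\<bar> \<le> M"
      by (simp_all add: mult.assoc)
    have int: "integrable lebesgue (\<lambda>x. h x * f x)"
      using integrable_mult_right[OF *(1), of B] B by simp
    moreover have "\<bar>\<integral>x. h x * f x \<partial>lebesgue\<bar> \<le> M * B"
      using *(2) B by (simp add: abs_mult field_simps)
    ultimately show ?thesis by simp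
  qed
  with M(1) show ?thesis by blast
qed

text \<open>Homogeneity: dividing \<open>\<Phi>\<close> by \<open>T = max B (A / \<epsilon>)\<close>
  makes it admissible. Boundedness of the set of values has to be shown, since
  \<open>sigma_mod\<close> is a supremum of reals.\<close>

lemma sigma_mod_upper:
  fixes f :: "'a::euclidean_space \<Rightarrow> real"
  assumes f: "f \<in> Lp_space (ereal p)" and p: "p \<ge> 1"
    and \<Phi>: "\<Phi> \<in> Cinf_compact" "conj_norm_le p (\<lambda>x. norm (\<Phi> x)) A" "conj_norm_le p (divergence \<Phi>) B"
    and \<epsilon>: "\<epsilon> > 0"
  shows "(\<integral>x. divergence \<Phi> x * f x \<partial>lebesgue) \<le> max B (A / \<epsilon>) * sigma_mod p f \<epsilon>"
proof -
  define T where "T = max B (A / \<epsilon>)"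
  have T: "T > 0" "B \<le> T" "A \<le> \<epsilon> * T"
    using conj_norm_leD(2)[OF \<Phi>(2)] conj_norm_leD(2)[OF \<Phi>(3)] \<epsilon> by (auto simp: T_def max_def field_simps)
  define \<Psi> where "\<Psi> x = inverse T *\<^sub>R \<Phi> x" for x
  define S where "S = {(\<integral>x. divergence \<Phi> x * f x \<partial>lebesgue) | \<Phi>.
     \<Phi> \<in> Cinf_compact \<and> Lp_norm (conj_exponent p) (divergence \<Phi>) \<le> 1 \<and>
     Lp_norm (conj_exponent p) \<Phi> \<le> ereal \<epsilon>}"
  have "bdd_above S"
  proof -
    obtain M where M: "\<And>h. h \<in> borel_measurable lebesgue \<Longrightarrow> Lp_norm (conj_exponent p) h \<le> 1 \<Longrightarrow>
       \<bar>\<integral>x. h x * f x \<partial>lebesgue\<bar> \<le> M"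
      using Lp_pairing_bounded[OF f p] by blast
    have "s \<le> M" if "s \<in> S" for s
    proof -
      obtain \<Phi> where \<Phi>: "s = (\<integral>x. divergence \<Phi> x * f x \<partial>lebesgue)" "\<Phi> \<in> Cinf_compact"
          "Lp_norm (conj_exponent p) (divergence \<Phi>) \<le> 1"
        using \<open>s \<in> S\<close> unfolding S_def by blast
      have "Ck (Suc 0) \<Phi>" using \<Phi>(2) unfolding Cinf_compact_def by blast
      then have "continuous_on UNIV (divergence \<Phi>)"
        unfolding divergence_def[abs_def] by (intro continuous_intros) simp
      then have "divergence \<Phi> \<in> borel_measurable lebesgue"
        by (intro measurable_completion) (simp add: borel_measurable_continuous_onI)
      from M[OF this \<Phi>(3)] show ?thesis using \<Phi>(1) by simp
    qed
    then show ?thesis by (auto simp: bdd_above_def)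
  qed
  moreover have div: "divergence \<Psi> = (\<lambda>x. inverse T * divergence \<Phi> x)"
  proof
    fix x
    have "Ck (Suc 0) \<Phi>" using \<Phi>(1) unfolding Cinf_compact_def by blast
    then have "(\<Phi> has_derivative frechet_derivative \<Phi> (at x)) (at x)"
      by (simp flip: frechet_derivative_works)
    then have "(\<Psi> has_derivative (\<lambda>v. inverse T *\<^sub>R frechet_derivative \<Phi> (at x) v)) (at x)"
      unfolding \<Psi>_def[abs_def] by (rule has_derivative_scaleR_right)
    from frechet_derivative_at[OF this, symmetric]
    show "divergence \<Psi> x = inverse T * divergence \<Phi> x"
      by (simp add: divergence_def sum_distrib_left)
  qed
  have "inverse T * (\<integral>x. divergence \<Phi> x * f x \<partial>lebesgue) \<in> S"
  proof -
    have "\<Psi> \<in> Cinf_compact"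
    proof -
      have "Ck k \<Psi>" for k
        unfolding \<Psi>_def[abs_def] using \<Phi>(1) by (intro Ck_scaleR Ck_const) (simp add: Cinf_compact_def)
      moreover have "{x. \<Psi> x \<noteq> 0} = {x. \<Phi> x \<noteq> 0}" using T by (auto simp: \<Psi>_def)
      ultimately show ?thesis using \<Phi>(1) by (simp add: Cinf_compact_def)
    qed
    moreover have "Lp_norm (conj_exponent p) (divergence \<Psi>) \<le> ereal 1"
    proof (rule Lp_norm_conj_exponent_le[OF _ p])
      have "conj_norm_le p (\<lambda>x. inverse T * divergence \<Phi> x) (inverse T * B)"
        using T by (intro conj_norm_le_scale \<Phi> p) auto
      then show "conj_norm_le p (\<lambda>x. norm (divergence \<Psi> x)) 1"
        using T conj_norm_leD(1)[OF \<Phi>(3)] p unfolding div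
        by (elim conj_norm_le_mono) (auto simp: field_simps)
    qed
    moreover have "Lp_norm (conj_exponent p) \<Psi> \<le> ereal \<epsilon>"
    proof (rule Lp_norm_conj_exponent_le[OF _ p])
      have "conj_norm_le p (\<lambda>x. inverse T * norm (\<Phi> x)) (inverse T * A)"
        using T by (intro conj_norm_le_scale \<Phi> p) auto
      moreover have eq: "(\<lambda>x. norm (\<Psi> x)) = (\<lambda>x. inverse T * norm (\<Phi> x))"
        using T by (simp add: \<Psi>_def fun_eq_iff)
      ultimately show "conj_norm_le p (\<lambda>x. norm (\<Psi> x)) \<epsilon>"
        unfolding eq using T conj_norm_leD(1)[OF \<Phi>(2)] p
        by (elim conj_norm_le_mono) (auto simp: field_simps)
    qed
    moreover have "inverse T * (\<integral>x. divergence \<Phi> x * f x \<partial>lebesgue) = (\<integral>x. divergence \<Psi> x * f x \<partial>lebesgue)"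
      by (simp add: div mult.assoc)
    ultimately show ?thesis
      unfolding S_def by (auto simp: one_ereal_def)
  qed
  ultimately have "inverse T * (\<integral>x. divergence \<Phi> x * f x \<partial>lebesgue) \<le> sigma_mod p f \<epsilon>"
    unfolding sigma_mod_def S_def[symmetric] by (intro cSup_upper)
  then show ?thesis
    using T by (simp add: T_def[symmetric] field_simps)
qed

text \<open>Provides the dominating functions for limits of pairings with \<open>f\<close>.\<close>

lemma integrable_indicator_Lp:
  fixes f :: "'a::euclidean_space \<Rightarrow> real"
  assumes f: "f \<in> Lp_space (ereal p)" and p: "p \<ge> 1" and A: "A \<in> sets borel" "bounded A"
  shows "integrable lebesgue (\<lambda>x. indicator A x * f x)"
proof -
  obtain M where M: "\<And>h B. conj_norm_le p h B \<Longrightarrow> integrable lebesgue (\<lambda>x. h x * f x)"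
    using Lp_pairing_conj_norm[OF f p] by blast
  define V where "V = measure lborel A"
  have V: "V \<ge> 0" "emeasure lborel A = ennreal V"
    using emeasure_bounded_finite[OF A(2)]
    by (auto simp: V_def intro!: emeasure_eq_ennreal_measure)
  \<comment> \<open>\<open>V + 1\<close> is positive and at least 1, so its q-th power still
    dominates \<open>V\<close>.\<close>
  have "conj_norm_le p (indicator A :: 'a \<Rightarrow> real) (V + 1)"
  proof (cases "p = 1")
    case True
    then show ?thesis using V A by (auto simp: conj_norm_le_def indicator_def)
  next
    case False
    define q where "q = p / (p - 1)"
    have q: "q > 1" using p False by (simp add: q_def field_simps)
    have "(\<integral>\<^sup>+x. ennreal (\<bar>indicator A x\<bar> powr q) \<partial>lborel) = (\<integral>\<^sup>+x. indicator A x \<partial>lborel)"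
      by (intro nn_integral_cong) (auto simp: indicator_def)
    also have "\<dots> = ennreal V" using A V by simp
    also have "\<dots> \<le> ennreal ((V + 1) powr q)"
    proof (rule ennreal_leI)
      have "V + 1 \<le> (V + 1) powr q"
        using V q powr_mono[of 1 q "V + 1"] by simp
      then show "V \<le> (V + 1) powr q" by simp
    qed
    finally show ?thesis using V A False by (simp add: conj_norm_le_def q_def)
  qed
  from M[OF this] show ?thesis .
qed

lemma integral_lborel_affine:
  fixes F :: "'a::euclidean_space \<Rightarrow> real"
  assumes [measurable]: "F \<in> borel_measurable borel" and c: "c \<noteq> 0"
  shows "(\<integral>y. F y \<partial>lborel) = (\<integral>z. \<bar>c\<bar> ^ DIM('a) * F (t + c *\<^sub>R z) \<partial>lborel)"
proof -
  have "(\<integral>y. F y \<partial>lborel) = (\<integral>y. F y \<partial>(density (distr lborel borel (\<lambda>x. t + c *\<^sub>R x)) (\<lambda>_. ennreal (\<bar>c\<bar> ^ DIM('a)))))"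
    using c by (subst lborel_affine[of c t]) auto
  also have "\<dots> = (\<integral>y. \<bar>c\<bar> ^ DIM('a) * F y \<partial>(distr lborel borel (\<lambda>x. t + c *\<^sub>R x)))"
    by (subst integral_density) auto
  also have "\<dots> = (\<integral>z. \<bar>c\<bar> ^ DIM('a) * F (t + c *\<^sub>R z) \<partial>lborel)"
    by (subst integral_distr) auto
  finally show ?thesis .
qed

section \<open>Convergence of the mollified densities\<close>

lemma cutoff_measurable [measurable]: "cutoff \<in> borel_measurable borel"
  by (intro borel_measurable_continuous_onI continuous_at_imp_continuous_on ballI isCont_cutoff)

context charge
begin

text \<open>The substitution y = x - \<delta> z moves \<open>\<delta>\<close> into \<open>g\<close>
  and the cutoff and leaves the fixed weight \<open>mollifier 1\<close>, which can dominate as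
  \<open>\<delta>\<close> tends to 0.\<close>

lemma mollified_eq:
  assumes \<delta>: "\<delta> > 0"
  shows "(\<integral>y. g y * (mollifier \<delta> (x - y) * cutoff (((x - y) \<bullet> (x - y) / R\<^sup>2) ^ DIM('a))) \<partial>lborel) =
    (\<integral>z. g (x - \<delta> *\<^sub>R z) * (mollifier 1 z * cutoff ((\<delta>\<^sup>2 * (z \<bullet> z) / R\<^sup>2) ^ DIM('a))) \<partial>lborel)"
proof -
  have "(\<integral>y. g y * (mollifier \<delta> (x - y) * cutoff (((x - y) \<bullet> (x - y) / R\<^sup>2) ^ DIM('a))) \<partial>lborel) =
     (\<integral>z. \<bar>- \<delta>\<bar> ^ DIM('a) * (g (x + (- \<delta>) *\<^sub>R z) * (mollifier \<delta> (x - (x + (- \<delta>) *\<^sub>R z)) *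
       cutoff (((x - (x + (- \<delta>) *\<^sub>R z)) \<bullet> (x - (x + (- \<delta>) *\<^sub>R z)) / R\<^sup>2) ^ DIM('a)))) \<partial>lborel)"
    using \<delta> by (intro integral_lborel_affine) auto
  also have "\<dots> = (\<integral>z. g (x - \<delta> *\<^sub>R z) * ((\<delta> ^ DIM('a) * mollifier \<delta> (\<delta> *\<^sub>R z)) *
       cutoff ((\<delta>\<^sup>2 * (z \<bullet> z) / R\<^sup>2) ^ DIM('a))) \<partial>lborel)"
    using \<delta> by (intro Bochner_Integration.integral_cong) (auto simp: power2_eq_square mult_ac)
  finally show ?thesis
    by (simp only: mollifier_scaleR[OF \<delta>])
qed

lemma abs_mollified_le:
  assumes \<delta>: "\<delta> > 0"
  shows "\<bar>\<integral>z. g (x - \<delta> *\<^sub>R z) * (mollifier 1 z * cutoff ((\<delta>\<^sup>2 * (z \<bullet> z) / R\<^sup>2) ^ DIM('a))) \<partial>lborel\<bar>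
    \<le> mollifier_mass TYPE('a)"
proof -
  have le: "\<bar>g (x - \<delta> *\<^sub>R z) * (mollifier 1 z * cutoff ((\<delta>\<^sup>2 * (z \<bullet> z) / R\<^sup>2) ^ DIM('a)))\<bar> \<le> mollifier 1 z" for z
  proof -
    have "\<bar>g (x - \<delta> *\<^sub>R z)\<bar> * (mollifier 1 z * cutoff ((\<delta>\<^sup>2 * (z \<bullet> z) / R\<^sup>2) ^ DIM('a))) \<le> 1 * (mollifier 1 z * 1)"
      by (intro mult_mono abs_le_1 cutoff_le_1 mult_nonneg_nonneg mollifier_nonneg cutoff_nonneg) auto
    then show ?thesis by (simp add: abs_mult mollifier_nonneg cutoff_nonneg)
  qed
  have "\<bar>\<integral>z. g (x - \<delta> *\<^sub>R z) * (mollifier 1 z * cutoff ((\<delta>\<^sup>2 * (z \<bullet> z) / R\<^sup>2) ^ DIM('a))) \<partial>lborel\<bar>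
      \<le> (\<integral>z. \<bar>g (x - \<delta> *\<^sub>R z) * (mollifier 1 z * cutoff ((\<delta>\<^sup>2 * (z \<bullet> z) / R\<^sup>2) ^ DIM('a)))\<bar> \<partial>lborel)"
    by (rule integral_abs_bound)
  also have "\<dots> \<le> (\<integral>z. mollifier 1 (z::'a) \<partial>lborel)"
    by (rule integral_mono'[OF mollifier_1_integrable le]) (simp add: mollifier_nonneg)
  finally show ?thesis by (simp add: mollifier_mass_def)
qed

lemma mollified_tendsto:
  assumes \<delta>: "\<delta> \<longlonglongrightarrow> 0" and \<delta>_pos: "\<And>k. \<delta> k > 0"
  shows "(\<lambda>k. \<integral>z. g (x - \<delta> k *\<^sub>R z) * (mollifier 1 z * cutoff (((\<delta> k)\<^sup>2 * (z \<bullet> z) / R\<^sup>2) ^ DIM('a))) \<partial>lborel)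
    \<longlonglongrightarrow> g x * mollifier_mass TYPE('a)"
proof -
  have "(\<lambda>k. \<integral>z. g (x - \<delta> k *\<^sub>R z) * (mollifier 1 z * cutoff (((\<delta> k)\<^sup>2 * (z \<bullet> z) / R\<^sup>2) ^ DIM('a))) \<partial>lborel)
    \<longlonglongrightarrow> (\<integral>z. g x * mollifier 1 (z::'a) \<partial>lborel)"
  proof (rule integral_dominated_convergence[where w="mollifier 1"])
    show "AE z in lborel. (\<lambda>k. g (x - \<delta> k *\<^sub>R z) * (mollifier 1 z * cutoff (((\<delta> k)\<^sup>2 * (z \<bullet> z) / R\<^sup>2) ^ DIM('a))))
        \<longlonglongrightarrow> g x * mollifier 1 z"
    proof (rule AE_I2)
      fix z :: 'a
      have "(\<lambda>k. x - \<delta> k *\<^sub>R z) \<longlonglongrightarrow> x - 0 *\<^sub>R z"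
        by (intro tendsto_intros \<delta>)
      then have 1: "(\<lambda>k. g (x - \<delta> k *\<^sub>R z)) \<longlonglongrightarrow> g x"
        using continuous_on_tendsto_compose[OF cont, of "\<lambda>k. x - \<delta> k *\<^sub>R z" x sequentially] by simp
      have "(\<lambda>k. ((\<delta> k)\<^sup>2 * (z \<bullet> z) * inverse (R\<^sup>2)) ^ DIM('a)) \<longlonglongrightarrow> (0\<^sup>2 * (z \<bullet> z) * inverse (R\<^sup>2)) ^ DIM('a)"
        by (intro tendsto_intros \<delta>)
      then have "(\<lambda>k. ((\<delta> k)\<^sup>2 * (z \<bullet> z) / R\<^sup>2) ^ DIM('a)) \<longlonglongrightarrow> 0"
        by (simp add: divide_inverse zero_power)
      from isCont_tendsto_compose[OF isCont_cutoff this]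
      have 2: "(\<lambda>k. cutoff (((\<delta> k)\<^sup>2 * (z \<bullet> z) / R\<^sup>2) ^ DIM('a))) \<longlonglongrightarrow> 1" by simp
      show "(\<lambda>k. g (x - \<delta> k *\<^sub>R z) * (mollifier 1 z * cutoff (((\<delta> k)\<^sup>2 * (z \<bullet> z) / R\<^sup>2) ^ DIM('a))))
        \<longlonglongrightarrow> g x * mollifier 1 z"
        using tendsto_mult[OF 1 tendsto_mult[OF tendsto_const[of "mollifier 1 z"] 2]] by simp
    qed
    fix k
    show "AE z in lborel. norm (g (x - \<delta> k *\<^sub>R z) * (mollifier 1 z * cutoff (((\<delta> k)\<^sup>2 * (z \<bullet> z) / R\<^sup>2) ^ DIM('a)))) \<le> mollifier 1 z"
    proof (rule AE_I2)
      fix z :: 'a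
      have "\<bar>g (x - \<delta> k *\<^sub>R z)\<bar> * (mollifier 1 z * cutoff (((\<delta> k)\<^sup>2 * (z \<bullet> z) / R\<^sup>2) ^ DIM('a))) \<le> 1 * (mollifier 1 z * 1)"
        by (intro mult_mono abs_le_1 cutoff_le_1 mult_nonneg_nonneg mollifier_nonneg cutoff_nonneg) auto
      then show "norm (g (x - \<delta> k *\<^sub>R z) * (mollifier 1 z * cutoff (((\<delta> k)\<^sup>2 * (z \<bullet> z) / R\<^sup>2) ^ DIM('a)))) \<le> mollifier 1 z"
        by (simp add: abs_mult mollifier_nonneg cutoff_nonneg)
    qed
  qed (auto intro: mollifier_1_integrable)
  then show ?thesis by (simp add: mollifier_mass_def)
qed

text \<open>The mollified functions vanish outside the ball of radius \<open>r + R\<close> and are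
  bounded by the mass inside, so a multiple of |f| on this ball dominates. The ball depends on
  \<open>R\<close>, which therefore stays fixed in this limit.\<close>

lemma mollified_pairing_tendsto:
  assumes f: "f \<in> Lp_space (ereal p)" and R: "R > 0"
    and \<delta>: "\<delta> \<longlonglongrightarrow> 0" and \<delta>_pos: "\<And>k. \<delta> k > 0"
  shows "(\<lambda>k. \<integral>x. (\<integral>y. g y * (mollifier (\<delta> k) (x - y) * cutoff (((x - y) \<bullet> (x - y) / R\<^sup>2) ^ DIM('a))) \<partial>lborel) * f x \<partial>lebesgue)
    \<longlonglongrightarrow> mollifier_mass TYPE('a) * (\<integral>x. g x * f x \<partial>lebesgue)"
proof -
  have [measurable]: "f \<in> borel_measurable lebesgue" using f by (simp add: Lp_space_def)
  have [measurable]: "g \<in> borel_measurable lebesgue"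
    by (intro measurable_completion) simp
  define G where "G k x = (\<integral>y. g y * (mollifier (\<delta> k) (x - y) * cutoff (((x - y) \<bullet> (x - y) / R\<^sup>2) ^ DIM('a))) \<partial>lborel)" for k x
  have G_le: "\<bar>G k x\<bar> \<le> mollifier_mass TYPE('a)" for k x
    unfolding G_def mollified_eq[OF \<delta>_pos] by (rule abs_mollified_le[OF \<delta>_pos])
  obtain r where r: "\<And>y. y \<in> cbox a b \<Longrightarrow> norm y \<le> r"
    using bounded_cbox[of a b] unfolding bounded_iff by blast
  have G_0: "G k x = 0" if "norm x > r + R" for k x
  proof -
    have zero: "g y * (mollifier (\<delta> k) (x - y) * cutoff (((x - y) \<bullet> (x - y) / R\<^sup>2) ^ DIM('a))) = 0" for y
    proof (cases "y \<in> cbox a b")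
      case True
      then have "norm (x - y) \<ge> R"
        using norm_triangle_ineq2[of x y] that r[OF True] by linarith
      then have "(x - y) \<bullet> (x - y) / R\<^sup>2 \<ge> 1"
        using R by (simp add: dot_square_norm power_mono)
      then have "((x - y) \<bullet> (x - y) / R\<^sup>2) ^ DIM('a) \<ge> 1"
        by (rule one_le_power)
      then show ?thesis by (simp add: cutoff_eq_0)
    qed (simp add: supp)
    show ?thesis unfolding G_def zero by simp
  qed
  have G_meas: "G k \<in> borel_measurable lebesgue" for k
    unfolding G_def by (intro measurable_completion) measurable
  have int: "integrable lebesgue (\<lambda>x. indicator (cball 0 (r + R)) x * f x)"
    by (rule integrable_indicator_Lp[OF f p_ge_1]) auto
  have "(\<lambda>k. \<integral>x. G k x * f x \<partial>lebesgue) \<longlonglongrightarrow> (\<integral>x. (g x * mollifier_mass TYPE('a)) * f x \<partial>lebesgue)"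
  proof (rule integral_dominated_convergence[where w="\<lambda>x. mollifier_mass TYPE('a) * \<bar>indicator (cball 0 (r + R)) x * f x\<bar>"])
    show "AE x in lebesgue. (\<lambda>k. G k x * f x) \<longlonglongrightarrow> g x * mollifier_mass TYPE('a) * f x"
      unfolding G_def mollified_eq[OF \<delta>_pos]
      by (intro AE_I2 tendsto_mult[OF mollified_tendsto[OF \<delta> \<delta>_pos] tendsto_const])
    fix k
    show "AE x in lebesgue. norm (G k x * f x) \<le> mollifier_mass TYPE('a) * \<bar>indicator (cball 0 (r + R)) x * f x\<bar>"
    proof (rule AE_I2)
      fix x :: 'a
      show "norm (G k x * f x) \<le> mollifier_mass TYPE('a) * \<bar>indicator (cball 0 (r + R)) x * f x\<bar>"
        using mult_right_mono[OF G_le[of k x], of "\<bar>f x\<bar>"] G_0[of x k]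
        by (cases "norm x \<le> r + R") (auto simp: abs_mult)
    qed
    show "(\<lambda>x. G k x * f x) \<in> borel_measurable lebesgue"
      using G_meas[of k] by measurable
  qed (use int in auto)
  also have "(\<integral>x. (g x * mollifier_mass TYPE('a)) * f x \<partial>lebesgue) = mollifier_mass TYPE('a) * (\<integral>x. g x * f x \<partial>lebesgue)"
    unfolding integral_mult_right_zero[symmetric] by (simp add: mult_ac)
  finally show ?thesis unfolding G_def .
qed

text \<open>Young's inequality with the mollifier as the integrable weight, which the cutoff can
  only decrease.\<close>

lemma conj_norm_mollified:
  assumes \<delta>: "\<delta> > 0" and R: "R > 0"
  shows "conj_norm_le p (\<lambda>x. \<integral>y. g y * (mollifier \<delta> (x - y) * cutoff (((x - y) \<bullet> (x - y) / R\<^sup>2) ^ DIM('a))) \<partial>lborel)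
    (mollifier_mass TYPE('a) * m powr (1 - 1 / p))"
proof -
  have Y: "conj_norm_le p (\<lambda>x. \<integral>y. \<bar>g y\<bar> * mollifier \<delta> (x - y) \<partial>lborel) (mollifier_mass TYPE('a) * m powr (1 - 1 / p))"
    using abs_le_1
    by (intro conj_norm_le_young_left[OF p_ge_1 mollifier_mass_pos _ _ _ conj_norm_g, where C=1])
       (auto simp: mollifier_nonneg nn_integral_mollifier[OF \<delta>])
  have "\<bar>\<integral>y. g y * (mollifier \<delta> (x - y) * cutoff (((x - y) \<bullet> (x - y) / R\<^sup>2) ^ DIM('a))) \<partial>lborel\<bar>
      \<le> \<bar>\<integral>y. \<bar>g y\<bar> * mollifier \<delta> (x - y) \<partial>lborel\<bar>" for x
  proof -
    have "\<bar>\<integral>y. g y * (mollifier \<delta> (x - y) * cutoff (((x - y) \<bullet> (x - y) / R\<^sup>2) ^ DIM('a))) \<partial>lborel\<bar>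
       \<le> (\<integral>y. \<bar>g y * (mollifier \<delta> (x - y) * cutoff (((x - y) \<bullet> (x - y) / R\<^sup>2) ^ DIM('a)))\<bar> \<partial>lborel)"
      by (rule integral_abs_bound)
    also have "\<dots> \<le> (\<integral>y. \<bar>g y\<bar> * mollifier \<delta> (x - y) \<partial>lborel)"
    proof (rule integral_mono')
      have nz: "z \<bullet> z + \<delta>\<^sup>2 \<noteq> 0" for z :: 'a
        using inner_ge_zero[of z] zero_less_power[OF \<delta>, of 2] by linarith
      have "continuous_on UNIV (\<lambda>y. mollifier \<delta> (x - y))"
        unfolding mollifier_def using nz by (intro continuous_intros) auto
      from integrable_abs[OF integrable_density[OF this]]
      show "integrable lborel (\<lambda>y. \<bar>g y\<bar> * mollifier \<delta> (x - y))"
        by (simp add: abs_mult mollifier_nonneg)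
      fix y
      have "\<bar>g y\<bar> * (mollifier \<delta> (x - y) * cutoff (((x - y) \<bullet> (x - y) / R\<^sup>2) ^ DIM('a))) \<le> \<bar>g y\<bar> * (mollifier \<delta> (x - y) * 1)"
        by (intro mult_left_mono cutoff_le_1 mollifier_nonneg) auto
      then show "\<bar>g y * (mollifier \<delta> (x - y) * cutoff (((x - y) \<bullet> (x - y) / R\<^sup>2) ^ DIM('a)))\<bar> \<le> \<bar>g y\<bar> * mollifier \<delta> (x - y)"
        by (simp add: abs_mult mollifier_nonneg cutoff_nonneg)
    qed (simp add: mollifier_nonneg)
    finally show ?thesis by simp
  qed
  then show ?thesis
    by (intro conj_norm_le_mono[OF Y order_refl _ _ p_ge_1]) auto
qed

end

text \<open>All is done up to \<open>\<eta>\<close>: \<open>R\<close> makes the divergence error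
  smaller than \<open>\<eta>\<close> in norm, then \<open>d k\<close> brings the mollified pairing
  within \<open>\<eta>\<close> of its limit. The loss is (M + 1) \<eta> in the pairing and \<eta> in
  the norm of the divergence; \<open>\<eta>\<close> tends to 0 last.\<close>

lemma charge_sigma_bound:
  assumes pn: "(1 \<le> p \<and> p < real DIM('a::euclidean_space)) \<or> (DIM('a) = 1 \<and> p = 1)"
  shows "\<exists>L>0. (DIM('a) = 1 \<longrightarrow> L = 1) \<and> (\<forall>f (g::'a \<Rightarrow> real) a b m \<epsilon>. f \<in> Lp_space (ereal p) \<longrightarrow> charge g a b m p \<longrightarrow> \<epsilon> > 0 \<longrightarrow>
    mollifier_mass TYPE('a) * (\<integral>x. g x * f x \<partial>lebesgue) \<le>
      max (mollifier_mass TYPE('a) * m powr (1 - 1 / p)) (L * m powr (1 - 1 / p + 1 / real DIM('a)) / \<epsilon>) * sigma_mod p f \<epsilon>)"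
proof -
  let ?n = "real DIM('a)" and ?c = "mollifier_mass TYPE('a)"
  have p: "p \<ge> 1" using pn by auto
  obtain L where L: "L > 0" "DIM('a) = 1 \<longrightarrow> L = 1" "\<And>(g::'a \<Rightarrow> real) a b m \<delta> R. charge g a b m p \<Longrightarrow> \<delta> > 0 \<Longrightarrow> R > 0 \<Longrightarrow>
    conj_norm_le p (\<lambda>x. norm (charge.potential g a b \<delta> R x)) (L * m powr (1 - 1 / p + 1 / ?n))"
    using conj_norm_potential_le[OF pn] by blast
  obtain C where C: "\<And>\<delta> R (g::'a \<Rightarrow> real) a b m. \<delta> > 0 \<Longrightarrow> R > 0 \<Longrightarrow> charge g a b m p \<Longrightarrow>
    conj_norm_le p (\<lambda>x. divergence (charge.potential g a b \<delta> R) x -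
        (\<integral>y. g y * (mollifier \<delta> (x - y) * cutoff (((x - y) \<bullet> (x - y) / R\<^sup>2) ^ DIM('a))) \<partial>lborel))
      (m * (C * R powr (- ?n / p)))"
    using divergence_kernel_error[OF p, where 'a='a] by blast
  have "?c * (\<integral>x. g x * f x \<partial>lebesgue) \<le>
      max (?c * m powr (1 - 1 / p)) (L * m powr (1 - 1 / p + 1 / ?n) / \<epsilon>) * sigma_mod p f \<epsilon>"
    if f: "f \<in> Lp_space (ereal p)" and "charge g a b m p" and \<epsilon>: "\<epsilon> > 0" for f g :: "'a \<Rightarrow> real" and a b m \<epsilon>
  proof -
    interpret charge g a b m p by fact
    obtain M where M: "M \<ge> 0" "\<And>h B. conj_norm_le p h B \<Longrightarrow>
        integrable lebesgue (\<lambda>x. h x * f x) \<and> \<bar>\<integral>x. h x * f x \<partial>lebesgue\<bar> \<le> M * B"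
      using Lp_pairing_conj_norm[OF f p] by blast
    define I where "I = (\<integral>x. g x * f x \<partial>lebesgue)"
    define S where "S = sigma_mod p f \<epsilon>"
    define B where "B = L * m powr (1 - 1 / p + 1 / ?n) / \<epsilon>"
    have step: "?c * I - (M + 1) * \<eta> \<le> max (?c * m powr (1 - 1 / p) + \<eta>) B * S" if \<eta>: "\<eta> > 0" for \<eta>
    proof -
      have "((\<lambda>R. m * (C * R powr (- ?n / p))) \<longlongrightarrow> m * (C * 0)) at_top"
        using p by (intro tendsto_intros tendsto_neg_powr filterlim_ident) (auto simp: divide_neg_pos)
      then have "\<forall>\<^sub>F R in at_top. m * (C * R powr (- ?n / p)) < \<eta>"
        using \<eta> by (intro order_tendstoD) auto
      then have "\<forall>\<^sub>F R in at_top. R > 0 \<and> m * (C * R powr (- ?n / p)) < \<eta>"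
        using eventually_gt_at_top[of 0] by eventually_elim auto
      then obtain R where R: "R > 0" "m * (C * R powr (- ?n / p)) < \<eta>"
        using eventually_happens'[OF trivial_limit_at_top_linorder] by blast
      define G where "G \<delta> x = (\<integral>y. g y * (mollifier \<delta> (x - y) * cutoff (((x - y) \<bullet> (x - y) / R\<^sup>2) ^ DIM('a))) \<partial>lborel)" for \<delta> x
      define d where "d k = 1 / real (Suc k)" for k
      have d: "d \<longlonglongrightarrow> 0" "\<And>k. d k > 0"
        unfolding d_def[abs_def] using LIMSEQ_inverse_real_of_nat by (auto simp: inverse_eq_divide)
      have "(\<lambda>k. \<integral>x. G (d k) x * f x \<partial>lebesgue) \<longlonglongrightarrow> ?c * I"
        unfolding G_def I_def by (rule mollified_pairing_tendsto[OF f R(1) d])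
      then have "\<forall>\<^sub>F k in sequentially. (\<integral>x. G (d k) x * f x \<partial>lebesgue) > ?c * I - \<eta>"
        using \<eta> by (intro order_tendstoD) auto
      then obtain k where k: "(\<integral>x. G (d k) x * f x \<partial>lebesgue) > ?c * I - \<eta>"
        using eventually_happens'[OF sequentially_bot] by blast
      define P where "P = potential (d k) R"
      have G: "conj_norm_le p (G (d k)) (?c * m powr (1 - 1 / p))"
        unfolding G_def by (rule conj_norm_mollified[OF d(2) R(1)])
      have E: "conj_norm_le p (\<lambda>x. divergence P x - G (d k) x) (m * (C * R powr (- ?n / p)))"
        unfolding G_def P_def by (rule C[OF d(2) R(1)]) fact
      have "conj_norm_le p (\<lambda>x. G (d k) x + (divergence P x - G (d k) x)) (?c * m powr (1 - 1 / p) + m * (C * R powr (- ?n / p)))"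
        by (rule conj_norm_le_add[OF G E p])
      then have D: "conj_norm_le p (divergence P) (?c * m powr (1 - 1 / p) + \<eta>)"
        using R(2) divergence_potential_measurable[OF d(2)] p
        by (elim conj_norm_le_mono) (auto simp: P_def)
      have N: "conj_norm_le p (\<lambda>x. norm (P x)) (L * m powr (1 - 1 / p + 1 / ?n))"
        unfolding P_def by (rule L(3)[OF _ d(2) R(1)]) fact
      have "(\<integral>x. divergence P x * f x \<partial>lebesgue) \<le> max (?c * m powr (1 - 1 / p) + \<eta>) B * S"
        unfolding B_def S_def
        by (rule sigma_mod_upper[OF f p _ N D \<epsilon>]) (simp add: P_def potential_Cinf[OF d(2) R(1)])
      moreover have "(\<integral>x. divergence P x * f x \<partial>lebesgue) =
          (\<integral>x. G (d k) x * f x + (divergence P x - G (d k) x) * f x \<partial>lebesgue)"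
        by (simp add: algebra_simps)
      moreover have "\<dots> = (\<integral>x. G (d k) x * f x \<partial>lebesgue) + (\<integral>x. (divergence P x - G (d k) x) * f x \<partial>lebesgue)"
        using M(2)[OF G] M(2)[OF E] by (intro Bochner_Integration.integral_add) auto
      moreover have "\<bar>\<integral>x. (divergence P x - G (d k) x) * f x \<partial>lebesgue\<bar> \<le> M * \<eta>"
        using M(2)[OF E] mult_left_mono[OF less_imp_le[OF R(2)] M(1)] by linarith
      ultimately show ?thesis
        using k by (simp add: algebra_simps)
    qed
    have "?c * I - (M + 1) * 0 \<le> max (?c * m powr (1 - 1 / p) + 0) B * S"
    proof (rule tendsto_le[OF trivial_limit_at_right_real])
      show "((\<lambda>\<eta>. ?c * I - (M + 1) * \<eta>) \<longlongrightarrow> ?c * I - (M + 1) * 0) (at_right 0)"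
        by (intro tendsto_intros)
      show "((\<lambda>\<eta>. max (?c * m powr (1 - 1 / p) + \<eta>) B * S) \<longlongrightarrow> max (?c * m powr (1 - 1 / p) + 0) B * S) (at_right 0)"
        by (intro tendsto_intros)
      show "\<forall>\<^sub>F \<eta> in at_right 0. ?c * I - (M + 1) * \<eta> \<le> max (?c * m powr (1 - 1 / p) + \<eta>) B * S"
        using step eventually_at_right_less[of 0] by (auto elim: eventually_mono)
    qed
    then show ?thesis by (simp add: I_def B_def S_def)
  qed
  with L(1,2) show ?thesis by blast
qed

text \<open>\<open>infdist x {}\<close> is 0, so without the case distinction the empty set would
  get the constant 1. The slope \<open>Suc j\<close> is at least 1, which keeps all supports within
  distance 1 of \<open>K\<close>.\<close>

definition compact_bump :: "'a::euclidean_space set \<Rightarrow> nat \<Rightarrow> 'a \<Rightarrow> real" where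
  "compact_bump K j x = (if K = {} then 0 else max 0 (1 - real (Suc j) * infdist x K))"

lemma compact_bump_bounds: "0 \<le> compact_bump K j x" "compact_bump K j x \<le> 1"
  by (simp_all add: compact_bump_def infdist_nonneg)

lemma compact_bump_continuous: "continuous_on UNIV (compact_bump K j)"
  unfolding compact_bump_def[abs_def] by (cases "K = {}") (auto intro!: continuous_intros)

lemma compact_bump_ge_indicator: "indicator K x \<le> compact_bump K j x"
  by (auto simp: compact_bump_def indicator_def infdist_nonneg)

lemma compact_bump_tendsto:
  assumes "compact K"
  shows "(\<lambda>j. compact_bump K j x) \<longlonglongrightarrow> indicator K x"
proof (cases "x \<in> K")
  case True
  then have "compact_bump K j x = 1" for j
    by (auto simp: compact_bump_def)
  with True show ?thesis by simp
next
  case False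
  show ?thesis
  proof (cases "K = {}")
    case nonempty: False
    then have d: "infdist x K > 0"
      using False assms in_closed_iff_infdist_zero[OF compact_imp_closed[OF assms] nonempty, of x] infdist_nonneg[of x K]
      by linarith
    obtain N where N: "1 / infdist x K < real N" using reals_Archimedean2 by blast
    have "compact_bump K j x = 0" if "j \<ge> N" for j
    proof -
      have "1 < real N * infdist x K" using N d by (simp add: field_simps)
      also have "\<dots> \<le> real (Suc j) * infdist x K" using that d by (intro mult_right_mono) auto
      finally show ?thesis using nonempty by (simp add: compact_bump_def)
    qed
    then have "\<forall>\<^sub>F j in sequentially. compact_bump K j x = 0"
      using eventually_sequentially by blast
    then show ?thesis using False by (simp add: tendsto_eventually)
  qed (simp add: compact_bump_def)
qed

lemma compact_bump_support:
  assumes "compact K"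
  shows "\<exists>r. \<forall>j x. norm x > r \<longrightarrow> compact_bump K j x = 0"
proof -
  obtain r where r: "\<And>y. y \<in> K \<Longrightarrow> norm y \<le> r"
    using compact_imp_bounded[OF assms] unfolding bounded_iff by blast
  have "compact_bump K j x = 0" if "norm x > r + 1" for j x
  proof (cases "K = {}")
    case False
    have "infdist x K \<ge> 1"
      unfolding infdist_notempty[OF False]
    proof (rule cINF_greatest[OF False])
      fix y assume "y \<in> K"
      then show "1 \<le> dist x y"
        using r[of y] that norm_triangle_ineq2[of x y] by (simp add: dist_norm)
    qed
    then have "real (Suc j) * infdist x K \<ge> 1 * 1" by (intro mult_mono) auto
    then show ?thesis using False by (simp add: compact_bump_def)
  qed (simp add: compact_bump_def)
  then show ?thesis by blast
qed

text \<open>The sign pattern \<open>indicator K1 x - indicator K2 x\<close> is in general not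
  continuous; it is the limit of differences of bumps, along which both sides of
  \<open>bound\<close> converge. Paired with \<open>f\<close> it yields at least
  \<open>h * m\<close>.\<close>

lemma compact_pair_sigma_bound:
  fixes f :: "'a::euclidean_space \<Rightarrow> real"
  assumes bound: "\<And>(g::'a \<Rightarrow> real) a b m. charge g a b m p \<Longrightarrow>
      c * (\<integral>x. g x * f x \<partial>lebesgue) \<le> max (c * m powr s) (L * m powr s') * S"
    and p: "p \<ge> 1" and c: "c > 0" and f: "f \<in> Lp_space (ereal p)" and h: "h > 0"
    and K: "compact K1" "compact K2" "\<And>x. x \<in> K1 \<Longrightarrow> f x > h" "\<And>x. x \<in> K2 \<Longrightarrow> f x < - h"
    and m: "m = measure lebesgue K1 + measure lebesgue K2" "m > 0"
  shows "c * (h * m) \<le> max (c * m powr s) (L * m powr s') * S"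
proof -
  obtain r1 r2 where r: "\<And>j x. norm x > r1 \<Longrightarrow> compact_bump K1 j x = 0" "\<And>j x. norm x > r2 \<Longrightarrow> compact_bump K2 j x = 0"
    using compact_bump_support[OF K(1)] compact_bump_support[OF K(2)] by metis
  obtain b where b: "cball (0::'a) (max r1 r2) \<subseteq> cbox (- b) b"
    using bounded_subset_cbox_symmetric[OF bounded_cball] by blast
  have zero: "compact_bump K1 j x = 0" "compact_bump K2 j x = 0" if "x \<notin> cbox (- b) b" for j x
    using that b r[of x] by force+
  have [measurable]: "f \<in> borel_measurable lebesgue" using f by (simp add: Lp_space_def)
  have bm [measurable]: "compact_bump K j \<in> borel_measurable borel" for K j
    by (rule borel_measurable_continuous_onI[OF compact_bump_continuous])
  have bl [measurable]: "compact_bump K j \<in> borel_measurable lebesgue" for K :: "'a set" and j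
    by (intro measurable_completion) simp
  have Kb [measurable]: "K1 \<in> sets borel" "K2 \<in> sets borel"
    using K by (auto intro: borel_compact)
  have Kl [measurable]: "K1 \<in> sets lebesgue" "K2 \<in> sets lebesgue"
    using Kb by auto
  have box_int: "integrable lborel (indicator (cbox (- b) b) :: 'a \<Rightarrow> real)"
    using emeasure_bounded_finite[OF bounded_cbox[of "- b" b]] by (intro integrable_real_indicator) auto
  have ind_le: "\<bar>compact_bump K1 j x\<bar> \<le> indicator (cbox (- b) b) x" "\<bar>compact_bump K2 j x\<bar> \<le> indicator (cbox (- b) b) x" for j x
    using zero[of x j] compact_bump_bounds[of K1 j x] compact_bump_bounds[of K2 j x] by (auto simp: indicator_def)
  have cb_int: "integrable lborel (compact_bump K1 j)" "integrable lborel (compact_bump K2 j)" for j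
    using ind_le by (auto intro!: Bochner_Integration.integrable_bound[OF box_int] AE_I2)
  define g where "g j x = compact_bump K1 j x - compact_bump K2 j x" for j x
  define M where "M j = (\<integral>x. compact_bump K1 j x \<partial>lborel) + (\<integral>x. compact_bump K2 j x \<partial>lborel)" for j
  have lim: "(\<lambda>j. \<integral>x. compact_bump K j x \<partial>lborel) \<longlonglongrightarrow> (\<integral>x. indicator K x \<partial>lborel)"
    if "compact K" "\<And>j x. \<bar>compact_bump K j x\<bar> \<le> indicator (cbox (- b) b) x" for K
  proof (rule integral_dominated_convergence[OF _ _ box_int])
    show "AE x in lborel. (\<lambda>j. compact_bump K j x) \<longlonglongrightarrow> indicator K x"
      by (intro AE_I2 compact_bump_tendsto that)
    show "AE x in lborel. norm (compact_bump K j x) \<le> indicator (cbox (- b) b) x" for j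
      using that(2) by (intro AE_I2) simp
  qed (use borel_compact[OF that(1)] in auto)
  have meas: "(\<integral>x. indicator K1 x \<partial>lborel) = measure lebesgue K1" "(\<integral>x. indicator K2 x \<partial>lborel) = measure lebesgue K2"
    using Kb by simp_all
  have Mlim: "M \<longlonglongrightarrow> m"
    unfolding M_def[abs_def] m(1) using tendsto_add[OF lim[OF K(1) ind_le(1)] lim[OF K(2) ind_le(2)]] by (simp only: meas)
  \<comment> \<open>Approximation from above keeps the masses positive, as the locale
    requires.\<close>
  have Mm: "M j \<ge> m" for j
  proof -
    have "(\<integral>x. indicator K1 x \<partial>lborel) \<le> (\<integral>x. compact_bump K1 j x \<partial>lborel)"
      by (rule integral_mono'[OF cb_int(1)]) (auto simp: compact_bump_ge_indicator compact_bump_bounds)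
    moreover have "(\<integral>x. indicator K2 x \<partial>lborel) \<le> (\<integral>x. compact_bump K2 j x \<partial>lborel)"
      by (rule integral_mono'[OF cb_int(2)]) (auto simp: compact_bump_ge_indicator compact_bump_bounds)
    ultimately show ?thesis unfolding m(1) M_def meas by simp
  qed
  have charge: "charge (g j) (- b) b (M j) p" for j
  proof
    show "continuous_on UNIV (g j)"
      unfolding g_def[abs_def] by (intro continuous_intros compact_bump_continuous)
    show "g j y = 0" if "y \<notin> cbox (- b) b" for y
      using zero[OF that] by (simp add: g_def)
    show "\<bar>g j y\<bar> \<le> 1" for y
      using compact_bump_bounds[of K1 j y] compact_bump_bounds[of K2 j y] by (simp add: g_def)
    show "0 < M j" using Mm[of j] m by linarith
    have "(\<integral>y. \<bar>g j y\<bar> \<partial>lborel) \<le> (\<integral>y. compact_bump K1 j y + compact_bump K2 j y \<partial>lborel)"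
    proof (rule integral_mono')
      show "\<bar>g j y\<bar> \<le> compact_bump K1 j y + compact_bump K2 j y" for y
        using compact_bump_bounds[of K1 j y] compact_bump_bounds[of K2 j y] by (simp add: g_def)
    qed (use cb_int in \<open>auto intro: add_nonneg_nonneg compact_bump_bounds\<close>)
    also have "\<dots> = M j" unfolding M_def by (rule Bochner_Integration.integral_add[OF cb_int])
    finally show "(\<integral>y. \<bar>g j y\<bar> \<partial>lborel) \<le> M j" .
  qed (fact p)
  have int_f: "integrable lebesgue (\<lambda>x. indicator (cbox (- b) b) x * f x)"
    by (rule integrable_indicator_Lp[OF f p]) auto
  have K_box: "x \<in> cbox (- b) b" if "x \<in> K1 \<or> x \<in> K2" for x
    using that zero[of x 0] compact_bump_ge_indicator[of K1 x 0] compact_bump_ge_indicator[of K2 x 0] by force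
  have limf: "(\<lambda>j. \<integral>x. g j x * f x \<partial>lebesgue) \<longlonglongrightarrow> (\<integral>x. (indicator K1 x - indicator K2 x) * f x \<partial>lebesgue)"
  proof (rule integral_dominated_convergence[where w="\<lambda>x. \<bar>indicator (cbox (- b) b) x * f x\<bar>"])
    show "AE x in lebesgue. (\<lambda>j. g j x * f x) \<longlonglongrightarrow> (indicator K1 x - indicator K2 x) * f x"
      unfolding g_def by (intro AE_I2 tendsto_intros compact_bump_tendsto K)
    fix j
    show "AE x in lebesgue. norm (g j x * f x) \<le> \<bar>indicator (cbox (- b) b) x * f x\<bar>"
    proof (rule AE_I2)
      fix x :: 'a
      have "\<bar>g j x\<bar> \<le> indicator (cbox (- b) b) x"
        using zero[of x j] compact_bump_bounds[of K1 j x] compact_bump_bounds[of K2 j x]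
        by (auto simp: g_def indicator_def)
      then show "norm (g j x * f x) \<le> \<bar>indicator (cbox (- b) b) x * f x\<bar>"
        by (simp add: abs_mult mult_right_mono)
    qed
    show "(\<lambda>x. g j x * f x) \<in> borel_measurable lebesgue"
      unfolding g_def by measurable
  qed (use int_f in auto)
  have low: "h * m \<le> (\<integral>x. (indicator K1 x - indicator K2 x) * f x \<partial>lebesgue)"
  proof -
    have fin: "emeasure lebesgue K1 < \<infinity>" "emeasure lebesgue K2 < \<infinity>"
      using emeasure_bounded_finite[OF compact_imp_bounded[OF K(1)]]
        emeasure_bounded_finite[OF compact_imp_bounded[OF K(2)]] Kb by auto
    then have ii: "integrable lebesgue (indicator K1 :: 'a \<Rightarrow> real)" "integrable lebesgue (indicator K2 :: 'a \<Rightarrow> real)"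
      using Kl by auto
    have "h * m = (\<integral>x. h * (indicator K1 x + indicator K2 x) \<partial>lebesgue)"
      using ii by (simp add: m(1))
    also have "\<dots> \<le> (\<integral>x. (indicator K1 x - indicator K2 x) * f x \<partial>lebesgue)"
    proof (rule integral_mono)
      show "integrable lebesgue (\<lambda>x. h * (indicator K1 x + indicator K2 x))" using ii by simp
      show "integrable lebesgue (\<lambda>x. (indicator K1 x - indicator K2 x) * f x)"
      proof (rule Bochner_Integration.integrable_bound[OF int_f])
        show "AE x in lebesgue. norm ((indicator K1 x - indicator K2 x) * f x) \<le> norm (indicator (cbox (- b) b) x * f x)"
          using K_box by (intro AE_I2) (auto simp: indicator_def)
      qed measurable
      fix x
      show "h * (indicator K1 x + indicator K2 x) \<le> (indicator K1 x - indicator K2 x) * f x"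
        using K(3)[of x] K(4)[of x] h by (auto simp: indicator_def)
    qed
    finally show ?thesis .
  qed
  have "c * (\<integral>x. (indicator K1 x - indicator K2 x) * f x \<partial>lebesgue) \<le> max (c * m powr s) (L * m powr s') * S"
  proof (rule LIMSEQ_le)
    show "(\<lambda>j. c * (\<integral>x. g j x * f x \<partial>lebesgue)) \<longlonglongrightarrow> c * (\<integral>x. (indicator K1 x - indicator K2 x) * f x \<partial>lebesgue)"
      by (intro tendsto_intros limf)
    show "(\<lambda>j. max (c * M j powr s) (L * M j powr s') * S) \<longlonglongrightarrow> max (c * m powr s) (L * m powr s') * S"
      using m(2) by (intro tendsto_intros Mlim) auto
    show "\<exists>N. \<forall>j\<ge>N. c * (\<integral>x. g j x * f x \<partial>lebesgue) \<le> max (c * M j powr s) (L * M j powr s') * S"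
      using bound[OF charge] by blast
  qed
  moreover have "c * (h * m) \<le> c * (\<integral>x. (indicator K1 x - indicator K2 x) * f x \<partial>lebesgue)"
    using low c by (intro mult_left_mono) auto
  ultimately show ?thesis by linarith
qed

section \<open>Level sets and rearrangement\<close>

text \<open>Fubini is applied on a product of Borel spaces. So \<open>F\<close> is first replaced by
  a nonnegative Borel function equal to it almost everywhere, which preserves the measures of the
  level sets.\<close>

lemma nn_integral_layer_cake:
  fixes F :: "'a::euclidean_space \<Rightarrow> real"
  assumes [measurable]: "F \<in> borel_measurable lebesgue" and nonneg: "\<And>x. F x \<ge> 0"
  shows "(\<integral>\<^sup>+x. ennreal (F x) \<partial>lebesgue) =
    (\<integral>\<^sup>+s. emeasure lebesgue {x. F x > s} * indicator {0..} s \<partial>lborel)"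
proof -
  obtain F' where F': "F' \<in> borel_measurable lborel" "AE x in lborel. F x = F' x"
    using completion_ex_borel_measurable_real[OF assms(1)] by blast
  have level: "{x. s < F x} \<in> sets lebesgue" for s
    using borel_measurable_iff_greater[THEN iffD1, OF assms(1), rule_format, of s] by simp
  define H where "H x = max 0 (F' x)" for x
  have [measurable]: "H \<in> borel_measurable borel"
    using F'(1) unfolding H_def by measurable
  have FH: "AE x in lebesgue. F x = H x"
    using F'(2) nonneg unfolding H_def
    by (intro AE_completion) (metis (mono_tags, lifting) eventually_mono max.absorb2)
  have H0: "H x \<ge> 0" for x by (simp add: H_def)
  have "(\<integral>\<^sup>+x. ennreal (F x) \<partial>lebesgue) = (\<integral>\<^sup>+x. ennreal (H x) \<partial>lborel)"
    using FH by (subst nn_integral_cong_AE[where v="\<lambda>x. ennreal (H x)"])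
      (auto simp: nn_integral_completion)
  also have "\<dots> = (\<integral>\<^sup>+x. \<integral>\<^sup>+s. indicator {0..<H x} s \<partial>lborel \<partial>lborel)"
    using H0 by simp
  also have "\<dots> = (\<integral>\<^sup>+x. \<integral>\<^sup>+s. indicator {z. 0 \<le> snd z \<and> snd z < H (fst z)} (x, s) \<partial>lborel \<partial>lborel)"
    by (intro nn_integral_cong) (auto simp: indicator_def)
  also have "\<dots> = (\<integral>\<^sup>+s. \<integral>\<^sup>+x. indicator {z. 0 \<le> snd z \<and> snd z < H (fst z)} (x, s) \<partial>lborel \<partial>lborel)"
    by (rule lborel_pair.Fubini'[symmetric]) measurable
  also have "\<dots> = (\<integral>\<^sup>+s. emeasure lebesgue {x. F x > s} * indicator {0..} s \<partial>lborel)"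
  proof (intro nn_integral_cong)
    fix s :: real
    have "emeasure lebesgue {x. F x > s} = emeasure lebesgue {x. H x > s}"
      by (rule emeasure_eq_AE) (use FH level in \<open>auto intro: measurable_completion\<close>)
    also have "\<dots> = emeasure lborel {x. H x > s}"
      by simp
    also have "\<dots> = (\<integral>\<^sup>+x. indicator {x. H x > s} x \<partial>lborel)"
      by simp
    finally have "emeasure lebesgue {x. F x > s} * indicator {0..} s =
       (\<integral>\<^sup>+x. indicator {x. H x > s} x * indicator {0..} s \<partial>lborel)"
      by (simp add: nn_integral_multc)
    also have "\<dots> = (\<integral>\<^sup>+x. indicator {z. 0 \<le> snd z \<and> snd z < H (fst z)} (x, s) \<partial>lborel)"
      by (intro nn_integral_cong) (auto simp: indicator_def)
    finally show "(\<integral>\<^sup>+x. indicator {z. 0 \<le> snd z \<and> snd z < H (fst z)} (x, s) \<partial>lborel) =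
       emeasure lebesgue {x. F x > s} * indicator {0..} s" by simp
  qed
  finally show ?thesis .
qed

text \<open>The interval from T to 2 T alone gives the right order, and constants do not affect
  finiteness.\<close>

lemma nn_integral_powr_atLeast_ge:
  fixes p T :: real
  assumes "p > 0" "T > 0"
  shows "ennreal (2 powr (- 1 - p) * T powr (- p)) \<le>
    (\<integral>\<^sup>+t. ennreal (t powr (- 1 - p)) * indicator {T..} t \<partial>lborel)"
proof -
  have "ennreal (2 powr (- 1 - p) * T powr (- p)) = ennreal ((2 * T) powr (- 1 - p) * T)"
    using assms powr_add[of T "- 1 - p" 1] by (simp add: powr_mult)
  also have "\<dots> = (\<integral>\<^sup>+t. ennreal ((2 * T) powr (- 1 - p)) * indicator {T..2*T} t \<partial>lborel)"
    using assms by (simp add: nn_integral_cmult_indicator ennreal_mult)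
  also have "\<dots> \<le> (\<integral>\<^sup>+t. ennreal (t powr (- 1 - p)) * indicator {T..} t \<partial>lborel)"
    using assms by (intro nn_integral_mono) (auto simp: indicator_def intro!: ennreal_leI powr_mono2')
  finally show ?thesis .
qed

text \<open>
  With \<open>F = U(|f|)\<close> this converts a bound of the rearrangement of \<open>f\<close> by \<open>G\<close> into the integrability
  statement; \<open>G\<close> need not be measurable, because the superlevel sets of \<open>F\<close> separate the two sides.
\<close>

lemma nn_integral_finite_of_rearrangement_bound:
  fixes F :: "'a::euclidean_space \<Rightarrow> real" and G :: "real \<Rightarrow> real"
  assumes p: "p > 0" and \<kappa>: "\<kappa> > 0" and N: "N > 0"
    and [measurable]: "F \<in> borel_measurable lebesgue" "E \<in> sets lebesgue" and nonneg: "\<And>x. F x \<ge> 0"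
    and E: "emeasure lebesgue E < \<infinity>"
    and bound: "\<And>t s. t \<ge> N \<Longrightarrow> s \<ge> 0 \<Longrightarrow> emeasure lebesgue {x. F x > s} > ennreal (\<kappa> * t powr (- p)) \<Longrightarrow> s \<le> G t"
    and fin: "(\<integral>\<^sup>+t\<in>{N..}. ennreal (t powr (- 1 - p) * G t) \<partial>lebesgue) < \<infinity>"
  shows "(\<integral>\<^sup>+x\<in>E. ennreal (F x) \<partial>lebesgue) < \<infinity>"
proof -
  define \<mu> where "\<mu> s = emeasure lebesgue {x. F x > s}" for s
  \<comment> \<open>\<open>J s\<close> integrates t^(-1-p) over those t at which
    \<open>bound\<close> applies to level \<open>s\<close>. In one order of integration s stays in
    [0, G t]; in the other, \<open>J s\<close> dominates a multiple of the measure of the level set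
    within \<open>E\<close>.\<close>
  define J where "J s = (\<integral>\<^sup>+t. ennreal (t powr (- 1 - p)) * indicator {N..} t *
      indicator {z. ennreal (\<kappa> * fst z powr (- p)) < \<mu> (snd z) \<and> 0 \<le> snd z} (t, s) \<partial>lborel)" for s
  have level: "{x. s < F x} \<in> sets lebesgue" for s
    using borel_measurable_iff_greater[THEN iffD1, OF \<open>F \<in> borel_measurable lebesgue\<close>, rule_format, of s] by simp
  have "antimono \<mu>"
    unfolding \<mu>_def by (intro antimonoI emeasure_mono level) auto
  then have [measurable]: "\<mu> \<in> borel_measurable borel"
  proof (intro borel_measurableI_greater)
    fix y
    show "{x \<in> space borel. y < \<mu> x} \<in> sets borel"
    proof -
      have "is_interval {x. y < \<mu> x}"
        unfolding is_interval_1 using antimonoD[OF \<open>antimono \<mu>\<close>] by (auto intro: less_le_trans)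
      then show ?thesis by (simp add: real_interval_borel_measurable)
    qed
  qed
  define m0 where "m0 = measure lebesgue E"
  have m0: "emeasure lebesgue E = ennreal m0"
    unfolding m0_def using E by (intro emeasure_eq_ennreal_measure) auto
  have "(\<integral>\<^sup>+s. J s \<partial>lborel) = (\<integral>\<^sup>+t. \<integral>\<^sup>+s. ennreal (t powr (- 1 - p)) * indicator {N..} t *
      indicator {z. ennreal (\<kappa> * fst z powr (- p)) < \<mu> (snd z) \<and> 0 \<le> snd z} (t, s) \<partial>lborel \<partial>lborel)"
    unfolding J_def by (rule lborel_pair.Fubini') measurable
  also have "\<dots> \<le> (\<integral>\<^sup>+t\<in>{N..}. ennreal (t powr (- 1 - p) * G t) \<partial>lborel)"
  proof (intro nn_integral_mono)
    fix t :: real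
    show "(\<integral>\<^sup>+s. ennreal (t powr (- 1 - p)) * indicator {N..} t *
      indicator {z. ennreal (\<kappa> * fst z powr (- p)) < \<mu> (snd z) \<and> 0 \<le> snd z} (t, s) \<partial>lborel)
      \<le> ennreal (t powr (- 1 - p) * G t) * indicator {N..} t"
    proof (cases "t \<ge> N")
      case True
      have "(\<integral>\<^sup>+s. ennreal (t powr (- 1 - p)) * indicator {N..} t *
        indicator {z. ennreal (\<kappa> * fst z powr (- p)) < \<mu> (snd z) \<and> 0 \<le> snd z} (t, s) \<partial>lborel)
        \<le> (\<integral>\<^sup>+s. ennreal (t powr (- 1 - p)) * indicator {0..G t} s \<partial>lborel)"
        using True bound[OF True] by (intro nn_integral_mono) (auto simp: indicator_def \<mu>_def)
      also have "\<dots> = ennreal (t powr (- 1 - p)) * ennreal (G t)"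
        by (cases "G t \<ge> 0") (simp_all add: nn_integral_cmult_indicator ennreal_neg)
      finally show ?thesis using True by (simp add: ennreal_mult')
    qed simp
  qed
  also have "\<dots> < \<infinity>" using fin by (simp add: nn_integral_completion)
  finally have J_fin: "(\<integral>\<^sup>+s. J s \<partial>lborel) < \<infinity>" .
  have [measurable]: "J \<in> borel_measurable borel"
    unfolding J_def by measurable
  \<comment> \<open>The two entries answer the two cases of \<open>T\<close> below: for T = N the
    bound m \<le> m0 is used, with \<open>m0 + 1\<close> to avoid division by 0; otherwise T^(-p) =
    m / (2 \<kappa>).\<close>
  define c where "c = 2 powr (- 1 - p) * min (N powr (- p) / (m0 + 1)) (1 / (2 * \<kappa>))"
  have m0_nonneg: "m0 \<ge> 0" by (simp add: m0_def)
  have c: "c > 0" using N \<kappa> m0_nonneg by (simp add: c_def)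
  have key: "emeasure lebesgue {x\<in>E. F x > s} \<le> ennreal (1 / c) * J s" if s: "s \<ge> 0" for s
  proof -
    define m where "m = measure lebesgue {x\<in>E. F x > s}"
    have "emeasure lebesgue {x\<in>E. F x > s} \<le> emeasure lebesgue E"
      by (intro emeasure_mono) auto
    then have le: "emeasure lebesgue {x\<in>E. F x > s} \<le> ennreal m0"
      by (simp only: m0)
    then have "emeasure lebesgue {x\<in>E. F x > s} \<noteq> top"
      by (metis ennreal_neq_top top_unique)
    then have em: "emeasure lebesgue {x\<in>E. F x > s} = ennreal m"
      unfolding m_def by (rule emeasure_eq_ennreal_measure)
    have mm0: "m \<le> m0"
      using le m0_nonneg unfolding em by (simp add: ennreal_le_iff)
    have m\<mu>: "ennreal m \<le> \<mu> s"
      unfolding \<mu>_def em[symmetric] by (intro emeasure_mono level) auto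
    show ?thesis
    proof (cases "m > 0")
      case True
      \<comment> \<open>For t \<ge> T one has \<kappa> t^(-p) \<le> m / 2, and the factor 2 secures
        the strict inequality. The finite \<open>m\<close> stands in for \<open>\<mu> s\<close>,
        which may be infinite.\<close>
      define T where "T = max N ((2 * \<kappa> / m) powr (1 / p))"
      have T: "T \<ge> N" "T > 0" using N by (auto simp: T_def)
      have Tp: "T powr (- p) \<ge> min (N powr (- p)) (m / (2 * \<kappa>))"
      proof -
        have "((2 * \<kappa> / m) powr (1 / p)) powr (- p) = m / (2 * \<kappa>)"
          using p \<kappa> True by (simp add: powr_powr powr_minus)
        then show ?thesis by (auto simp: T_def max_def)
      qed
      have small: "ennreal (\<kappa> * t powr (- p)) < \<mu> s" if "t \<ge> T" for t
      proof -
        have "t powr (- p) \<le> ((2 * \<kappa> / m) powr (1 / p)) powr (- p)"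
          using that p \<kappa> True by (intro powr_mono2') (auto simp: T_def)
        also have "\<dots> = m / (2 * \<kappa>)"
          using p \<kappa> True by (simp add: powr_powr powr_minus)
        finally have "\<kappa> * t powr (- p) \<le> m / 2"
          using \<kappa> by (simp add: field_simps)
        also have "\<dots> < m" using True by simp
        finally have "ennreal (\<kappa> * t powr (- p)) < ennreal m"
          using \<kappa> True by (intro ennreal_lessI) auto
        with m\<mu> show ?thesis by simp
      qed
      have "c * m \<le> 2 powr (- 1 - p) * T powr (- p)"
      proof -
        have "m * min (N powr (- p) / (m0 + 1)) (1 / (2 * \<kappa>)) \<le> min (N powr (- p)) (m / (2 * \<kappa>))"
        proof (rule min.boundedI)
          have "m * min (N powr (- p) / (m0 + 1)) (1 / (2 * \<kappa>)) \<le> (m0 + 1) * (N powr (- p) / (m0 + 1))"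
            using True mm0 \<kappa> by (intro mult_mono) auto
          then show "m * min (N powr (- p) / (m0 + 1)) (1 / (2 * \<kappa>)) \<le> N powr (- p)"
            using m0_nonneg by simp
          have "m * min (N powr (- p) / (m0 + 1)) (1 / (2 * \<kappa>)) \<le> m * (1 / (2 * \<kappa>))"
            using True by (intro mult_left_mono) auto
          then show "m * min (N powr (- p) / (m0 + 1)) (1 / (2 * \<kappa>)) \<le> m / (2 * \<kappa>)" by simp
        qed
        then have "2 powr (- 1 - p) * (m * min (N powr (- p) / (m0 + 1)) (1 / (2 * \<kappa>))) \<le> 2 powr (- 1 - p) * T powr (- p)"
          using Tp by (intro mult_left_mono) auto
        then show ?thesis by (simp add: c_def mult_ac)
      qed
      then have "ennreal (c * m) \<le> ennreal (2 powr (- 1 - p) * T powr (- p))"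
        by (rule ennreal_leI)
      also have "\<dots> \<le> (\<integral>\<^sup>+t. ennreal (t powr (- 1 - p)) * indicator {T..} t \<partial>lborel)"
        by (rule nn_integral_powr_atLeast_ge[OF p T(2)])
      also have "\<dots> \<le> J s"
        unfolding J_def using T small s by (intro nn_integral_mono) (auto simp: indicator_def)
      finally have "ennreal (1 / c) * ennreal (c * m) \<le> ennreal (1 / c) * J s"
        by (rule mult_left_mono) simp
      moreover have "ennreal (1 / c) * ennreal (c * m) = ennreal m"
        using c True by (simp add: ennreal_mult[symmetric])
      ultimately show ?thesis using em by simp
    qed (use em in \<open>simp add: ennreal_neg\<close>)
  qed
  have "(\<integral>\<^sup>+x\<in>E. ennreal (F x) \<partial>lebesgue) = (\<integral>\<^sup>+x. ennreal (F x * indicator E x) \<partial>lebesgue)"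
    by (intro nn_integral_cong) (auto simp: indicator_def)
  also have "\<dots> = (\<integral>\<^sup>+s. emeasure lebesgue {x. F x * indicator E x > s} * indicator {0..} s \<partial>lborel)"
    using nonneg by (intro nn_integral_layer_cake) auto
  also have "\<dots> \<le> (\<integral>\<^sup>+s. ennreal (1 / c) * J s \<partial>lborel)"
  proof (rule nn_integral_mono)
    fix s :: real
    have "{x. F x * indicator E x > s} = {x\<in>E. F x > s}" if "s \<ge> 0"
      using that by (auto simp: indicator_def split: if_splits)
    then show "emeasure lebesgue {x. F x * indicator E x > s} * indicator {0..} s \<le> ennreal (1 / c) * J s"
      using key[of s] by (auto simp: indicator_def)
  qed
  also have "\<dots> = ennreal (1 / c) * (\<integral>\<^sup>+s. J s \<partial>lborel)"
    by (rule nn_integral_cmult) measurable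
  also have "\<dots> < \<infinity>"
    using J_fin by (simp add: ennreal_mult_less_top)
  finally show ?thesis .
qed

section \<open>Inner approximation of superlevel sets\<close>

lemma lmeasurable_inner_compact:
  fixes S :: "'a::euclidean_space set"
  assumes "S \<in> sets lebesgue" "bounded S" "e > 0"
  obtains K where "compact K" "K \<subseteq> S" "measure lebesgue S - e < measure lebesgue K"
proof -
  have S: "S \<in> lmeasurable"
    using assms(2,1) by (rule bounded_set_imp_lmeasurable)
  obtain K where K: "closed K" "K \<subseteq> S" "S - K \<in> lmeasurable" "emeasure lebesgue (S - K) < ennreal e"
    using sets_lebesgue_inner_closed[OF assms(1,3)] .
  have cK: "compact K"
    using K assms by (auto simp: compact_eq_bounded_closed intro: bounded_subset)
  have "measure lebesgue (S - K) < e"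
    using K(3,4) assms(3) by (simp add: emeasure_eq_measure2 ennreal_less_iff)
  moreover have "measure lebesgue (S - K) = measure lebesgue S - measure lebesgue K"
    using S lmeasurable_compact[OF cK] K(2) by (intro measurable_measure_Diff) (auto simp: fmeasurableD)
  ultimately show ?thesis
    using cK K(2) by (intro that) auto
qed

text \<open>The superlevel set may have infinite measure, hence the exhaustion by balls before
  compact subsets are taken.\<close>

lemma superlevel_inner_compact:
  fixes f :: "'a::euclidean_space \<Rightarrow> real"
  assumes f: "f \<in> borel_measurable lebesgue" and h: "h > 0" and v: "v \<ge> 0"
    and gt: "emeasure lebesgue {x. \<bar>f x\<bar> > h} > ennreal v"
  obtains K1 K2 where "compact K1" "compact K2" "\<And>x. x \<in> K1 \<Longrightarrow> f x > h" "\<And>x. x \<in> K2 \<Longrightarrow> f x < - h"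
    "measure lebesgue K1 + measure lebesgue K2 > v"
proof -
  define A where "A k = {x. f x > h} \<inter> cball 0 (real k)" for k
  define B where "B k = {x. f x < - h} \<inter> cball 0 (real k)" for k
  have s1: "{x. f x > h} \<in> sets lebesgue"
    using borel_measurable_iff_greater[THEN iffD1, OF f, rule_format, of h] by simp
  have s2: "{x. f x < - h} \<in> sets lebesgue"
    using borel_measurable_iff_less[THEN iffD1, OF f, rule_format, of "- h"] by simp
  have cb: "cball 0 r \<in> sets (lebesgue :: 'a measure)" for r by simp
  have AB: "A k \<in> sets lebesgue" "B k \<in> sets lebesgue" for k
    unfolding A_def B_def using s1 s2 cb by (auto intro: sets.Int)
  have bd: "bounded (A k)" "bounded (B k)" for k
    unfolding A_def B_def by (auto intro: bounded_Int)
  have inc: "incseq (\<lambda>k. A k \<union> B k)"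
    unfolding A_def B_def by (intro incseq_SucI) auto
  have un: "(\<Union>k. A k \<union> B k) = {x. \<bar>f x\<bar> > h}"
  proof (intro equalityI subsetI)
    fix x assume "x \<in> {x. \<bar>f x\<bar> > h}"
    then have "f x > h \<or> f x < - h" by auto
    moreover obtain k where "norm x \<le> real k" using real_arch_simple by blast
    ultimately show "x \<in> (\<Union>k. A k \<union> B k)" by (auto simp: A_def B_def)
  qed (use h in \<open>auto simp: A_def B_def\<close>)
  have rng: "range (\<lambda>k. A k \<union> B k) \<subseteq> sets lebesgue"
    using AB by auto
  have "(SUP k. emeasure lebesgue (A k \<union> B k)) = emeasure lebesgue {x. \<bar>f x\<bar> > h}"
    using SUP_emeasure_incseq[OF rng inc] unfolding un .
  with gt have "ennreal v < (SUP k. emeasure lebesgue (A k \<union> B k))"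
    by (simp only:)
  then obtain k where k: "ennreal v < emeasure lebesgue (A k \<union> B k)"
    unfolding less_SUP_iff by blast
  have lm: "A k \<in> lmeasurable" "B k \<in> lmeasurable"
    by (rule bounded_set_imp_lmeasurable[OF bd(1) AB(1)], rule bounded_set_imp_lmeasurable[OF bd(2) AB(2)])
  have "B k - A k = B k" using h by (auto simp: A_def B_def)
  then have "measure lebesgue (A k \<union> B k) = measure lebesgue (A k) + measure lebesgue (B k)"
    using measure_Un2[OF lm] by (simp only:)
  moreover have "v < measure lebesgue (A k \<union> B k)"
    using k v fmeasurable.Un[OF lm] by (simp add: emeasure_eq_measure2 ennreal_less_iff)
  ultimately have gt: "v < measure lebesgue (A k) + measure lebesgue (B k)" by simp
  \<comment> \<open>Half of the surplus over \<open>v\<close>: a loss of less than \<open>e\<close>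
    on each of the two sets still leaves more than \<open>v\<close>.\<close>
  define e where "e = (measure lebesgue (A k) + measure lebesgue (B k) - v) / 2"
  have e: "e > 0" using gt by (simp add: e_def)
  obtain K1 where K1: "compact K1" "K1 \<subseteq> A k" "measure lebesgue (A k) - e < measure lebesgue K1"
    using lmeasurable_inner_compact[OF AB(1) bd(1) e] .
  obtain K2 where K2: "compact K2" "K2 \<subseteq> B k" "measure lebesgue (B k) - e < measure lebesgue K2"
    using lmeasurable_inner_compact[OF AB(2) bd(2) e] .
  have "measure lebesgue K1 + measure lebesgue K2 > v"
    using K1(3) K2(3) unfolding e_def by (simp add: field_simps)
  then show ?thesis
    using K1 K2 by (intro that[of K1 K2]) (auto simp: A_def B_def)
qed

text \<open>
  Any bound \<open>L\<close> suffices when \<open>p < n\<close>, since \<open>\<kappa>\<close> may be taken large; in the case \<open>n = p = 1\<close> the powers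
  of \<open>\<kappa>\<close> cancel, and one needs \<open>L = 1\<close> to be at most the mass of the mollifier.
\<close>

lemma level_set_sigma_bound:
  fixes f :: "'a::euclidean_space \<Rightarrow> real"
  assumes pn: "(1 \<le> p \<and> p < real DIM('a)) \<or> (DIM('a) = 1 \<and> p = 1)"
    and f: "f \<in> Lp_space (ereal p)"
  shows "\<exists>\<kappa>>0. \<forall>h t. h > 0 \<longrightarrow> t > 0 \<longrightarrow> emeasure lebesgue {x. \<bar>f x\<bar> > h} > ennreal (\<kappa> * t powr (- p)) \<longrightarrow>
     h \<le> t * sigma_mod p f (t powr (- p / real DIM('a)))"
proof -
  let ?n = "real DIM('a)" and ?c = "mollifier_mass TYPE('a)"
  have p: "p \<ge> 1" using pn by auto
  have n: "?n > 0" by simp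
  have c: "?c > 0" by (rule mollifier_mass_pos)
  obtain L where L: "L > 0" "DIM('a) = 1 \<longrightarrow> L = 1" "\<And>(f::'a \<Rightarrow> real) g a b m \<epsilon>. f \<in> Lp_space (ereal p) \<Longrightarrow> charge g a b m p \<Longrightarrow> \<epsilon> > 0 \<Longrightarrow>
    ?c * (\<integral>x. g x * f x \<partial>lebesgue) \<le>
      max (?c * m powr (1 - 1 / p)) (L * m powr (1 - 1 / p + 1 / ?n) / \<epsilon>) * sigma_mod p f \<epsilon>"
    using charge_sigma_bound[OF pn] by blast
  define \<beta> where "\<beta> = 1 / p - 1 / ?n"
  have \<beta>: "\<beta> \<ge> 0" using pn p by (auto simp: \<beta>_def field_simps)
  \<comment> \<open>The first inequality makes the second entry of the maximum the larger one; the
    second absorbs the constants after division by \<open>m\<close>.\<close>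
  obtain \<kappa> where \<kappa>: "\<kappa> > 0" "?c \<le> L * \<kappa> powr (1 / ?n)" "L * \<kappa> powr (- \<beta>) \<le> ?c"
  proof (cases "DIM('a) = 1")
    case True
    then have "\<beta> = 0" "L = 1" using pn L by (auto simp: \<beta>_def)
    \<comment> \<open>For n = 1 and \<open>L = 1\<close>, taking the mass c as \<kappa> turns the
      two requirements into c \<le> c and 1 \<le> c.\<close>
    with True c mollifier_mass_ge_1[OF True] show ?thesis
      by (intro that[of ?c]) auto
  next
    case False
    then have b: "\<beta> > 0" using pn p by (auto simp: \<beta>_def field_simps)
    define \<kappa> where "\<kappa> = max ((?c / L) powr ?n) ((L / ?c) powr (1 / \<beta>))"
    have k: "\<kappa> > 0" using L c by (simp add: \<kappa>_def less_max_iff_disj)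
    have "?c / L = ((?c / L) powr ?n) powr (1 / ?n)"
      using L c by (simp add: powr_powr)
    also have "\<dots> \<le> \<kappa> powr (1 / ?n)"
      by (intro powr_mono2) (auto simp: \<kappa>_def)
    finally have 1: "?c \<le> L * \<kappa> powr (1 / ?n)" using L by (simp add: field_simps)
    have "L / ?c = ((L / ?c) powr (1 / \<beta>)) powr \<beta>"
      using L c b by (simp add: powr_powr)
    also have "\<dots> \<le> \<kappa> powr \<beta>"
      using b by (intro powr_mono2) (auto simp: \<kappa>_def)
    finally have 2: "L * \<kappa> powr (- \<beta>) \<le> ?c"
      using c k by (simp add: powr_minus field_simps)
    from k 1 2 show ?thesis by (rule that)
  qed
  have "h \<le> t * sigma_mod p f (t powr (- p / ?n))"
    if h: "h > 0" and t: "t > 0" and gt: "emeasure lebesgue {x. \<bar>f x\<bar> > h} > ennreal (\<kappa> * t powr (- p))" for h t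
  proof -
    define \<epsilon> where "\<epsilon> = t powr (- p / ?n)"
    define S where "S = sigma_mod p f \<epsilon>"
    have \<epsilon>: "\<epsilon> > 0" using t by (simp add: \<epsilon>_def)
    have fm: "f \<in> borel_measurable lebesgue" using f by (simp add: Lp_space_def)
    have v: "\<kappa> * t powr (- p) > 0" using \<kappa> t by simp
    obtain K1 K2 where K: "compact K1" "compact K2" "\<And>x. x \<in> K1 \<Longrightarrow> f x > h" "\<And>x. x \<in> K2 \<Longrightarrow> f x < - h"
      "measure lebesgue K1 + measure lebesgue K2 > \<kappa> * t powr (- p)"
      using superlevel_inner_compact[OF fm h less_imp_le[OF v] gt] by blast
    define m where "m = measure lebesgue K1 + measure lebesgue K2"
    have mk: "m > \<kappa> * t powr (- p)" using K(5) by (simp add: m_def)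
    have m: "m > 0" using mk v by linarith
    have "?c * (h * m) \<le> max (?c * m powr (1 - 1 / p)) ((L / \<epsilon>) * m powr (1 - 1 / p + 1 / ?n)) * S"
    proof (rule compact_pair_sigma_bound[OF _ p c f h K(1-4) m_def m])
      show "?c * (\<integral>x. g x * f x \<partial>lebesgue) \<le>
          max (?c * M powr (1 - 1 / p)) ((L / \<epsilon>) * M powr (1 - 1 / p + 1 / ?n)) * S"
        if "charge g a b M p" for g a b M
        using L(3)[OF f that \<epsilon>] by (simp add: S_def)
    qed
    moreover have "?c * m powr (1 - 1 / p) \<le> (L / \<epsilon>) * m powr (1 - 1 / p + 1 / ?n)"
    proof -
      have "?c \<le> L * \<kappa> powr (1 / ?n)" by (rule \<kappa>(2))
      also have "\<kappa> powr (1 / ?n) = (\<kappa> * t powr (- p)) powr (1 / ?n) / \<epsilon>"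
        using \<kappa>(1) t by (simp add: \<epsilon>_def powr_mult powr_powr)
      also have "\<dots> \<le> m powr (1 / ?n) / \<epsilon>"
        using mk v \<epsilon> by (intro divide_right_mono powr_mono2) auto
      finally have "?c \<le> L * (m powr (1 / ?n) / \<epsilon>)" using L by simp
      then have "?c * m powr (1 - 1 / p) \<le> L * (m powr (1 / ?n) / \<epsilon>) * m powr (1 - 1 / p)"
        by (rule mult_right_mono) simp
      then show ?thesis by (simp add: powr_add mult_ac)
    qed
    ultimately have main: "?c * (h * m) \<le> (L / \<epsilon>) * m powr (1 - 1 / p + 1 / ?n) * S"
      by (simp add: max_def)
    \<comment> \<open>Positivity is read off from \<open>main\<close>, whose left side is positive;
      the estimates below multiply by \<open>S\<close>.\<close>
    have S: "S > 0"
    proof (rule ccontr)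
      assume "\<not> S > 0"
      then have "(L / \<epsilon>) * m powr (1 - 1 / p + 1 / ?n) * S \<le> 0"
        using L \<epsilon> by (intro mult_nonneg_nonpos) auto
      moreover have "?c * (h * m) > 0" using c h m by simp
      ultimately show False using main by linarith
    qed
    have "m powr (1 - 1 / p + 1 / ?n) = m * m powr (- \<beta>)"
    proof -
      have "1 - 1 / p + 1 / ?n = 1 + (- \<beta>)" by (simp add: \<beta>_def)
      then show ?thesis using m by (simp only: powr_add) simp
    qed
    with main have "m * (?c * h) \<le> m * ((L / \<epsilon>) * m powr (- \<beta>) * S)" by (simp add: mult_ac)
    then have "?c * h \<le> (L / \<epsilon>) * m powr (- \<beta>) * S"
      using m by (simp only: mult_le_cancel_left_pos)
    also have "\<dots> \<le> (L / \<epsilon>) * (\<kappa> * t powr (- p)) powr (- \<beta>) * S"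
      using mk v L \<epsilon> S \<beta> by (intro mult_right_mono mult_left_mono powr_mono2') auto
    also have "\<dots> = (L * \<kappa> powr (- \<beta>)) * (t powr (p * \<beta>) / \<epsilon>) * S"
      using \<kappa>(1) t by (simp add: powr_mult powr_powr)
    \<comment> \<open>The exponents match because p \<beta> + p/n = 1: this is why the measure
      t^(-p) is paired with \<epsilon> = t^(-p/n).\<close>
    also have "t powr (p * \<beta>) / \<epsilon> = t"
    proof -
      have "t powr (p * \<beta>) / \<epsilon> = t powr (p * \<beta> - (- p / ?n))"
        unfolding \<epsilon>_def by (rule powr_diff[symmetric])
      also have "p * \<beta> - (- p / ?n) = 1" using p by (simp add: \<beta>_def field_simps)
      finally show ?thesis using t by simp
    qed
    also have "(L * \<kappa> powr (- \<beta>)) * t * S \<le> ?c * t * S"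
      using \<kappa>(3) t S by (intro mult_right_mono) auto
    finally have "?c * h \<le> ?c * (t * S)" by (simp add: mult_ac)
    then show ?thesis using c by (simp add: S_def \<epsilon>_def)
  qed
  with \<kappa>(1) show ?thesis by blast
qed

section \<open>Integrability of \<open>U \<bar>f x\<bar>\<close>\<close>

lemma const_C_ge_1: "1 \<le> const_C TYPE('a::euclidean_space) p"
  by (simp add: const_C_def)

theorem theorem3p5:
  fixes f :: "real ^ 'n \<Rightarrow> real" and U :: "real \<Rightarrow> real" and p a r N :: real
  assumes "(1 \<le> p \<and> p < real CARD('n)) \<or> (CARD('n) = 1 \<and> p = 1)"
    and "f \<in> Lp_space (ereal p)"
    and "strict_mono_on {0..} U"
    and "continuous_on {0..} U"
    and "\<And>t. t \<ge> 0 \<Longrightarrow> U t \<ge> 0"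
    and "U 0 = 0"
    and "filterlim U at_top at_top"
    and "a > 0" and "r > 0"
    and "\<And>t. 0 < t \<Longrightarrow> t < r \<Longrightarrow> U t \<le> a * t powr p"
    and "N > 0"
    and "(\<integral>\<^sup>+ t \<in> {N..}. ennreal (t powr (- 1 - p) *
            U (const_C TYPE(real ^ 'n) p * t * sigma_mod p f (t powr (- p / real CARD('n))))) \<partial>lebesgue) < \<infinity>"
  shows "(\<integral>\<^sup>+ x. ennreal (U \<bar>f x\<bar>) \<partial>lebesgue) < \<infinity>"
proof -
  let ?C = "const_C TYPE(real ^ 'n) p"
  define \<sigma> where "\<sigma> t = sigma_mod p f (t powr (- p / real CARD('n)))" for t
  have p: "p \<ge> 1" using assms(1) by auto
  have fm [measurable]: "f \<in> borel_measurable lebesgue" using assms(2) by (simp add: Lp_space_def)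
  have mono: "U s \<le> U t" if "0 \<le> s" "s \<le> t" for s t
    using strict_mono_onD[OF assms(3), of s t] that by (cases "s = t") auto
  have Fm [measurable]: "(\<lambda>x. U \<bar>f x\<bar>) \<in> borel_measurable lebesgue"
  proof -
    \<comment> \<open>\<open>U\<close> is continuous on the half-line only; composing with
      \<open>max 0\<close> extends it without changing \<open>U \<bar>f x\<bar>\<close>.\<close>
    have "continuous_on UNIV (\<lambda>y. U (max 0 y))"
      by (rule continuous_on_compose2[OF assms(4)]) (auto intro: continuous_intros)
    then have [measurable]: "(\<lambda>y. U (max 0 y)) \<in> borel_measurable borel"
      by (rule borel_measurable_continuous_onI)
    have "(\<lambda>x. U (max 0 \<bar>f x\<bar>)) \<in> borel_measurable lebesgue" by measurable
    then show ?thesis by simp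
  qed
  obtain \<kappa> where \<kappa>: "\<kappa> > 0" "\<And>h t. h > 0 \<Longrightarrow> t > 0 \<Longrightarrow>
      emeasure lebesgue {x. \<bar>f x\<bar> > h} > ennreal (\<kappa> * t powr (- p)) \<Longrightarrow> h \<le> t * \<sigma> t"
    using level_set_sigma_bound[of p f] assms(1,2) unfolding \<sigma>_def by auto
  \<comment> \<open>Off \<open>E\<close> the growth bound near 0 applies; \<open>E\<close> itself
    has finite measure by Chebyshev's inequality.\<close>
  define E where "E = {x. \<bar>f x\<bar> \<ge> r / 2}"
  have Em [measurable]: "E \<in> sets lebesgue"
    using borel_measurable_iff_ge[THEN iffD1, of "\<lambda>x. \<bar>f x\<bar>" lebesgue, rule_format, of "r / 2"] by (simp add: E_def)
  have fp: "(\<integral>\<^sup>+x. ennreal (\<bar>f x\<bar> powr p) \<partial>lebesgue) < \<infinity>"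
    by (rule Lp_space_powr_finite[OF assms(2)])
  have E_fin: "emeasure lebesgue E < \<infinity>"
  proof -
    have pos: "(r / 2) powr p > 0" using assms(9) by simp
    have "ennreal ((r / 2) powr p) * emeasure lebesgue E = (\<integral>\<^sup>+x. ennreal ((r / 2) powr p) * indicator E x \<partial>lebesgue)"
      by (simp add: nn_integral_cmult_indicator)
    also have "\<dots> \<le> (\<integral>\<^sup>+x. ennreal (\<bar>f x\<bar> powr p) \<partial>lebesgue)"
      using p assms(9) by (intro nn_integral_mono) (auto simp: indicator_def E_def intro!: ennreal_leI powr_mono2)
    finally have "ennreal ((r / 2) powr p) * emeasure lebesgue E < \<infinity>"
      using fp by (rule le_less_trans)
    then show ?thesis using pos by (auto simp: ennreal_mult_less_top)
  qed
  have on_E: "(\<integral>\<^sup>+x\<in>E. ennreal (U \<bar>f x\<bar>) \<partial>lebesgue) < \<infinity>"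
  \<comment> \<open>Truncation by \<open>max 0\<close> supplies the bound at level 0, where the sign
    of the argument of \<open>U\<close> has not been established. The integral is unchanged, since
    \<open>ennreal\<close> sends negative values to 0.\<close>
  proof (rule nn_integral_finite_of_rearrangement_bound[where G="\<lambda>t. max 0 (U (?C * t * \<sigma> t))", OF _ \<kappa>(1) assms(11) Fm Em _ E_fin])
    show "p > 0" using p by simp
    show "0 \<le> U \<bar>f x\<bar>" for x using assms(5) by simp
    have "ennreal (t powr (- 1 - p) * max 0 (U (?C * t * \<sigma> t))) = ennreal (t powr (- 1 - p) * U (?C * t * \<sigma> t))" for t
      by (cases "U (?C * t * \<sigma> t) \<ge> 0") (auto simp: ennreal_neg mult_nonneg_nonpos)
    then show "(\<integral>\<^sup>+t\<in>{N..}. ennreal (t powr (- 1 - p) * max 0 (U (?C * t * \<sigma> t))) \<partial>lebesgue) < \<infinity>"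
      using assms(12) unfolding \<sigma>_def by simp
    fix t s :: real
    assume t: "t \<ge> N" and s: "s \<ge> 0" and gt: "emeasure lebesgue {x. U \<bar>f x\<bar> > s} > ennreal (\<kappa> * t powr (- p))"
    have t0: "t > 0" using t assms(11) by simp
    obtain b where b: "b \<ge> 0" "U b \<ge> s"
      using eventually_conj[OF eventually_ge_at_top[of 0] assms(7)[unfolded filterlim_at_top, rule_format, of s]]
        eventually_happens'[OF trivial_limit_at_top_linorder] by blast
    \<comment> \<open>By the intermediate value theorem each level of
      \<open>U \<bar>f x\<bar>\<close> comes from a level of |f|, to which the bound by
      \<open>\<sigma>\<close> applies.\<close>
    obtain h where h: "h \<ge> 0" "U h = s"
      using IVT'[of U 0 s b] assms(6) s b continuous_on_subset[OF assms(4), of "{0..b}"] by auto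
    have iff: "U y > s \<longleftrightarrow> y > h" if "y \<ge> 0" for y
      using strict_mono_onD[OF assms(3), of h y] mono[of y h] h that by (cases "h < y") auto
    then have eq: "{x. U \<bar>f x\<bar> > s} = {x. \<bar>f x\<bar> > h}" by auto
    show "s \<le> max 0 (U (?C * t * \<sigma> t))"
    proof (cases "h = 0")
      case False
      then have h0: "h > 0" using h by simp
      have "h \<le> t * \<sigma> t" using \<kappa>(2)[OF h0 t0] gt unfolding eq by simp
      \<comment> \<open>Enlarging by the constant is allowed because t \<sigma>(t) \<ge> h >
        0.\<close>
      also have "\<dots> \<le> ?C * (t * \<sigma> t)"
        using mult_right_mono[OF const_C_ge_1[where 'a="real ^ 'n", of p], of "t * \<sigma> t"] h0 \<open>h \<le> t * \<sigma> t\<close> by simp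
      finally have "U h \<le> U (?C * t * \<sigma> t)"
        using h by (intro mono) (auto simp: mult.assoc)
      then show ?thesis using h by simp
    qed (use h assms(6) in simp)
  qed
  have "(\<integral>\<^sup>+x. ennreal (U \<bar>f x\<bar>) \<partial>lebesgue) \<le>
      (\<integral>\<^sup>+x. ennreal (U \<bar>f x\<bar>) * indicator E x + ennreal a * ennreal (\<bar>f x\<bar> powr p) \<partial>lebesgue)"
  proof (intro nn_integral_mono)
    fix x
    \<comment> \<open>The growth hypothesis says nothing at 0; there \<open>U 0 = 0\<close> is
      used.\<close>
    have "U \<bar>f x\<bar> \<le> a * \<bar>f x\<bar> powr p" if "x \<notin> E"
      using assms(6,9) assms(10)[of "\<bar>f x\<bar>"] that by (cases "f x = 0") (auto simp: E_def)
    then show "ennreal (U \<bar>f x\<bar>) \<le> ennreal (U \<bar>f x\<bar>) * indicator E x + ennreal a * ennreal (\<bar>f x\<bar> powr p)"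
      using assms(8) by (cases "x \<in> E") (auto simp: ennreal_leI simp flip: ennreal_mult')
  qed
  also have "\<dots> = (\<integral>\<^sup>+x\<in>E. ennreal (U \<bar>f x\<bar>) \<partial>lebesgue) + ennreal a * (\<integral>\<^sup>+x. ennreal (\<bar>f x\<bar> powr p) \<partial>lebesgue)"
    by (subst nn_integral_add) (auto simp: nn_integral_cmult)
  also have "\<dots> < \<infinity>"
    using on_E fp by (simp add: ennreal_mult_less_top)
  finally show ?thesis .
qed

end
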